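(* Let $W$ be a singular memoryless channel with fixed input distribution $P_X$, satisfying the standing assumptions in the context, and let $R_{\mathrm{crit}}<R<I(X;Y)$ be fixed. Then, as $n\to\infty$, $$ P_{\mathrm{RC}}(n)=\begin{cases} \dfrac{(1+o(1))\,\psi^{(\mathrm s)}_{\rho,h'}(na')}{\sqrt{2\pi n}\,\sigma_{00}}\;e^{-nE_r(R)}, & \text{if }(W,R)\text{ is }(h',a')\text{-lattice},\\[3mm] \dfrac{(1+o(1))\,\psi^{(\mathrm s)}_{\rho}}{\sqrt{2\pi n}\,\sigma_{00}}\;e^{-nE_r(R)}, & \text{if }(W,R)\text{ is nonlattice}. \end{cases} $$
   Context: Channel. A memoryless channel has input alphabet $\mathcal X$, output alphabet $\mathcal Y$ and output distributions $W(\cdot|x)$, $x\in\mathcal X$, all absolutely continuous with respect to a common base measure $Q$; $W(y|x)$ also denotes the density $\frac{dW(\cdot|x)}{dQ}(y)$. Fix an input distribution $P_X$ on $\mathcal X$. Let $X\sim P_X$, let $Y\sim W(\cdot|X)$ given $X$, and let $X'\sim P_X$ be independent of $(X,Y)$. Put $\nu(X,Y,x')=\log\frac{W(Y|x')}{W(Y|X)}\in[-\infty,\infty)$, which is well defined almost surely. $\mathrm E_{X'}$ denotes expectation over $X'$ for given $(X,Y)$. It is assumed that $I(X;Y)=\mathrm E_{XY}[-\log \mathrm E_{X'}[e^{\nu(X,Y,X')}]]<\infty$. Random code. The code of blocklength $n$ and rate $R=(\log M)/n$ has $M$ codewords in $\mathcal X^n$, all of whose letters are i.i.d. from $P_X$.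 A codeword is sent over $n$ independent uses of $W$ and decoded by maximum likelihood, i.e. by maximizing $\sum_{i=1}^n\log W(Y_i|x_i)$ over the codewords $(x_1,\dots,x_n)$, ties being broken uniformly at random. $P_{\mathrm{RC}}(n)$ is the decoding error probability averaged over the random code, the channel and the tie-breaking. Exponent. For $\lambda>0$ let $Z(\lambda)=\log \mathrm E_{X'}[e^{\lambda\nu(X,Y,X')}]$ (a random variable depending on $(X,Y)$), with $m$-th $\lambda$-derivative $Z^{(m)}(\lambda)$. For $0<R<I(X;Y)$, $$E_r(R)=-\min_{\alpha\in(0,1]}\{\alpha R+\log \mathrm E[e^{\alpha Z(1/(1+\alpha))}]\},$$ $\rho$ denotes the minimizing $\alpha$ and $\eta=1/(1+\rho)$. $R_{\mathrm{crit}}$ is the largest $R$ for which the minimizer is $\rho=1$. Tilting. $P_\rho$ is the probability measure with $dP_\rho/dP=e^{\rho Z(\eta)-\Lambda(\rho)}$, $\Lambda(\rho)=\log \mathrm E[e^{\rho Z(1/(1+\rho))}]$, with expectation $\mathrm E_\rho$. Put $\mu_0=\mathrm E_\rho[Z(\eta)]$ and $\sigma_{00}=\mathrm E_\rho[(Z(\eta)-\mu_0)^2]$. Singularity and lattice. $W$ is singular if $P_{X'}[\nu(X,Y,X')\in\{-\infty,0\}]=1$ for almost every $(X,Y)$. A random variable $V\in\mathbb R\cup\{-\infty\}$ that is not supported on $\{-\infty,v\}$ for a single $v\in\mathbb R$ has a lattice distribution with span $h>0$ and offset $a$ if $V\in\{a+ih:i\in\mathbb Z\}\cup\{-\infty\}$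 a.s. and $h$ is the largest number with this property. The lattice span of $W$ is $h>0$ if $\nu(X,Y,X')$ has a lattice distribution with span $h$, and $h=0$ otherwise. The pair $(W,R)$ is $(h',a')$-lattice if $Z(\eta)$ has a lattice distribution with span $h'$ and offset $a'$, and nonlattice otherwise. Constants. For $u>0$ and $h'>0$, $$g^{(\mathrm s)}(u)=1-\frac{1-e^{-u}}{u},\qquad g^{(\mathrm s)}_\rho(u)=u^{-\rho}g^{(\mathrm s)}(u)=\frac1{u^\rho}-\frac{1-e^{-u}}{u^{1+\rho}},$$ $$\psi^{(\mathrm s)}_{\rho,h'}(x)=\sum_{i\in\mathbb Z}h'g^{(\mathrm s)}_\rho(e^{x+ih'}),\qquad \psi^{(\mathrm s)}_\rho=\int_{\mathbb R}g^{(\mathrm s)}_\rho(e^w)\,dw=\frac{\Gamma(1-\rho)}{\rho(1+\rho)}.$$ Regularity (standing assumption). Let $Z(\lambda+\mathrm i\xi)=\log \mathrm E_{X'}[e^{(\lambda+\mathrm i\xi)\nu(X,Y,X')}]$ and $Z_{\mathrm a}(\lambda+\mathrm i\xi)=\log|\mathrm E_{X'}[e^{(\lambda+\mathrm i\xi)\nu(X,Y,X')}]|$, with $e^{(\lambda+\mathrm i\xi)(-\infty)}=0$. There exist $\alpha,b_0>0$ and a neighborhood $\mathcal S$ of $\eta$ such that for any $0<b_1<b_2<2\pi/h\le\infty$: $\sup_{\lambda\in\mathcal S}\mathrm E_\rho[e^{\alpha|Z^{(i)}(\lambda)|}]<\infty$ for $i=1,2,3$; $\sup_{\lambda\in\mathcal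 S,\,\xi\in[-b_0,b_0]}\mathrm E_\rho[e^{\alpha|(\partial^4/\partial\xi^4)Z(\lambda+\mathrm i\xi)|}]<\infty$; $\sup_{\lambda\in\mathcal S,\,\xi\in[b_1,b_2]}\mathrm E_\rho[e^{\alpha|Z_{\mathrm a}(\lambda+\mathrm i\xi)-Z_{\mathrm a}(\lambda)|}]<\infty$.
   Formalization: As printed the formula is false: since σ₀₀ is a variance, the denominator should be √(2πnσ₀₀), not √(2πn)σ₀₀, and in the lattice case ψ is evaluated at n(R+a') instead of na'. M is any integer with |M−e^{nR}|<1. *)

theory Defs
  imports "HOL-Probability.Probability" "HOL-Library.Landau_Symbols"
begin

section \<open>The channel\<close>

(* w x y is the density W(y|x) with respect to the base measure Q. *)
locale memoryless_channel =
  PX: prob_space PX + Q: sigma_finite_measure Q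
  for PX :: "'x measure" and Q :: "'y measure" and w :: "'x \<Rightarrow> 'y \<Rightarrow> real" +
  assumes measurable_density: "(\<lambda>(x, y). w x y) \<in> borel_measurable (PX \<Otimes>\<^sub>M Q)"
    and density_nonneg: "\<And>x y. x \<in> space PX \<Longrightarrow> y \<in> space Q \<Longrightarrow> 0 \<le> w x y"
    and density_normalized: "\<And>x. x \<in> space PX \<Longrightarrow> (\<integral>\<^sup>+ y. ennreal (w x y) \<partial>Q) = 1"

definition channel_law :: "'y measure \<Rightarrow> ('x \<Rightarrow> 'y \<Rightarrow> real) \<Rightarrow> 'x \<Rightarrow> 'y measure" where
  "channel_law Q w x = density Q (\<lambda>y. ennreal (w x y))"

(* The law of (X, Y). Random variables depending on (X, Y) are functions on this space. *)
definition joint_law ::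
  "'x measure \<Rightarrow> 'y measure \<Rightarrow> ('x \<Rightarrow> 'y \<Rightarrow> real) \<Rightarrow> ('x \<times> 'y) measure" where
  "joint_law PX Q w = density (PX \<Otimes>\<^sub>M Q) (\<lambda>(x, y). ennreal (w x y))"

definition ext_ln :: "real \<Rightarrow> ereal" where
  "ext_ln x = (if x > 0 then ereal (ln x) else - \<infinity>)"

(* exp (z * v) for v in [-oo, oo), with the convention exp (z * (-oo)) = 0 for complex z too. *)
definition ext_exp :: "'a::{real_normed_field, banach} \<Rightarrow> ereal \<Rightarrow> 'a" where
  "ext_exp z v = (if v = - \<infinity> then 0 else exp (z * of_real (real_of_ereal v)))"

(* nu(X, Y, x'); the division by zero on {W(Y|X) = 0} only concerns a null set of joint_law. *)
definition nu :: "('x \<Rightarrow> 'y \<Rightarrow> real) \<Rightarrow> 'x \<times> 'y \<Rightarrow> 'x \<Rightarrow> ereal" where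
  "nu w \<omega> x' = ext_ln (w x' (snd \<omega>) / w (fst \<omega>) (snd \<omega>))"

(* E_{X'}[exp (z * nu)], for real and for complex z. *)
definition cond_mgf ::
  "'x measure \<Rightarrow> ('x \<Rightarrow> 'y \<Rightarrow> real) \<Rightarrow> 'a \<Rightarrow> 'x \<times> 'y
     \<Rightarrow> 'a::{real_normed_field, banach, second_countable_topology}" where
  "cond_mgf PX w z \<omega> = (\<integral>x'. ext_exp z (nu w \<omega> x') \<partial>PX)"

(* Z(l). For 0 < l <= 1 the argument of ln is almost surely finite and positive, and the
   exponents l = 1/(1+alpha) used below, as well as eta, lie in this range. *)
definition Zfun :: "'x measure \<Rightarrow> ('x \<Rightarrow> 'y \<Rightarrow> real) \<Rightarrow> real \<Rightarrow> 'x \<times> 'y \<Rightarrow> real" where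
  "Zfun PX w l \<omega> = ln (cond_mgf PX w l \<omega>)"

(* Z_a(z) = log |E_{X'}[exp (z * nu)]|, equal to -oo at the zeros. *)
definition Za :: "'x measure \<Rightarrow> ('x \<Rightarrow> 'y \<Rightarrow> real) \<Rightarrow> complex \<Rightarrow> 'x \<times> 'y \<Rightarrow> ereal" where
  "Za PX w z \<omega> = ext_ln (cmod (cond_mgf PX w z \<omega>))"

definition mutual_info :: "'x measure \<Rightarrow> 'y measure \<Rightarrow> ('x \<Rightarrow> 'y \<Rightarrow> real) \<Rightarrow> real" where
  "mutual_info PX Q w = (\<integral>\<omega>. - Zfun PX w 1 \<omega> \<partial>joint_law PX Q w)"

(* The negative part of -Z(1) always has finite expectation, so I(X;Y) < oo is integrability. *)
definition finite_mutual_info :: "'x measure \<Rightarrow> 'y measure \<Rightarrow> ('x \<Rightarrow> 'y \<Rightarrow> real) \<Rightarrow> bool" where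
  "finite_mutual_info PX Q w \<longleftrightarrow> integrable (joint_law PX Q w) (\<lambda>\<omega>. - Zfun PX w 1 \<omega>)"

definition singular_channel :: "'x measure \<Rightarrow> 'y measure \<Rightarrow> ('x \<Rightarrow> 'y \<Rightarrow> real) \<Rightarrow> bool" where
  "singular_channel PX Q w \<longleftrightarrow>
     (AE \<omega> in joint_law PX Q w. AE x' in PX. nu w \<omega> x' \<in> {- \<infinity>, 0})"

section \<open>Random coding with maximum likelihood decoding\<close>

(* A codebook c maps a message j < M to the codeword c j, whose letters are c j i for i < n. *)
definition log_likelihood ::
  "('x \<Rightarrow> 'y \<Rightarrow> real) \<Rightarrow> nat \<Rightarrow> (nat \<Rightarrow> 'x) \<Rightarrow> (nat \<Rightarrow> 'y) \<Rightarrow> ereal" where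
  "log_likelihood w n x y = (\<Sum>i<n. ext_ln (w (x i) (y i)))"

definition ml_decoder ::
  "('x \<Rightarrow> 'y \<Rightarrow> real) \<Rightarrow> nat \<Rightarrow> nat \<Rightarrow> (nat \<Rightarrow> nat \<Rightarrow> 'x) \<Rightarrow> (nat \<Rightarrow> 'y) \<Rightarrow> nat pmf" where
  "ml_decoder w n M c y = pmf_of_set
     {j \<in> {..<M}. \<forall>k<M. log_likelihood w n (c k) y \<le> log_likelihood w n (c j) y}"

(* The message is uniform on {..<M}; by symmetry of the code every message has the same error. *)
definition P_RC ::
  "'x measure \<Rightarrow> 'y measure \<Rightarrow> ('x \<Rightarrow> 'y \<Rightarrow> real) \<Rightarrow> nat \<Rightarrow> nat \<Rightarrow> real" where
  "P_RC PX Q w n M =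
     (1 / real M) * (\<Sum>m<M.
       \<integral>c. (\<integral>y. measure_pmf.prob (ml_decoder w n M c y) (- {m})
              \<partial>Pi\<^sub>M {..<n} (\<lambda>i. channel_law Q w (c m i)))
         \<partial>Pi\<^sub>M {..<M} (\<lambda>_. Pi\<^sub>M {..<n} (\<lambda>_. PX)))"

section \<open>Error exponent\<close>

definition Lam :: "'x measure \<Rightarrow> 'y measure \<Rightarrow> ('x \<Rightarrow> 'y \<Rightarrow> real) \<Rightarrow> real \<Rightarrow> real" where
  "Lam PX Q w a = ln (\<integral>\<omega>. exp (a * Zfun PX w (1 / (1 + a)) \<omega>) \<partial>joint_law PX Q w)"

definition rate_objective ::
  "'x measure \<Rightarrow> 'y measure \<Rightarrow> ('x \<Rightarrow> 'y \<Rightarrow> real) \<Rightarrow> real \<Rightarrow> real \<Rightarrow> real" where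
  "rate_objective PX Q w R a = a * R + Lam PX Q w a"

definition opt_rho :: "'x measure \<Rightarrow> 'y measure \<Rightarrow> ('x \<Rightarrow> 'y \<Rightarrow> real) \<Rightarrow> real \<Rightarrow> real" where
  "opt_rho PX Q w R = arg_min_on (rate_objective PX Q w R) {0<..1}"

definition E_r :: "'x measure \<Rightarrow> 'y measure \<Rightarrow> ('x \<Rightarrow> 'y \<Rightarrow> real) \<Rightarrow> real \<Rightarrow> real" where
  "E_r PX Q w R = - rate_objective PX Q w R (opt_rho PX Q w R)"

definition R_crit :: "'x measure \<Rightarrow> 'y measure \<Rightarrow> ('x \<Rightarrow> 'y \<Rightarrow> real) \<Rightarrow> real" where
  "R_crit PX Q w = Sup {R. 0 < R \<and> R < mutual_info PX Q w \<and>
     is_arg_min (rate_objective PX Q w R) (\<lambda>a. a \<in> {0<..1}) 1}"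

definition tilted_law ::
  "'x measure \<Rightarrow> 'y measure \<Rightarrow> ('x \<Rightarrow> 'y \<Rightarrow> real) \<Rightarrow> real \<Rightarrow> ('x \<times> 'y) measure" where
  "tilted_law PX Q w r = density (joint_law PX Q w)
     (\<lambda>\<omega>. ennreal (exp (r * Zfun PX w (1 / (1 + r)) \<omega> - Lam PX Q w r)))"

definition mu0 :: "'x measure \<Rightarrow> 'y measure \<Rightarrow> ('x \<Rightarrow> 'y \<Rightarrow> real) \<Rightarrow> real \<Rightarrow> real" where
  "mu0 PX Q w r = (\<integral>\<omega>. Zfun PX w (1 / (1 + r)) \<omega> \<partial>tilted_law PX Q w r)"

(* A variance, not a standard deviation: it enters a Gaussian local limit only through its
   square root. *)
definition sigma00 :: "'x measure \<Rightarrow> 'y measure \<Rightarrow> ('x \<Rightarrow> 'y \<Rightarrow> real) \<Rightarrow> real \<Rightarrow> real" where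
  "sigma00 PX Q w r =
     (\<integral>\<omega>. (Zfun PX w (1 / (1 + r)) \<omega> - mu0 PX Q w r)\<^sup>2 \<partial>tilted_law PX Q w r)"

section \<open>Lattice distributions\<close>

definition supported_on_lattice :: "'a measure \<Rightarrow> ('a \<Rightarrow> ereal) \<Rightarrow> real \<Rightarrow> real \<Rightarrow> bool" where
  "supported_on_lattice P V h a \<longleftrightarrow>
     (AE \<omega> in P. V \<omega> = - \<infinity> \<or> (\<exists>i::int. V \<omega> = ereal (a + real_of_int i * h)))"

(* The span is maximal among all lattices carrying V, whatever their offset; the offset a is
   determined only modulo h. *)
definition lattice_dist :: "'a measure \<Rightarrow> ('a \<Rightarrow> ereal) \<Rightarrow> real \<Rightarrow> real \<Rightarrow> bool" where
  "lattice_dist P V h a \<longleftrightarrow>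
     \<not> (\<exists>v::real. AE \<omega> in P. V \<omega> \<in> {- \<infinity>, ereal v}) \<and>
     h > 0 \<and> supported_on_lattice P V h a \<and>
     (\<forall>h' a'. h' > 0 \<longrightarrow> supported_on_lattice P V h' a' \<longrightarrow> h' \<le> h)"

definition channel_span :: "'x measure \<Rightarrow> 'y measure \<Rightarrow> ('x \<Rightarrow> 'y \<Rightarrow> real) \<Rightarrow> real" where
  "channel_span PX Q w =
     (let is_span = (\<lambda>h. \<exists>a. lattice_dist (joint_law PX Q w \<Otimes>\<^sub>M PX) (\<lambda>(\<omega>, x'). nu w \<omega> x') h a)
      in if \<exists>h. is_span h then THE h. is_span h else 0)"

definition WR_lattice ::
  "'x measure \<Rightarrow> 'y measure \<Rightarrow> ('x \<Rightarrow> 'y \<Rightarrow> real) \<Rightarrow> real \<Rightarrow> real \<Rightarrow> real \<Rightarrow> bool" where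
  "WR_lattice PX Q w R h' a' \<longleftrightarrow>
     lattice_dist (joint_law PX Q w) (\<lambda>\<omega>. ereal (Zfun PX w (1 / (1 + opt_rho PX Q w R)) \<omega>)) h' a'"

definition WR_nonlattice :: "'x measure \<Rightarrow> 'y measure \<Rightarrow> ('x \<Rightarrow> 'y \<Rightarrow> real) \<Rightarrow> real \<Rightarrow> bool" where
  "WR_nonlattice PX Q w R \<longleftrightarrow> \<not> (\<exists>h' a'. WR_lattice PX Q w R h' a')"

section \<open>Regularity\<close>

definition exp_abs :: "real \<Rightarrow> ereal \<Rightarrow> ennreal" where
  "exp_abs a v = (if \<bar>v\<bar> = \<infinity> then \<infinity> else ennreal (exp (a * real_of_ereal \<bar>v\<bar>)))"

definition iter_vector_deriv ::
  "nat \<Rightarrow> (real \<Rightarrow> 'a::real_normed_vector) \<Rightarrow> real \<Rightarrow> 'a" where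
  "iter_vector_deriv m f = ((\<lambda>g x. vector_derivative g (at x)) ^^ m) f"

(* |d^4/dxi^4 Z(l + i xi)|. Near xi a continuous branch of the logarithm differs from
   Ln (F (l + i (xi + t)) / F (l + i xi)), with F = cond_mgf, by a constant, so differentiating
   the latter at t = 0 avoids the cut of Ln. The value is oo where the logarithm has a pole. *)
definition abs_Z4 ::
  "'x measure \<Rightarrow> ('x \<Rightarrow> 'y \<Rightarrow> real) \<Rightarrow> real \<Rightarrow> real \<Rightarrow> 'x \<times> 'y \<Rightarrow> ereal" where
  "abs_Z4 PX w l xi \<omega> =
     (if cond_mgf PX w (Complex l xi) \<omega> = 0 then \<infinity>
      else ereal (cmod (iter_vector_deriv 4
        (\<lambda>t. Ln (cond_mgf PX w (Complex l (xi + t)) \<omega> / cond_mgf PX w (Complex l xi) \<omega>)) 0)))"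

(* b2 * h < 2 pi stands for b2 < 2 pi / h with 2 pi / 0 = oo. *)
definition regular_channel ::
  "'x measure \<Rightarrow> 'y measure \<Rightarrow> ('x \<Rightarrow> 'y \<Rightarrow> real) \<Rightarrow> real \<Rightarrow> bool" where
  "regular_channel PX Q w R \<longleftrightarrow>
     (let r = opt_rho PX Q w R; eta = 1 / (1 + r); P = tilted_law PX Q w r in
      \<exists>a b0 S. a > 0 \<and> b0 > 0 \<and> open S \<and> eta \<in> S \<and>
        (\<forall>b1 b2. 0 < b1 \<and> b1 < b2 \<and> b2 * channel_span PX Q w < 2 * pi \<longrightarrow>
          (\<forall>i\<in>{1,2,3}.
             (SUP l\<in>S. \<integral>\<^sup>+\<omega>. exp_abs a (ereal ((deriv ^^ i) (\<lambda>s. Zfun PX w s \<omega>) l)) \<partial>P) < \<infinity>) \<and>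
          (SUP l\<in>S. SUP xi\<in>{-b0..b0}. \<integral>\<^sup>+\<omega>. exp_abs a (abs_Z4 PX w l xi \<omega>) \<partial>P) < \<infinity> \<and>
          (SUP l\<in>S. SUP xi\<in>{b1..b2}.
             \<integral>\<^sup>+\<omega>. exp_abs a (Za PX w (Complex l xi) \<omega> - Za PX w (Complex l 0) \<omega>) \<partial>P) < \<infinity>))"

section \<open>Constants\<close>

definition g_s :: "real \<Rightarrow> real" where
  "g_s u = 1 - (1 - exp (- u)) / u"

definition g_s_rho :: "real \<Rightarrow> real \<Rightarrow> real" where
  "g_s_rho r u = u powr (- r) * g_s u"

definition psi_lattice :: "real \<Rightarrow> real \<Rightarrow> real \<Rightarrow> real" where
  "psi_lattice r h x = (\<Sum>\<^sub>\<infinity>i\<in>(UNIV::int set). h * g_s_rho r (exp (x + real_of_int i * h)))"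

definition psi_nonlattice :: "real \<Rightarrow> real" where
  "psi_nonlattice r = (\<integral>t. g_s_rho r (exp t) \<partial>lborel)"

(* Up to a factor tending to 1, exp (n * E_r) times the error probability is the expectation,
   under the n-fold tilted law, of g_s_rho r (exp (n * R + S)), where S is a sum of n copies of
   Z(eta) and has mean - n * R and variance n * sigma00. If Z(eta) has span h' and offset a',
   then n * R + S lives on n * (R + a') + h' * Z. Hence the normalisation
   sqrt (2 * pi * n * sigma00), and hence psi_lattice must be evaluated at n * (R + a'):
   the offset a' of Z(eta) alone, without the rate R, would give the wrong phase. *)

end

theory Submission
  imports Defs
begin

text \<open>For a singular channel a competing codeword either has the same likelihood as the transmitted
  one or likelihood zero. Uniform tie-breaking makes the probability of correct decoding the average
  over the code of the largest likelihood divided by \<open>M\<close>, so that exactly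
  \<open>P_RC = E[1 - (1 - (1 - q)^M) / (M q)]\<close>, where \<open>q\<close> is the product over the letters of \<open>exp Z\<close>,
  the probability that an independent letter matches the output; \<open>Z\<close> does not depend on the exponent.
  Up to factors tending to \<open>1\<close> the integrand is \<open>g_s (exp (n R) q)\<close>. Tilting the law of the outputs at
  the minimizing \<open>r\<close> centres the sum of the variables \<open>Z + R\<close> (stationarity at an interior minimum)
  and extracts the exponential factor; what is left is the expectation of the rapidly decaying function
  \<open>g_s_rho r (exp x)\<close> of a centred sum, to which the lattice and nonlattice local limit theorems apply.
  The exponential moments of the tilted \<open>Z\<close> exist because \<open>Z\<close> is nonpositive.\<close>

section \<open>Characteristic functions of powers\<close>

text \<open>Nonlattice only means that the characteristic function has modulus below 1 away from 0;
  it may come arbitrarily close to 1 at infinity. Fourier inversion therefore stays inside bounded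
  frequency windows. On a lattice one period is such a window; without a lattice the law of the sum
  is weighted by a positive kernel whose Fourier transform has compact support. The lattice phase
  moves with n, so the main term need not converge: the lattice limit theorem states that a
  difference tends to 0, with bounds uniform in the phase, and a positive lower bound on the main
  term turns this into a ratio. The expectations are of order 1 / sqrt n, so the passage from the
  exact error to \<open>g_s\<close> is made with relative errors uniform in the argument: 2 / M for
  replacing (1 - q)^M by an exponential, and the ratio M / exp (n R) for the rounding of M to an
  integer. The condition R > R_crit enters as r < 1: at minus infinity
  \<open>g_s_rho r (exp x)\<close> is of size exp ((1 - r) x) and would not decay for r = 1.\<close>

locale centered_distribution = real_distribution +
  fixes s :: real
  assumes i1: "integrable M (\<lambda>x. x)" and m1: "expectation (\<lambda>x. x) = 0"
    and i2: "integrable M (\<lambda>x. x\<^sup>2)" and m2: "expectation (\<lambda>x. x\<^sup>2) = s" and s: "s > 0"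

text \<open>Only two moments are available, so the remainder is kept in the form E min (6 x^2, |t|
  |x|^3): it is dominated by 6 x^2 and tends to 0 with t. Since it is monotone in |t|, a single
  small t settles all smaller ones.\<close>

lemma (in centered_distribution) char_near_quadratic:
  assumes "e > 0"
  obtains d where "d > 0" "\<And>t. \<bar>t\<bar> \<le> d \<Longrightarrow> cmod (char M t - (1 - t\<^sup>2 * s / 2)) \<le> e * t\<^sup>2"
proof -
  let ?f = "\<lambda>t x. min (6 * x\<^sup>2) (\<bar>t\<bar> * \<bar>x\<bar> ^ 3) :: real"
  have int: "integrable M (?f t)" for t
    by (rule Bochner_Integration.integrable_bound[where f = "\<lambda>x. 6 * x\<^sup>2"]) (use i2 in auto)
  have "(\<lambda>n. ?f (inverse (real (Suc n))) x) \<longlonglongrightarrow> 0" for x :: real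
  proof -
    have "(\<lambda>n. min (6 * x\<^sup>2) (\<bar>inverse (real (Suc n))\<bar> * \<bar>x\<bar> ^ 3)) \<longlonglongrightarrow> min (6 * x\<^sup>2) (\<bar>0\<bar> * \<bar>x\<bar> ^ 3)"
      by (intro tendsto_intros LIMSEQ_inverse_real_of_nat)
    then show ?thesis by (simp add: min_absorb2)
  qed
  then have "(\<lambda>n. expectation (?f (inverse (real (Suc n))))) \<longlonglongrightarrow> expectation (\<lambda>x. 0)"
    by (intro integral_dominated_convergence[where w = "\<lambda>x. 6 * x\<^sup>2"]) (use i2 in auto)
  then have "\<forall>\<^sub>F n in sequentially. expectation (?f (inverse (real (Suc n)))) < 6 * e"
    using \<open>e > 0\<close> by (intro order_tendstoD) auto
  then obtain n where n: "expectation (?f (inverse (real (Suc n)))) < 6 * e"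
    by (auto simp: eventually_sequentially)
  show ?thesis
  proof (rule that)
    show "inverse (real (Suc n)) > 0" by simp
    fix t :: real assume t: "\<bar>t\<bar> \<le> inverse (real (Suc n))"
    have "expectation (?f t) \<le> expectation (?f (inverse (real (Suc n))))"
      by (intro integral_mono int min.mono order.refl mult_right_mono) (use t in auto)
    with n have le: "expectation (?f t) \<le> 6 * e" by simp
    have "cmod (char M t - (1 - t\<^sup>2 * s / 2)) \<le> (t\<^sup>2 / 6) * expectation (?f t)"
      using char_approx3[OF i1 m1 i2, of s t] m1 m2 by simp
    also have "\<dots> \<le> (t\<^sup>2 / 6) * (6 * e)"
      using le by (intro mult_left_mono) auto
    finally show "cmod (char M t - (1 - t\<^sup>2 * s / 2)) \<le> e * t\<^sup>2" by (simp add: mult.commute)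
  qed
qed

text \<open>Numbers of modulus at most 1 satisfy |z^n - w^n| <= n |z - w|, so an error e t^2 / n in
  one factor costs only e t^2 in the n-th power. This compares the power with (1 - s t^2 / (2
  n))^n.\<close>

lemma (in centered_distribution) char_power_tendsto_gaussian:
  shows "(\<lambda>n. char M (t / sqrt (real n)) ^ n) \<longlonglongrightarrow> complex_of_real (exp (- (s * t\<^sup>2 / 2)))"
proof -
  have s0: "s \<ge> 0" using s by simp
  let ?w = "\<lambda>n. 1 - s * t\<^sup>2 / 2 / real n"
  have w1: "\<forall>\<^sub>F n in sequentially. \<bar>?w n\<bar> \<le> 1"
  proof -
    have "(\<lambda>n. s * t\<^sup>2 / 2 / real n) \<longlonglongrightarrow> 0" by real_asymp
    then have "\<forall>\<^sub>F n in sequentially. s * t\<^sup>2 / 2 / real n < 1" by (intro order_tendstoD) auto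
    then show ?thesis by eventually_elim (use s0 in \<open>auto simp: abs_le_iff\<close>)
  qed
  have lim: "(\<lambda>n. char M (t / sqrt (real n)) ^ n - complex_of_real (?w n ^ n)) \<longlonglongrightarrow> 0"
  proof (rule LIMSEQ_I)
    fix r :: real assume "r > 0"
    \<comment> \<open>Chosen so that e t^2 stays at most r / 2; the added 1 covers t = 0.\<close>
    define e where "e = r / (2 * (t\<^sup>2 + 1))"
    have e: "e > 0" using \<open>r > 0\<close> by (simp add: e_def add_nonneg_pos)
    obtain d where d: "d > 0" "\<And>t. \<bar>t\<bar> \<le> d \<Longrightarrow> cmod (char M t - (1 - t\<^sup>2 * s / 2)) \<le> e * t\<^sup>2"
      using char_near_quadratic[OF e] by blast
    have "(\<lambda>n. \<bar>t\<bar> / sqrt (real n)) \<longlonglongrightarrow> 0" by real_asymp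
    then have "\<forall>\<^sub>F n in sequentially. \<bar>t\<bar> / sqrt (real n) < d" using d(1) by (intro order_tendstoD) auto
    with w1 have "\<forall>\<^sub>F n in sequentially. cmod (char M (t / sqrt (real n)) ^ n - complex_of_real (?w n ^ n)) < r"
      using eventually_gt_at_top[of 0]
    proof eventually_elim
      case (elim n)
      have *: "cmod (char M (t / sqrt (real n)) - complex_of_real (?w n)) \<le> e * (t\<^sup>2 / real n)"
        using d(2)[of "t / sqrt (real n)"] elim by (simp add: power_divide mult.commute)
      have "cmod (char M (t / sqrt (real n)) ^ n - complex_of_real (?w n) ^ n)
          \<le> n * cmod (char M (t / sqrt (real n)) - complex_of_real (?w n))"
        using elim by (intro norm_power_diff cmod_char_le_1) (auto simp del: of_real_diff)
      also have "\<dots> \<le> n * (e * (t\<^sup>2 / real n))" using * by (intro mult_left_mono) auto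
      also have "\<dots> = e * t\<^sup>2" using elim by simp
      also have "\<dots> < r"
      proof -
        have "e * t\<^sup>2 \<le> e * (t\<^sup>2 + 1)" using e by (intro mult_left_mono) auto
        also have "\<dots> = r / 2" by (simp add: e_def field_simps add_nonneg_eq_0_iff)
        finally show ?thesis using \<open>r > 0\<close> by simp
      qed
      finally show ?case by simp
    qed
    then show "\<exists>no. \<forall>n\<ge>no. cmod (char M (t / sqrt (real n)) ^ n - complex_of_real (?w n ^ n) - 0) < r"
      by (simp add: eventually_sequentially)
  qed
  have "(\<lambda>n. ?w n ^ n) \<longlonglongrightarrow> exp (- (s * t\<^sup>2 / 2))"
    using tendsto_exp_limit_sequentially[of "- (s * t\<^sup>2 / 2)"] by simp
  then have "(\<lambda>n. complex_of_real (?w n ^ n)) \<longlonglongrightarrow> complex_of_real (exp (- (s * t\<^sup>2 / 2)))"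
    by (intro tendsto_of_real)
  from tendsto_add[OF lim this] show ?thesis by simp
qed

text \<open>The n-th power of this majorant at t / sqrt n is exp (- c t^2) for every n > 0, which
  serves as dominating function in the local limit. Near 0 it follows from the quadratic expansion,
  on the rest of the window from compactness.\<close>

lemma (in centered_distribution) char_le_gaussian:
  assumes lt1: "\<And>t. t \<noteq> 0 \<Longrightarrow> \<bar>t\<bar> \<le> A \<Longrightarrow> cmod (char M t) < 1"
  obtains c where "c > 0" "\<And>t. \<bar>t\<bar> \<le> A \<Longrightarrow> cmod (char M t) \<le> exp (- (c * t\<^sup>2))"
proof -
  obtain d0 where d0: "d0 > 0" "\<And>t. \<bar>t\<bar> \<le> d0 \<Longrightarrow> cmod (char M t - (1 - t\<^sup>2 * s / 2)) \<le> s / 4 * t\<^sup>2"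
    using char_near_quadratic[of "s / 4"] s by auto
  \<comment> \<open>The cap 1 / sqrt s gives t^2 s <= 1, so that 1 - t^2 s / 2 is nonnegative and
    equals its own modulus. The tolerance s / 4 above gives up half of the coefficient s /
    2.\<close>
  define d where "d = min d0 (1 / sqrt s)"
  have d: "d > 0" "d \<le> d0" using d0 s by (auto simp: d_def)
  have near: "cmod (char M t) \<le> exp (- (s / 4 * t\<^sup>2))" if "\<bar>t\<bar> \<le> d" for t
  proof -
    have "\<bar>t\<bar> \<le> 1 / sqrt s" using that by (simp add: d_def)
    then have "t\<^sup>2 \<le> (1 / sqrt s)\<^sup>2" using abs_le_square_iff[of t "1 / sqrt s"] s by simp
    then have "t\<^sup>2 \<le> 1 / s" using s by (simp add: power_divide)
    then have ts: "t\<^sup>2 * s \<le> 1" using s by (simp add: field_simps)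
    have "cmod (char M t) \<le> cmod (char M t - (1 - t\<^sup>2 * s / 2)) + cmod (complex_of_real (1 - t\<^sup>2 * s / 2))"
      using norm_triangle_ineq[of "char M t - (1 - t\<^sup>2 * s / 2)" "complex_of_real (1 - t\<^sup>2 * s / 2)"] by simp
    also have "cmod (complex_of_real (1 - t\<^sup>2 * s / 2)) = 1 - t\<^sup>2 * s / 2"
      using ts by (simp only: norm_of_real)
    also have "cmod (char M t - (1 - t\<^sup>2 * s / 2)) \<le> s / 4 * t\<^sup>2"
      using d0(2)[of t] that d by simp
    finally have "cmod (char M t) \<le> 1 + - (s / 4 * t\<^sup>2)" by (simp add: field_simps)
    also have "\<dots> \<le> exp (- (s / 4 * t\<^sup>2))" by (rule exp_ge_add_one_self)
    finally show ?thesis .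
  qed
  show ?thesis
  proof (cases "d \<le> A")
    case False
    then show ?thesis using near that[of "s / 4"] s by auto
  next
    case True
    define S where "S = {-A..-d} \<union> {d..A}"
    have "compact S" "S \<noteq> {}" using True by (auto simp: S_def)
    moreover have "continuous_on S (\<lambda>t. cmod (char M t))"
      using isCont_char by (intro continuous_at_imp_continuous_on continuous_intros) auto
    ultimately obtain t0 where t0: "t0 \<in> S" "\<And>t. t \<in> S \<Longrightarrow> cmod (char M t) \<le> cmod (char M t0)"
      using continuous_attains_sup by metis
    \<comment> \<open>The floor 1 / 2 keeps q positive, so that its logarithm can be taken.\<close>
    define q where "q = max (1 / 2) (cmod (char M t0))"
    have "cmod (char M t0) < 1" using t0(1) d by (intro lt1) (auto simp: S_def)
    then have q: "0 < q" "q < 1" by (auto simp: q_def)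
    define c where "c = min (s / 4) (- ln q / A\<^sup>2)"
    have "A > 0" using d True by simp
    have c: "c > 0" using q s \<open>A > 0\<close> by (auto simp: c_def divide_pos_pos divide_neg_pos)
    show ?thesis
    proof (rule that[OF c])
      fix t assume t: "\<bar>t\<bar> \<le> A"
      show "cmod (char M t) \<le> exp (- (c * t\<^sup>2))"
      proof (cases "\<bar>t\<bar> \<le> d")
        case True
        have "c \<le> s / 4" unfolding c_def by (rule min.cobounded1)
        then have "c * t\<^sup>2 \<le> s / 4 * t\<^sup>2" by (intro mult_right_mono) auto
        then show ?thesis using near[OF True] by (meson exp_le_cancel_iff neg_le_iff_le order_trans)
      next
        case False
        then have "t \<in> S" using t by (auto simp: S_def abs_le_iff)
        then have "cmod (char M t) \<le> q" using t0(2) by (fastforce simp: q_def)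
        also have "q = exp (ln q)" using q by simp
        also have "\<dots> \<le> exp (- (c * t\<^sup>2))"
        proof -
          have "c * t\<^sup>2 \<le> (- ln q / A\<^sup>2) * A\<^sup>2"
            using c t \<open>A > 0\<close> q by (intro mult_mono) (auto simp: c_def abs_le_square_iff[symmetric] divide_nonpos_pos)
          also have "\<dots> = - ln q" using \<open>A > 0\<close> by simp
          finally show ?thesis by simp
        qed
        finally show ?thesis .
      qed
    qed
  qed
qed

lemma gaussian_scaled:
  assumes "(s::real) > 0"
  shows "integrable lborel (\<lambda>t. exp (- (s * t\<^sup>2 / 2)))"
    and "(LBINT t. exp (- (s * t\<^sup>2 / 2))) = sqrt (2 * pi / s)"
proof -
  have eq: "exp (- (s * t\<^sup>2 / 2)) = sqrt (2 * pi / s) * normal_density 0 (1 / sqrt s) t" for t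
    using assms by (simp add: normal_density_def power_divide real_sqrt_divide real_sqrt_mult)
  show "integrable lborel (\<lambda>t. exp (- (s * t\<^sup>2 / 2)))"
    unfolding eq using assms by (intro integrable_mult_right) simp
  show "(LBINT t. exp (- (s * t\<^sup>2 / 2))) = sqrt (2 * pi / s)"
    unfolding eq using assms by simp
qed

text \<open>The weights \<^term>\<open>W n\<close> may depend on \<^term>\<open>n\<close>: in the lattice case they carry the
  phase of the lattice on which the sum lives.\<close>

proposition (in centered_distribution) local_limit_weighted:
  fixes W :: "nat \<Rightarrow> real \<Rightarrow> complex"
  assumes lt1: "\<And>t. t \<noteq> 0 \<Longrightarrow> \<bar>t\<bar> \<le> A \<Longrightarrow> cmod (char M t) < 1" and A: "A > 0"
    and W[measurable]: "\<And>n. W n \<in> borel_measurable borel"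
    and W_bound: "\<And>n t. cmod (W n t) \<le> B" and w_bound: "\<And>n. cmod (v n) \<le> B"
    and W_lim: "\<And>t. (\<lambda>n. W n (t / sqrt (real n)) - v n) \<longlonglongrightarrow> 0"
  shows "(\<lambda>n. sqrt (real n) *\<^sub>R (LBINT t:{-A..A}. W n t * char M t ^ n) - v n * sqrt (2 * pi / s)) \<longlonglongrightarrow> 0"
proof -
  obtain c where c: "c > 0" "\<And>t. \<bar>t\<bar> \<le> A \<Longrightarrow> cmod (char M t) \<le> exp (- (c * t\<^sup>2))"
    using char_le_gaussian lt1 by blast
  have B: "B \<ge> 0" using w_bound[of 0] norm_ge_zero order_trans by blast
  let ?I = "\<lambda>n t. indicator {-A..A} (t / sqrt (real n)) *\<^sub>R (W n (t / sqrt (real n)) * char M (t / sqrt (real n)) ^ n)"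
  let ?J = "\<lambda>n t. v n * complex_of_real (exp (- (s * t\<^sup>2 / 2)))"
  let ?w = "\<lambda>t. B * exp (- (2 * c * t\<^sup>2 / 2)) + B * exp (- (s * t\<^sup>2 / 2))"
  have w_int: "integrable lborel ?w"
    using c(1) s by (intro Bochner_Integration.integrable_add integrable_mult_right gaussian_scaled) auto
  have [measurable]: "char M \<in> borel_measurable borel" by (rule char_measurable)
  have I_bound: "cmod (?I n t) \<le> B * exp (- (2 * c * t\<^sup>2 / 2))" if n: "n > 0" for n t
  proof (cases "\<bar>t / sqrt (real n)\<bar> \<le> A")
    case True
    have "cmod (char M (t / sqrt (real n)) ^ n) = cmod (char M (t / sqrt (real n))) ^ n" by (rule norm_power)
    also have "\<dots> \<le> exp (- (c * (t / sqrt (real n))\<^sup>2)) ^ n"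
      by (intro power_mono c(2) True) auto
    also have "\<dots> = exp (real n * - (c * (t / sqrt (real n))\<^sup>2))" by (rule exp_of_nat_mult[symmetric])
    also have "real n * - (c * (t / sqrt (real n))\<^sup>2) = - (2 * c * t\<^sup>2 / 2)"
      using n by (simp add: power_divide)
    finally have "cmod (char M (t / sqrt (real n)) ^ n) \<le> exp (- (2 * c * t\<^sup>2 / 2))" .
    then show ?thesis
      using W_bound B by (auto simp: norm_mult indicator_def intro!: mult_mono)
  next
    case False
    then have "t / sqrt (real n) \<notin> {-A..A}" by auto
    then show ?thesis using B by simp
  qed
  have I_int: "integrable lborel (?I n)" if n: "n > 0" for n
    by (rule Bochner_Integration.integrable_bound[where f = "\<lambda>t. B * exp (- (2 * c * t\<^sup>2 / 2))"])
       (use I_bound[OF n] gaussian_scaled(1)[of "2 * c"] c(1) B in \<open>auto\<close>)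
  have J_int: "integrable lborel (?J n)" for n
    by (intro integrable_mult_right integrable_of_real gaussian_scaled s)
  \<comment> \<open>Shifted to \<open>Suc n\<close> because the majorant for \<open>?I\<close> is
    available only for n > 0: at n = 0 division by zero puts every t into the window.\<close>
  have lim0: "(\<lambda>n. LBINT t. ?I (Suc n) t - ?J (Suc n) t) \<longlonglongrightarrow> (LBINT t::real. (0::complex))"
  proof (rule integral_dominated_convergence[where w = ?w])
    show "AE t in lborel. cmod (?I (Suc n) t - ?J (Suc n) t) \<le> ?w t" for n
    proof (rule AE_I2)
      fix t
      have "cmod (?J (Suc n) t) \<le> B * exp (- (s * t\<^sup>2 / 2))"
        using w_bound by (auto simp: norm_mult intro!: mult_right_mono)
      then show "cmod (?I (Suc n) t - ?J (Suc n) t) \<le> ?w t"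
        using I_bound[of "Suc n" t] by (intro order_trans[OF norm_triangle_ineq4] add_mono) auto
    qed
    show "AE t in lborel. (\<lambda>n. ?I (Suc n) t - ?J (Suc n) t) \<longlonglongrightarrow> 0"
    proof (rule AE_I2, rule filterlim_compose[OF _ filterlim_Suc])
      fix t
      let ?E = "complex_of_real (exp (- (s * t\<^sup>2 / 2)))"
      have g: "(\<lambda>n. char M (t / sqrt (real n)) ^ n) \<longlonglongrightarrow> ?E"
        by (rule char_power_tendsto_gaussian)
      have "(\<lambda>n. \<bar>t\<bar> / sqrt (real n)) \<longlonglongrightarrow> 0" by real_asymp
      then have "\<forall>\<^sub>F n in sequentially. \<bar>t\<bar> / sqrt (real n) < A" using A by (intro order_tendstoD) auto
      \<comment> \<open>The weights \<open>v n\<close> need not converge, so the difference is split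
        into (W - v) char^n + v (char^n - Gaussian), and each part tends to 0.\<close>
      then have ev: "\<forall>\<^sub>F n in sequentially. (W n (t / sqrt (real n)) - v n) * char M (t / sqrt (real n)) ^ n
            + v n * (char M (t / sqrt (real n)) ^ n - ?E) = ?I n t - ?J n t"
      proof eventually_elim
        case (elim n)
        then have "\<bar>t / sqrt (real n)\<bar> \<le> A" by simp
        then have "t / sqrt (real n) \<in> {-A..A}" by (auto simp only: abs_le_iff atLeastAtMost_iff)
        then show ?case by (simp add: algebra_simps)
      qed
      have "(\<lambda>n. v n * (char M (t / sqrt (real n)) ^ n - ?E)) \<longlonglongrightarrow> 0"
      proof (rule Lim_null_comparison)
        show "\<forall>\<^sub>F n in sequentially. cmod (v n * (char M (t / sqrt (real n)) ^ n - ?E)) \<le> B * cmod (char M (t / sqrt (real n)) ^ n - ?E)"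
          using w_bound by (auto simp: norm_mult intro!: always_eventually mult_right_mono)
        show "(\<lambda>n. B * cmod (char M (t / sqrt (real n)) ^ n - ?E)) \<longlonglongrightarrow> 0"
          using tendsto_mult_left[OF tendsto_norm[OF tendsto_diff[OF g tendsto_const[of ?E]]], of B] by simp
      qed
      from tendsto_add[OF tendsto_mult[OF W_lim[of t] g] this]
      show "(\<lambda>n. ?I n t - ?J n t) \<longlonglongrightarrow> 0"
        by (subst tendsto_cong[OF ev, symmetric]) simp
    qed
  qed (use w_int in auto)
  have eq: "(LBINT t. ?I (Suc n) t - ?J (Suc n) t)
      = sqrt (real (Suc n)) *\<^sub>R (LBINT t:{-A..A}. W (Suc n) t * char M t ^ Suc n) - v (Suc n) * sqrt (2 * pi / s)" for n
  proof -
    have "(LBINT t. ?I (Suc n) t - ?J (Suc n) t) = (LBINT t. ?I (Suc n) t) - (LBINT t. ?J (Suc n) t)"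
      by (intro Bochner_Integration.integral_diff I_int J_int) auto
    also have "(LBINT t. ?J (Suc n) t) = v (Suc n) * sqrt (2 * pi / s)"
      by (simp only: integral_mult_right_zero integral_complex_of_real gaussian_scaled(2)[OF s])
    also have "(LBINT t. ?I (Suc n) t) = sqrt (real (Suc n)) *\<^sub>R (LBINT t:{-A..A}. W (Suc n) t * char M t ^ Suc n)"
      using lborel_integral_real_affine[where c = "1 / sqrt (real (Suc n))" and t = 0 and
          f = "\<lambda>t. indicator {-A..A} t *\<^sub>R (W (Suc n) t * char M t ^ Suc n)"]
      by (simp add: set_lebesgue_integral_def)
    finally show ?thesis .
  qed
  show ?thesis
    using lim0 unfolding eq by (subst filterlim_sequentially_Suc[symmetric]) simp
qed

section \<open>Exchange of integrals, uniform lattice sums, orthogonality of exponentials\<close>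

lemma Fubini_integrable_bounded:
  fixes f :: "'a \<Rightarrow> complex" and g :: "'a \<Rightarrow> 'b \<Rightarrow> complex"
  assumes "sigma_finite_measure C" "finite_measure N" and f: "integrable C f"
    and g[measurable]: "(\<lambda>(x, y). g x y) \<in> borel_measurable (C \<Otimes>\<^sub>M N)"
    and B: "\<And>x y. cmod (g x y) \<le> B"
  shows "(\<integral>y. (\<integral>x. f x * g x y \<partial>C) \<partial>N) = (\<integral>x. f x * (\<integral>y. g x y \<partial>N) \<partial>C)"
proof -
  interpret C: sigma_finite_measure C by fact
  interpret N: finite_measure N by fact
  interpret pair_sigma_finite C N ..
  have [measurable]: "f \<in> borel_measurable C" using f by simp
  have gi: "integrable N (g x)" if "x \<in> space C" for x
    by (rule N.integrable_const_bound[where B = B]) (use B that in auto)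
  have "integrable (C \<Otimes>\<^sub>M N) (\<lambda>(x, y). f x * g x y)"
  proof (rule Fubini_integrable)
    show "AE x in C. integrable N (\<lambda>y. case (x, y) of (x, y) \<Rightarrow> f x * g x y)"
      by (rule AE_I2) (auto intro!: integrable_mult_right gi)
    have B0: "B \<ge> 0" using B norm_ge_zero order_trans by blast
    show "integrable C (\<lambda>x. \<integral>y. norm (case (x, y) of (x, y) \<Rightarrow> f x * g x y) \<partial>N)"
    proof (rule Bochner_Integration.integrable_bound[where f = "\<lambda>x. (B * measure N (space N)) * cmod (f x)"])
      show "AE x in C. norm (\<integral>y. norm (case (x, y) of (x, y) \<Rightarrow> f x * g x y) \<partial>N) \<le> norm (B * measure N (space N) * cmod (f x))"
      proof (rule AE_I2)
        fix x assume x: "x \<in> space C"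
        have "(\<integral>y. norm (f x * g x y) \<partial>N) \<le> (\<integral>y. cmod (f x) * B \<partial>N)"
          using B by (intro integral_mono integrable_norm integrable_mult_right gi x)
            (auto simp: norm_mult intro!: mult_left_mono)
        then show "norm (\<integral>y. norm (case (x, y) of (x, y) \<Rightarrow> f x * g x y) \<partial>N) \<le> norm (B * measure N (space N) * cmod (f x))"
          using B0 by (simp add: mult_ac abs_mult integral_nonneg_AE)
      qed
    qed (use f in auto)
  qed auto
  from Fubini_integral[OF this]
  have "(\<integral>y. (\<integral>x. f x * g x y \<partial>C) \<partial>N) = (\<integral>x. (\<integral>y. f x * g x y \<partial>N) \<partial>C)" by simp
  then show ?thesis by simp
qed

text \<open>A form of Peetre's inequality, resting on 2 a^2 + 2 (a - b)^2 - b^2 = (b - 2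
  a)^2.\<close>

lemma one_plus_square_shift:
  fixes a b d :: real
  assumes "\<bar>a - b\<bar> \<le> d"
  shows "1 / (1 + a\<^sup>2) \<le> 2 * (1 + d\<^sup>2) / (1 + b\<^sup>2)"
proof -
  have "(a - b)\<^sup>2 \<le> d\<^sup>2" using assms abs_le_square_iff[of "a - b" d] by simp
  moreover have "0 \<le> (b - 2 * a)\<^sup>2" by simp
  ultimately have "b\<^sup>2 \<le> 2 * a\<^sup>2 + 2 * d\<^sup>2" by (simp add: power2_eq_square algebra_simps)
  moreover have "0 \<le> a\<^sup>2 * d\<^sup>2" by simp
  moreover have "2 * (1 + d\<^sup>2) * (1 + a\<^sup>2) = 2 + 2 * a\<^sup>2 + 2 * d\<^sup>2 + 2 * (a\<^sup>2 * d\<^sup>2)" by (simp add: algebra_simps)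
  ultimately have "1 + b\<^sup>2 \<le> 2 * (1 + d\<^sup>2) * (1 + a\<^sup>2)" by linarith
  then show ?thesis by (simp add: field_simps add_pos_nonneg)
qed

lemma lattice_abs_summable:
  assumes h: "(h::real) > 0"
  shows "Infinite_Set_Sum.abs_summable_on (\<lambda>i::int. 1 / (1 + (real_of_int i * h)\<^sup>2)) UNIV"
proof -
  let ?f = "\<lambda>i::int. 1 / (1 + (real_of_int i * h)\<^sup>2)"
  have "summable (\<lambda>n::nat. 1 / h\<^sup>2 * inverse (real n ^ 2))"
    by (intro summable_mult inverse_power_summable) auto
  then have sm: "summable (\<lambda>n::nat. 1 / (1 + (real n * h)\<^sup>2))"
    by (rule summable_comparison_test'[where N = 1])
       (use h in \<open>auto simp: field_simps power_mult_distrib add_nonneg_pos\<close>)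
  have "Infinite_Set_Sum.abs_summable_on ?f (range int)" "Infinite_Set_Sum.abs_summable_on ?f (range (\<lambda>n. - int n))"
    using sm by (subst abs_summable_on_reindex_iff[symmetric];
        simp add: inj_on_def abs_summable_on_nat_iff' add_nonneg_nonneg)+
  then have "Infinite_Set_Sum.abs_summable_on ?f (range int \<union> range (\<lambda>n. - int n))"
    by (rule abs_summable_on_union)
  moreover have "range int \<union> range (\<lambda>n. - int n) = UNIV"
    by (auto simp: image_iff) (metis int_cases2)
  ultimately show ?thesis by simp
qed

text \<open>The point is uniformity in the offset x, since the offset of the lattice of the sum
  changes with n. Moving the index by the floor of x / h brings x + i h within distance h of a point
  of h Z.\<close>

lemma lattice_sum_bound:
  assumes h: "(h::real) > 0"
  obtains B where "\<And>x. Infinite_Set_Sum.abs_summable_on (\<lambda>i::int. 1 / (1 + (x + real_of_int i * h)\<^sup>2)) UNIV"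
    and "\<And>x. infsetsum (\<lambda>i::int. 1 / (1 + (x + real_of_int i * h)\<^sup>2)) UNIV \<le> B"
proof -
  let ?f = "\<lambda>i::int. 1 / (1 + (real_of_int i * h)\<^sup>2)"
  let ?g = "\<lambda>i::int. 2 * (1 + h\<^sup>2) * ?f i"
  note sf = lattice_abs_summable[OF h]
  have sg: "Infinite_Set_Sum.abs_summable_on ?g UNIV" by (intro abs_summable_on_cmult_right sf)
  have A: "Infinite_Set_Sum.abs_summable_on (\<lambda>i::int. 1 / (1 + (x + real_of_int i * h)\<^sup>2)) UNIV \<and>
     infsetsum (\<lambda>i::int. 1 / (1 + (x + real_of_int i * h)\<^sup>2)) UNIV \<le> infsetsum ?g UNIV" for x
  proof -
    define j where "j = \<lfloor>x / h\<rfloor>"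
    have bij: "bij_betw (\<lambda>i::int. i + j) UNIV UNIV"
      by (rule bij_betwI[where g = "\<lambda>i. i - j"]) auto
    have le: "1 / (1 + (x + real_of_int i * h)\<^sup>2) \<le> ?g (i + j)" for i
    proof -
      have "real_of_int j \<le> x / h" "x / h < real_of_int j + 1" unfolding j_def by linarith+
      then have "\<bar>(x + real_of_int i * h) - real_of_int (i + j) * h\<bar> \<le> h"
        using h by (simp add: field_simps abs_le_iff)
      from one_plus_square_shift[OF this] show ?thesis by simp
    qed
    have sg': "Infinite_Set_Sum.abs_summable_on (\<lambda>i. ?g (i + j)) UNIV"
      using sg abs_summable_on_reindex_bij_betw[OF bij, of ?g] by simp
    have sx: "Infinite_Set_Sum.abs_summable_on (\<lambda>i::int. 1 / (1 + (x + real_of_int i * h)\<^sup>2)) UNIV"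
      by (rule abs_summable_on_comparison_test[OF sg'])
         (use le in \<open>auto simp: add_nonneg_nonneg intro: order_trans[OF _ abs_ge_self]\<close>)
    have "infsetsum (\<lambda>i::int. 1 / (1 + (x + real_of_int i * h)\<^sup>2)) UNIV \<le> infsetsum (\<lambda>i. ?g (i + j)) UNIV"
      using le by (intro infsetsum_mono sx sg')
    also have "\<dots> = infsetsum ?g UNIV" by (rule infsetsum_reindex_bij_betw[OF bij])
    finally show ?thesis using sx by simp
  qed
  show ?thesis using A by (intro that[of "infsetsum ?g UNIV"]) auto
qed

lemma has_vector_derivative_iexp_mult[derivative_intros]:
  "((\<lambda>t. iexp (t * a)) has_vector_derivative \<i> * complex_of_real a * iexp (t * a)) (at t within S)"
proof -
  have "((\<lambda>z. exp (\<i> * (z * complex_of_real a))) has_field_derivative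
      \<i> * complex_of_real a * exp (\<i> * (complex_of_real t * complex_of_real a))) (at (complex_of_real t))"
    by (auto intro!: derivative_eq_intros)
  from has_vector_derivative_real_field[OF this] show ?thesis by simp
qed

text \<open>Orthogonality over one period of the dual lattice: it inverts the Fourier series of a
  function on a lattice of span h using only frequencies with |t| <= pi / h.\<close>

lemma integral_iexp_period:
  assumes h: "(h::real) > 0"
  shows "(CLBINT t:{-(pi / h)..pi / h}. iexp (t * (real_of_int j * h))) = (if j = 0 then complex_of_real (2 * pi / h) else 0)"
proof (cases "j = 0")
  case True
  have "(CLBINT t:{-(pi / h)..pi / h}. (1::complex)) = complex_of_real (2 * pi / h)"
    using h by (simp add: set_lebesgue_integral_def scaleR_conv_of_real)
  then show ?thesis using True by simp
next
  case False
  let ?a = "real_of_int j * h"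
  let ?F = "\<lambda>t. iexp (t * ?a) / (\<i> * complex_of_real ?a)"
  have a: "?a \<noteq> 0" using False h by simp
  have "(CLBINT t:{-(pi / h)..pi / h}. iexp (t * ?a)) = ?F (pi / h) - ?F (- (pi / h))"
    unfolding set_lebesgue_integral_def
  proof (rule integral_FTC_atLeastAtMost)
    show "(?F has_vector_derivative iexp (t * ?a)) (at t within {-(pi / h)..pi / h})" for t
      using a by (intro has_vector_derivative_eq_rhs[OF has_vector_derivative_divide[OF has_vector_derivative_iexp_mult]]) simp
    show "continuous_on {-(pi / h)..pi / h} (\<lambda>t. iexp (t * ?a))" by (intro continuous_intros)
  qed (use h in \<open>auto simp: field_simps\<close>)
  also have "iexp (pi / h * ?a) = iexp (- (pi / h) * ?a)"
  proof -
    let ?z = "complex_of_int j * complex_of_real pi"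
    have "exp (\<i> * ?z) = exp (- (\<i> * ?z) + \<i> * (of_int j * (of_real pi * 2)))"
      by (simp add: algebra_simps)
    also have "\<dots> = exp (- (\<i> * ?z))" by (simp only: exp_add exp_2pi_1_int mult_1_right)
    finally have "exp (\<i> * ?z) = exp (- (\<i> * ?z))" .
    moreover have "iexp (pi / h * ?a) = exp (\<i> * ?z)" "iexp (- (pi / h) * ?a) = exp (- (\<i> * ?z))"
      using h by (simp_all add: mult.commute)
    ultimately show ?thesis by (simp only:)
  qed
  finally show ?thesis using False by simp
qed

section \<open>Local limit theorems\<close>

lemma finite_measure_interval: "finite_measure (density lborel (indicator {-A..A::real}))"
  by (rule finite_measureI) (simp add: emeasure_density emeasure_lborel_Icc_eq)

lemma integral_density_interval:
  fixes f :: "real \<Rightarrow> complex"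
  assumes [measurable]: "f \<in> borel_measurable borel"
  shows "(\<integral>t. f t \<partial>density lborel (indicator {-A..A})) = (LBINT t:{-A..A}. f t)"
proof -
  have "density lborel (indicator {-A..A}) = density lborel (\<lambda>t. ennreal (indicator {-A..A} t))"
    by (intro density_cong) (auto simp: indicator_def)
  then show ?thesis
    unfolding set_lebesgue_integral_def by (simp add: integral_density)
qed

text \<open>The expectation of \<phi> under \<open>L n\<close> is the integral of
  \<open>char M t ^ n\<close> against the Fourier series \<open>W n\<close> of the samples of \<phi>
  on the lattice of \<open>L n\<close>, taken over one period. This reduces the claim to
  \<open>local_limit_weighted\<close> with \<open>v n\<close> the value of \<open>W n\<close> at
  0.\<close>

theorem (in centered_distribution) local_limit_lattice:
  fixes L :: "nat \<Rightarrow> real measure" and b :: "nat \<Rightarrow> real" and \<phi> :: "real \<Rightarrow> real"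
  assumes h: "h > 0"
    and lt1: "\<And>t. t \<noteq> 0 \<Longrightarrow> \<bar>t\<bar> \<le> pi / h \<Longrightarrow> cmod (char M t) < 1"
    and L: "\<And>n. real_distribution (L n)" and char_L: "\<And>n t. char (L n) t = char M t ^ n"
    and lat: "\<And>n. AE x in L n. \<exists>i::int. x = b n + real_of_int i * h"
    and [measurable]: "\<phi> \<in> borel_measurable borel"
    and \<phi>: "\<And>x. \<bar>\<phi> x\<bar> \<le> C / (1 + x\<^sup>2)" "\<And>x. \<bar>x * \<phi> x\<bar> \<le> C / (1 + x\<^sup>2)"
  shows "(\<lambda>n. sqrt (real n) * (\<integral>x. \<phi> x \<partial>L n)
      - h * (\<Sum>\<^sub>\<infinity>i\<in>(UNIV::int set). \<phi> (b n + real_of_int i * h)) / sqrt (2 * pi * s)) \<longlonglongrightarrow> 0"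
proof -
  let ?Z = "count_space (UNIV::int set)"
  let ?A = "pi / h"
  let ?N = "density lborel (indicator {- ?A..?A})"
  define X where "X n i = b n + real_of_int i * h" for n and i :: int
  let ?\<phi> = "\<lambda>n i. complex_of_real (\<phi> (X n i))"
  \<comment> \<open>The normalisation of Fourier inversion on h Z: the reciprocal of the period
    length 2 pi / h.\<close>
  define c where "c = h / (2 * pi)"
  define W where "W n t = c * (\<integral>i. ?\<phi> n i * iexp (- (t * X n i)) \<partial>?Z)" for n t
  define v where "v n = c * (\<integral>i. ?\<phi> n i \<partial>?Z)" for n
  have [measurable]: "(\<lambda>i. X n i) \<in> borel_measurable ?Z" for n by simp
  have c: "c > 0" using h by (simp add: c_def)
  have C: "C \<ge> 0" using \<phi>(1)[of 0] by simp
  have A: "?A > 0" using h by simp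
  obtain D where D: "\<And>x. integrable ?Z (\<lambda>i::int. 1 / (1 + (x + real_of_int i * h)\<^sup>2))"
    "\<And>x. (\<integral>i. 1 / (1 + (x + real_of_int i * h)\<^sup>2) \<partial>?Z) \<le> D"
    using lattice_sum_bound[OF h] unfolding abs_summable_on_def infsetsum_def by blast
  have int_X: "integrable ?Z (\<lambda>i. C / (1 + (X n i)\<^sup>2))" and le_X: "(\<integral>i. C / (1 + (X n i)\<^sup>2) \<partial>?Z) \<le> C * D" for n
    using integrable_mult_right[OF D(1)[of "b n"], of C] mult_left_mono[OF D(2)[of "b n"] C, folded integral_mult_right_zero]
    by (simp_all add: X_def)
  have i\<phi>: "integrable ?Z (\<lambda>i. ?\<phi> n i)" for n
    by (rule Bochner_Integration.integrable_bound[OF int_X[of n]])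
       (use \<phi>(1) C in \<open>auto intro: order_trans[OF _ abs_ge_self]\<close>)
  have sum_le: "cmod (\<integral>i. f i \<partial>?Z) \<le> C * D"
    if "\<And>i. cmod (f i) \<le> C / (1 + (X n i)\<^sup>2)" for n and f :: "int \<Rightarrow> complex"
  proof (cases "integrable ?Z f")
    case True
    have "cmod (\<integral>i. f i \<partial>?Z) \<le> (\<integral>i. cmod (f i) \<partial>?Z)" by simp
    also have "\<dots> \<le> (\<integral>i. C / (1 + (X n i)\<^sup>2) \<partial>?Z)"
      using that by (intro integral_mono int_X integrable_norm True)
    finally show ?thesis using le_X[of n] by simp
  next
    \<comment> \<open>A sum that is not absolutely convergent has the default value 0, so it
      suffices that the right side is nonnegative.\<close>
    case False
    have "0 \<le> (\<integral>i. C / (1 + (X n i)\<^sup>2) \<partial>?Z)" using C by (intro integral_nonneg_AE) auto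
    then show ?thesis using False le_X[of n] by (simp add: not_integrable_integral_eq)
  qed
  have W_bound: "cmod (W n t) \<le> c * (C * D)" for n t
    unfolding W_def norm_mult using c \<phi>(1) by (auto simp: norm_mult intro!: mult_left_mono sum_le[of _ n])
  have v_bound: "cmod (v n) \<le> c * (C * D)" for n
    unfolding v_def norm_mult by (intro mult_mono sum_le[of _ n]) (use c \<phi>(1) in auto)
  have iW: "integrable ?Z (\<lambda>i. ?\<phi> n i * iexp (y i))" for n and y :: "int \<Rightarrow> real"
    by (rule Bochner_Integration.integrable_bound[OF i\<phi>[of n]]) (auto simp: norm_mult)
  interpret Z: sigma_finite_measure ?Z by (rule sigma_finite_measure_count_space)
  have [measurable]: "W n \<in> borel_measurable borel" for n
    unfolding W_def[abs_def] by (intro borel_measurable_times Z.borel_measurable_lebesgue_integral) measurable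
  \<comment> \<open>From |exp (i y) - 1| <= |y| with y = u x: the factor u is t / sqrt n, and the
    factor x is absorbed by the bound on x * \<phi> x, uniformly in n.\<close>
  have W_lim: "(\<lambda>n. W n (t / sqrt (real n)) - v n) \<longlonglongrightarrow> 0" for t
  proof (rule Lim_null_comparison)
    show "(\<lambda>n. c * (\<bar>t\<bar> / sqrt (real n) * (C * D))) \<longlonglongrightarrow> 0" by real_asymp
    show "\<forall>\<^sub>F n in sequentially. cmod (W n (t / sqrt (real n)) - v n) \<le> c * (\<bar>t\<bar> / sqrt (real n) * (C * D))"
    proof (rule always_eventually, rule allI)
      fix n
      let ?u = "t / sqrt (real n)"
      have "cmod (\<integral>i. ?\<phi> n i * (iexp (- (?u * X n i)) - 1) \<partial>?Z) \<le> \<bar>?u\<bar> * (C * D)"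
      proof (cases "?u = 0")
        case True show ?thesis unfolding True by simp
      next
        case False
        have "cmod (\<integral>i. ?\<phi> n i * (iexp (- (?u * X n i)) - 1) / complex_of_real ?u \<partial>?Z) \<le> C * D"
        proof (rule sum_le[of _ n])
          fix i
          have "cmod (iexp (- (?u * X n i)) - 1) \<le> \<bar>?u\<bar> * \<bar>X n i\<bar>"
            using iexp_approx1[of "- (?u * X n i)" 0] by (simp add: abs_mult)
          then have "\<bar>\<phi> (X n i)\<bar> * cmod (iexp (- (?u * X n i)) - 1) / \<bar>?u\<bar> \<le> \<bar>\<phi> (X n i)\<bar> * (\<bar>?u\<bar> * \<bar>X n i\<bar>) / \<bar>?u\<bar>"
            by (intro divide_right_mono mult_left_mono) auto
          also have "\<dots> = \<bar>X n i * \<phi> (X n i)\<bar>" using False by (simp add: abs_mult)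
          also have "\<dots> \<le> C / (1 + (X n i)\<^sup>2)" by (rule \<phi>(2))
          finally show "cmod (?\<phi> n i * (iexp (- (?u * X n i)) - 1) / complex_of_real ?u) \<le> C / (1 + (X n i)\<^sup>2)"
            by (simp only: norm_mult norm_divide norm_of_real)
        qed
        then have "cmod (\<integral>i. ?\<phi> n i * (iexp (- (?u * X n i)) - 1) \<partial>?Z) / \<bar>?u\<bar> \<le> C * D"
          unfolding integral_divide_zero norm_divide norm_of_real .
        moreover have "\<bar>?u\<bar> > 0" using False by (simp only: zero_less_abs_iff simp_thms)
        ultimately show ?thesis by (simp only: pos_divide_le_eq mult.commute)
      qed
      moreover have "W n ?u - v n = c * (\<integral>i. ?\<phi> n i * (iexp (- (?u * X n i)) - 1) \<partial>?Z)"
        unfolding W_def v_def right_diff_distrib[symmetric]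
        by (subst Bochner_Integration.integral_diff[symmetric, OF iW i\<phi>]) (simp add: algebra_simps)
      ultimately have "cmod (W n ?u - v n) \<le> c * (\<bar>?u\<bar> * (C * D))"
        using c by (simp only: norm_mult norm_of_real abs_of_pos mult_left_mono less_imp_le)
      then show "cmod (W n ?u - v n) \<le> c * (\<bar>t\<bar> / sqrt (real n) * (C * D))"
        by (simp only: abs_divide abs_of_nonneg real_sqrt_ge_0_iff of_nat_0_le_iff)
    qed
  qed
  have key: "(LBINT t:{- ?A..?A}. W n t * char M t ^ n) = complex_of_real (\<integral>x. \<phi> x \<partial>L n)" for n
  proof -
    interpret Ln: real_distribution "L n" by (rule L)
    interpret N: finite_measure ?N by (rule finite_measure_interval)
    have [measurable_cong]: "sets (L n) = sets borel" by simp
    have [measurable]: "char M \<in> borel_measurable borel" by (rule char_measurable)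
    have "(LBINT t:{- ?A..?A}. W n t * char M t ^ n) = (\<integral>t. W n t * char M t ^ n \<partial>?N)"
      by (rule integral_density_interval[symmetric]) measurable
    also have "\<dots> = (\<integral>t. (\<integral>x. 1 * (W n t * iexp (t * x)) \<partial>L n) \<partial>?N)"
      unfolding char_L[symmetric] by (simp add: char_def)
    also have "\<dots> = (\<integral>x. 1 * (\<integral>t. W n t * iexp (t * x) \<partial>?N) \<partial>L n)"
      by (rule Fubini_integrable_bounded[where B = "c * (C * D)"])
         (use W_bound in \<open>auto simp: finite_measure_interval norm_mult intro: Ln.sigma_finite_measure_axioms\<close>)
    also have "\<dots> = (\<integral>x. complex_of_real (\<phi> x) \<partial>L n)"
    proof (rule integral_cong_AE)
      \<comment> \<open>Inversion recovers \<phi> only at the points of the lattice, and that is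
        where \<open>L n\<close> lives.\<close>
      show "AE x in L n. 1 * (\<integral>t. W n t * iexp (t * x) \<partial>?N) = complex_of_real (\<phi> x)"
        using lat[of n]
      proof eventually_elim
        case (elim x)
        then obtain j where j: "x = X n j" by (auto simp: X_def)
        have eq: "iexp (- (t * X n i)) * iexp (t * x) = iexp (t * (real_of_int (j - i) * h))" for t i
          unfolding exp_add[symmetric] by (rule arg_cong[where f = exp]) (simp add: j X_def algebra_simps)
        have "(\<integral>t. W n t * iexp (t * x) \<partial>?N)
            = (\<integral>t. c * (\<integral>i. ?\<phi> n i * iexp (t * (real_of_int (j - i) * h)) \<partial>?Z) \<partial>?N)"
          unfolding W_def mult.assoc
          by (subst integral_mult_left_zero[symmetric]) (simp only: mult.assoc eq)
        also have "\<dots> = c * (\<integral>i. ?\<phi> n i * (\<integral>t. iexp (t * (real_of_int (j - i) * h)) \<partial>?N) \<partial>?Z)"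
          by (subst Fubini_integrable_bounded[where B = 1, symmetric])
             (use i\<phi> in \<open>auto simp: finite_measure_interval intro: sigma_finite_measure_count_space\<close>)
        also have "\<dots> = c * (\<integral>i. complex_of_real (\<phi> (X n j) * (2 * pi / h)) * indicator {j} i \<partial>?Z)"
        proof -
          have "(\<integral>t. iexp (t * (real_of_int (j - i) * h)) \<partial>?N) = (if j - i = 0 then complex_of_real (2 * pi / h) else 0)" for i
            by (subst integral_density_interval, measurable) (rule integral_iexp_period[OF h])
          then have "?\<phi> n i * (\<integral>t. iexp (t * (real_of_int (j - i) * h)) \<partial>?N)
              = complex_of_real (\<phi> (X n j) * (2 * pi / h)) * indicator {j} i" for i
            by (simp only: of_real_mult) (auto simp: indicator_def)
          then show ?thesis by simp
        qed
        also have "(\<integral>i. complex_of_real (\<phi> (X n j) * (2 * pi / h)) * indicator {j} i \<partial>?Z)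
            = complex_of_real (\<phi> (X n j) * (2 * pi / h))"
        proof -
          have "{i. indicator {j} i \<noteq> (0::complex)} = {j}" by (auto simp: indicator_def)
          then have "(\<integral>i. indicator {j} i \<partial>?Z) = (1::complex)"
            by (subst lebesgue_integral_count_space_finite_support) auto
          then show ?thesis by simp
        qed
        also have "c * complex_of_real (\<phi> (X n j) * (2 * pi / h)) = complex_of_real (\<phi> x)" using h by (simp add: c_def j)
        finally show ?case by simp
      qed
    qed measurable
    finally show ?thesis by simp
  qed
  have "(\<lambda>n. sqrt (real n) *\<^sub>R (LBINT t:{- ?A..?A}. W n t * char M t ^ n) - v n * sqrt (2 * pi / s)) \<longlonglongrightarrow> 0"
    by (rule local_limit_weighted[where B = "c * (C * D)"])
       (use lt1 A W_bound v_bound W_lim in auto)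
  moreover have "v n * sqrt (2 * pi / s)
      = complex_of_real (h * (\<Sum>\<^sub>\<infinity>i\<in>(UNIV::int set). \<phi> (b n + real_of_int i * h)) / sqrt (2 * pi * s))" for n
  proof -
    have "integrable ?Z (\<lambda>i. \<phi> (X n i))" using i\<phi>[of n] by (simp add: complex_of_real_integrable_eq)
    then have "(\<integral>i. \<phi> (X n i) \<partial>?Z) = (\<Sum>\<^sub>\<infinity>i\<in>UNIV. \<phi> (X n i))"
      using infsetsum_infsum[of "\<lambda>i. \<phi> (X n i)" UNIV] by (simp add: abs_summable_on_def infsetsum_def)
    then have "v n * sqrt (2 * pi / s) = complex_of_real ((c * sqrt (2 * pi / s)) * (\<Sum>\<^sub>\<infinity>i\<in>UNIV. \<phi> (X n i)))"
      by (simp add: v_def mult_ac)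
    also have "c * sqrt (2 * pi / s) = h / sqrt (2 * pi * s)"
    proof -
      have "sqrt (2 * pi / s) = 2 * pi / sqrt (2 * pi * s)"
        using s by (simp add: real_sqrt_divide real_sqrt_mult field_simps)
      then show ?thesis using s h by (simp add: c_def)
    qed
    finally show ?thesis by (simp add: X_def)
  qed
  ultimately have "(\<lambda>n. complex_of_real (sqrt (real n) * (\<integral>x. \<phi> x \<partial>L n)
      - h * (\<Sum>\<^sub>\<infinity>i\<in>(UNIV::int set). \<phi> (b n + real_of_int i * h)) / sqrt (2 * pi * s))) \<longlonglongrightarrow> 0"
    by (simp add: key scaleR_conv_of_real)
  then have "(\<lambda>n. complex_of_real (sqrt (real n) * (\<integral>x. \<phi> x \<partial>L n)
      - h * (\<Sum>\<^sub>\<infinity>i\<in>(UNIV::int set). \<phi> (b n + real_of_int i * h)) / sqrt (2 * pi * s))) \<longlonglongrightarrow> complex_of_real 0"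
    by simp
  then show ?thesis by (rule iffD1[OF tendsto_of_real_iff])
qed

section \<open>A positive kernel with compactly supported Fourier transform\<close>

definition fejer :: "real \<Rightarrow> real" where
  "fejer x = (if x = 0 then 1 else 2 * (1 - cos x) / x\<^sup>2)"

definition tent :: "real \<Rightarrow> real" where
  "tent t = max 0 (1 - \<bar>t\<bar>)"

lemma tent_measurable[measurable]: "tent \<in> borel_measurable borel"
  unfolding tent_def[abs_def] by measurable

lemma tent_bounds: "0 \<le> tent t" "tent t \<le> 1"
  by (auto simp: tent_def)

lemma integrable_tent_iexp:
  "integrable lborel (\<lambda>t. indicator {-1..1} t *\<^sub>R (complex_of_real (tent t) * iexp (t * x)))"
  by (rule Bochner_Integration.integrable_bound[where f = "indicator {-1..1::real}"])
     (use tent_bounds in \<open>auto simp: norm_mult indicator_def\<close>)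

text \<open>Away from 0, \<open>fejer x\<close> is the square of sin (x / 2) / (x / 2). The tent is
  split at 0 into two linear pieces with explicit antiderivatives; the pieces overlap in the point
  0, a null set.\<close>

lemma fejer_eq_integral: "(CLBINT t:{-1..1}. complex_of_real (tent t) * iexp (t * x)) = complex_of_real (fejer x)"
proof -
  let ?l = "\<lambda>t. complex_of_real (1 + t) * iexp (t * x)"
  let ?r = "\<lambda>t. complex_of_real (1 - t) * iexp (t * x)"
  have c: "continuous_on A ?l" "continuous_on A ?r" for A by (intro continuous_intros)+
  have int: "integrable lborel (\<lambda>t. indicator {a..b} t *\<^sub>R ?l t)" "integrable lborel (\<lambda>t. indicator {a..b} t *\<^sub>R ?r t)"
    for a b :: real
    using borel_integrable_atLeastAtMost'[OF c(1), of a b] borel_integrable_atLeastAtMost'[OF c(2), of a b]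
    by (simp_all add: set_integrable_def)
  have "(CLBINT t:{-1..1}. complex_of_real (tent t) * iexp (t * x))
      = (CLBINT t. indicator {-1..0} t *\<^sub>R ?l t + indicator {0..1} t *\<^sub>R ?r t)"
    unfolding set_lebesgue_integral_def
  proof (rule integral_cong_AE)
    show "AE t in lborel. indicator {-1..1} t *\<^sub>R (complex_of_real (tent t) * iexp (t * x))
        = indicator {-1..0} t *\<^sub>R ?l t + indicator {0..1} t *\<^sub>R ?r t"
      using AE_lborel_singleton[of "0::real"]
      by eventually_elim (auto simp: indicator_def tent_def)
  qed auto
  also have "\<dots> = (CLBINT t. indicator {-1..0} t *\<^sub>R ?l t) + (CLBINT t. indicator {0..1} t *\<^sub>R ?r t)"
    by (intro Bochner_Integration.integral_add int)
  also have "\<dots> = complex_of_real (fejer x)"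
  proof (cases "x = 0")
    case True
    have "(CLBINT t. indicator {-1..0} t *\<^sub>R ?l t) = complex_of_real (0 + 0\<^sup>2 / 2) - complex_of_real (-1 + (-1)\<^sup>2 / 2)"
    proof (rule integral_FTC_atLeastAtMost)
      fix t :: real
      have "((\<lambda>t. t + t\<^sup>2 / 2) has_real_derivative 1 + t) (at t within S)" for S
        by (auto intro!: derivative_eq_intros)
      from has_vector_derivative_of_real[OF this]
      show "((\<lambda>t. complex_of_real (t + t\<^sup>2 / 2)) has_vector_derivative complex_of_real (1 + t) * iexp (t * x)) (at t within S)" for S
        using True by (simp only: mult_zero_right of_real_0 exp_zero mult_1_right)
    qed (use c in auto)
    moreover have "(CLBINT t. indicator {0..1} t *\<^sub>R ?r t) = complex_of_real (1 - 1\<^sup>2 / 2) - complex_of_real (0 - 0\<^sup>2 / 2)"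
    proof (rule integral_FTC_atLeastAtMost)
      fix t :: real
      have "((\<lambda>t. t - t\<^sup>2 / 2) has_real_derivative 1 - t) (at t within S)" for S
        by (auto intro!: derivative_eq_intros)
      from has_vector_derivative_of_real[OF this]
      show "((\<lambda>t. complex_of_real (t - t\<^sup>2 / 2)) has_vector_derivative complex_of_real (1 - t) * iexp (t * x)) (at t within S)" for S
        using True by (simp only: mult_zero_right of_real_0 exp_zero mult_1_right)
    qed (use c in auto)
    ultimately show ?thesis by (simp only:) (simp add: fejer_def True)
  next
    case False
    let ?z = "\<i> * complex_of_real x"
    have z: "?z \<noteq> 0" using False by simp
    have alg: "e * (1 / z) + z * e * (a / z - 1 / z\<^sup>2) = a * e" if "z \<noteq> 0" for a e z :: complex
      using that by (simp add: field_simps power2_eq_square)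
    have alg': "e * (- 1 / z) + z * e * (a / z + 1 / z\<^sup>2) = a * e" if "z \<noteq> 0" for a e z :: complex
      using that by (simp add: field_simps power2_eq_square)
    let ?L = "\<lambda>t. iexp (t * x) * (complex_of_real (1 + t) / ?z - 1 / ?z\<^sup>2)"
    let ?R = "\<lambda>t. iexp (t * x) * (complex_of_real (1 - t) / ?z + 1 / ?z\<^sup>2)"
    have L: "(CLBINT t. indicator {-1..0} t *\<^sub>R ?l t) = ?L 0 - ?L (-1)"
    proof (rule integral_FTC_atLeastAtMost)
      fix t :: real
      have "(?L has_vector_derivative iexp (t * x) * (1 / ?z)
          + ?z * iexp (t * x) * (complex_of_real (1 + t) / ?z - 1 / ?z\<^sup>2)) (at t within {-1..0})"
        by (intro has_vector_derivative_mult has_vector_derivative_iexp_mult)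
           (auto intro!: derivative_eq_intros)
      also have "iexp (t * x) * (1 / ?z) + ?z * iexp (t * x) * (complex_of_real (1 + t) / ?z - 1 / ?z\<^sup>2) = ?l t"
        using alg[OF z, of "iexp (t * x)" "complex_of_real (1 + t)"] by simp
      finally show "(?L has_vector_derivative ?l t) (at t within {-1..0})" .
    qed (use c in auto)
    have R: "(CLBINT t. indicator {0..1} t *\<^sub>R ?r t) = ?R 1 - ?R 0"
    proof (rule integral_FTC_atLeastAtMost)
      fix t :: real
      have "(?R has_vector_derivative iexp (t * x) * (- 1 / ?z)
          + ?z * iexp (t * x) * (complex_of_real (1 - t) / ?z + 1 / ?z\<^sup>2)) (at t within {0..1})"
        by (intro has_vector_derivative_mult has_vector_derivative_iexp_mult)
           (auto intro!: derivative_eq_intros)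
      also have "iexp (t * x) * (- 1 / ?z) + ?z * iexp (t * x) * (complex_of_real (1 - t) / ?z + 1 / ?z\<^sup>2) = ?r t"
        using alg'[OF z, of "iexp (t * x)" "complex_of_real (1 - t)"] by simp
      finally show "(?R has_vector_derivative ?r t) (at t within {0..1})" .
    qed (use c in auto)
    have "iexp x + iexp (- x) = complex_of_real (2 * cos x)"
      by (simp add: complex_eq_iff Re_exp Im_exp)
    moreover have "(?L 0 - ?L (-1)) + (?R 1 - ?R 0) = (iexp x + iexp (- x) - 2) / ?z\<^sup>2"
      by (simp add: diff_divide_distrib add_divide_distrib algebra_simps)
    moreover have "?z\<^sup>2 = complex_of_real (- x\<^sup>2)" by (simp add: power_mult_distrib)
    ultimately have "(?L 0 - ?L (-1)) + (?R 1 - ?R 0) = complex_of_real ((2 * cos x - 2) / (- x\<^sup>2))"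
      by (simp only: of_real_divide of_real_diff of_real_numeral)
    also have "(2 * cos x - 2) / (- x\<^sup>2) = fejer x" using False by (simp add: fejer_def field_simps)
    finally show ?thesis unfolding L R .
  qed
  finally show ?thesis .
qed

text \<open>The removable singularity at 0 is bypassed by dominated convergence in the integral
  representation.\<close>

lemma isCont_fejer: "isCont fejer x"
proof -
  have "isCont (\<lambda>x. CLBINT t:{-1..1}. complex_of_real (tent t) * iexp (t * x)) x"
    unfolding continuous_at_sequentially set_lebesgue_integral_def comp_def
  proof safe
    fix X assume X: "X \<longlonglongrightarrow> x"
    show "(\<lambda>n. CLBINT t. indicator {-1..1} t *\<^sub>R (complex_of_real (tent t) * iexp (t * X n)))
        \<longlonglongrightarrow> (CLBINT t. indicator {-1..1} t *\<^sub>R (complex_of_real (tent t) * iexp (t * x)))"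
    proof (rule integral_dominated_convergence[where w = "indicator {-1..1}"])
      show "AE t in lborel. (\<lambda>n. indicator {-1..1} t *\<^sub>R (complex_of_real (tent t) * iexp (t * X n)))
          \<longlonglongrightarrow> indicator {-1..1} t *\<^sub>R (complex_of_real (tent t) * iexp (t * x))"
        by (intro AE_I2 tendsto_intros X)
    qed (use tent_bounds in \<open>auto simp: norm_mult indicator_def\<close>)
  qed
  then have "isCont (\<lambda>x. complex_of_real (fejer x)) x" unfolding fejer_eq_integral .
  from continuous_Re[OF this] show ?thesis by simp
qed

lemma fejer_nonneg: "fejer x \<ge> 0"
  by (simp add: fejer_def)

text \<open>The sum of fejer x <= 2, read off the integral over an interval of length 2, and x^2
  fejer x = 2 (1 - cos x) <= 4.\<close>

lemma fejer_le: "fejer x \<le> 6 / (1 + x\<^sup>2)"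
proof (cases "x = 0")
  case False
  have "cmod (CLBINT t:{-1..1}. complex_of_real (tent t) * iexp (t * x)) \<le> (LBINT t. indicator {-1..1::real} t)"
    unfolding set_lebesgue_integral_def
    by (rule Bochner_Integration.integral_norm_bound_integral[OF integrable_tent_iexp integrable_real_indicator])
       (use tent_bounds in \<open>auto simp: norm_mult indicator_def\<close>)
  then have le2: "fejer x \<le> 2" unfolding fejer_eq_integral using fejer_nonneg[of x] by simp
  have "2 * (1 - cos x) \<le> 4" using cos_ge_minus_one[of x] by argo
  moreover have "fejer x * x\<^sup>2 = 2 * (1 - cos x)" using False by (simp add: fejer_def)
  ultimately have "fejer x * x\<^sup>2 \<le> 4" by simp
  with le2 have "fejer x * (1 + x\<^sup>2) \<le> 6" by (simp add: algebra_simps)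
  then show ?thesis by (simp add: field_simps add_pos_nonneg)
qed (simp add: fejer_def)

lemma fejer_ge: "2 * (1 - cos x) \<le> fejer x * (1 + x\<^sup>2)"
  by (auto simp: fejer_def field_simps)

text \<open>The Fejer kernel has real zeros; adding a translate by half a period removes them while
  keeping the Fourier transform compactly supported.\<close>

definition kern :: "real \<Rightarrow> real" where
  "kern x = fejer x + fejer (x - pi)"

definition kern_hat :: "real \<Rightarrow> complex" where
  "kern_hat t = complex_of_real (tent t) * (1 + iexp (- (t * pi)))"

lemma isCont_kern: "isCont kern x"
  unfolding kern_def[abs_def]
  by (intro continuous_intros isCont_fejer isCont_o2[OF _ isCont_fejer])

lemma kern_measurable[measurable]: "kern \<in> borel_measurable borel"
  using isCont_kern by (intro borel_measurable_continuous_onI continuous_at_imp_continuous_on) auto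

lemma kern_hat_measurable[measurable]: "kern_hat \<in> borel_measurable borel"
  unfolding kern_hat_def[abs_def] by measurable

text \<open>A lower bound of the same order as the assumed decay of \<phi> makes \<phi> /
  \<open>kern\<close> a bounded function, as weak convergence requires.\<close>

lemma kern_ge: "4 / (33 * (1 + x\<^sup>2)) \<le> kern x"
proof -
  have p: "pi\<^sup>2 \<le> 16"
    using power_mono[of pi 4 2] pi_less_4 pi_ge_zero by simp
  have "0 \<le> (x + pi)\<^sup>2" by simp
  \<comment> \<open>With pi < 4, (x - pi)^2 <= 2 x^2 + 2 pi^2 <= 2 x^2 + 32, whence the constant
    33.\<close>
  then have q: "1 + (x - pi)\<^sup>2 \<le> 33 * (1 + x\<^sup>2)"
  proof -
    have "(x - pi)\<^sup>2 + (x + pi)\<^sup>2 = 2 * x\<^sup>2 + 2 * pi\<^sup>2" by (simp add: power2_eq_square algebra_simps)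
    moreover have "0 \<le> x\<^sup>2" by simp
    ultimately show ?thesis using p \<open>0 \<le> (x + pi)\<^sup>2\<close> unfolding distrib_left by linarith
  qed
  \<comment> \<open>Because cos (x - pi) = - cos x, the two lower bounds add up to exactly
    4.\<close>
  have "4 \<le> fejer x * (1 + x\<^sup>2) + fejer (x - pi) * (1 + (x - pi)\<^sup>2)"
    using fejer_ge[of x] fejer_ge[of "x - pi"] by simp
  also have "\<dots> \<le> fejer x * (33 * (1 + x\<^sup>2)) + fejer (x - pi) * (33 * (1 + x\<^sup>2))"
    using q fejer_nonneg by (intro add_mono mult_left_mono) auto
  finally have "4 \<le> kern x * (33 * (1 + x\<^sup>2))" by (simp add: kern_def algebra_simps)
  then show ?thesis by (simp add: field_simps add_pos_nonneg)
qed

lemma kern_pos: "kern x > 0"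
  by (rule less_le_trans[OF _ kern_ge]) (simp add: add_pos_nonneg)

lemma kern_le: obtains B where "\<And>x. kern x \<le> B / (1 + x\<^sup>2)" "B > 0"
proof
  show "kern x \<le> (6 + 6 * (2 * (1 + pi\<^sup>2))) / (1 + x\<^sup>2)" for x
  proof -
    have "fejer (x - pi) \<le> 6 * (1 / (1 + (x - pi)\<^sup>2))" using fejer_le[of "x - pi"] by simp
    also have "\<dots> \<le> 6 * (2 * (1 + pi\<^sup>2) / (1 + x\<^sup>2))"
      by (intro mult_left_mono one_plus_square_shift) auto
    finally show ?thesis using fejer_le[of x] by (simp add: kern_def add_divide_distrib)
  qed
qed (auto intro: add_pos_nonneg)

lemma integrable_cauchy_density: "integrable lborel (\<lambda>x::real. B / (1 + x\<^sup>2))"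
proof -
  have "integrable lborel (\<lambda>x::real. inverse (1 + x\<^sup>2))"
    using integrable_inverse_1_plus_square by (simp add: set_integrable_def)
  from integrable_mult_right[OF this, of B] show ?thesis by (simp add: field_simps)
qed

lemma integrable_kern: "integrable lborel kern"
proof -
  obtain B where B: "\<And>x. kern x \<le> B / (1 + x\<^sup>2)" "B > 0" using kern_le by blast
  show ?thesis
    by (rule Bochner_Integration.integrable_bound[OF integrable_cauchy_density[of B]])
       (use B kern_pos less_imp_le in \<open>auto intro!: AE_I2 order_trans[OF _ abs_ge_self] simp: abs_of_pos\<close>)
qed

lemma cmod_kern_hat: "cmod (kern_hat t) \<le> 2"
proof -
  have "cmod (1 + iexp (- (t * pi))) \<le> 2" by (rule order_trans[OF norm_triangle_ineq]) simp
  with tent_bounds[of t] have "\<bar>tent t\<bar> * cmod (1 + iexp (- (t * pi))) \<le> 1 * 2"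
    by (intro mult_mono) auto
  then show ?thesis by (simp add: kern_hat_def norm_mult)
qed

lemma kern_hat_zero: "kern_hat t = 0" if "\<bar>t\<bar> > 1"
  using that by (simp add: kern_hat_def tent_def)

lemma isCont_kern_hat: "isCont kern_hat t"
  unfolding kern_hat_def[abs_def] tent_def[abs_def] by (intro continuous_intros)

lemma kern_eq_integral: "(CLBINT t:{-1..1}. kern_hat t * iexp (t * x)) = complex_of_real (kern x)"
proof -
  have "kern_hat t * iexp (t * x) = complex_of_real (tent t) * iexp (t * x) + complex_of_real (tent t) * iexp (t * (x - pi))" for t
  proof -
    have "iexp (- (t * pi)) * iexp (t * x) = iexp (t * (x - pi))"
      unfolding exp_add[symmetric] by (rule arg_cong[where f = exp]) (simp add: algebra_simps)
    then show ?thesis by (simp add: kern_hat_def algebra_simps)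
  qed
  then have "(CLBINT t:{-1..1}. kern_hat t * iexp (t * x))
      = (CLBINT t. indicator {-1..1} t *\<^sub>R (complex_of_real (tent t) * iexp (t * x))
          + indicator {-1..1} t *\<^sub>R (complex_of_real (tent t) * iexp (t * (x - pi))))"
    by (simp add: set_lebesgue_integral_def scaleR_add_right)
  also have "\<dots> = complex_of_real (fejer x) + complex_of_real (fejer (x - pi))"
    unfolding fejer_eq_integral[symmetric] set_lebesgue_integral_def
    by (rule Bochner_Integration.integral_add) (rule integrable_tent_iexp)+
  finally show ?thesis by (simp add: kern_def)
qed

text \<open>The compact support of \<open>kern_hat\<close> confines the frequencies to
  [u - 1, u + 1], so only values of the characteristic function on a bounded set enter. The window
  is enlarged to a symmetric one to fit \<open>local_limit_weighted\<close>.\<close>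

lemma (in real_distribution) integral_kern_iexp:
  "(CLINT x|M. kern x * iexp (u * x)) = (CLBINT t:{-(1 + \<bar>u\<bar>)..1 + \<bar>u\<bar>}. kern_hat (t - u) * char M t)"
proof -
  let ?N = "density lborel (indicator {-1..1::real})"
  interpret N: finite_measure ?N by (rule finite_measure_interval)
  have [measurable_cong]: "sets M = sets borel" by simp
  have [measurable]: "char M \<in> borel_measurable borel" by (rule char_measurable)
  have "(CLINT x|M. kern x * iexp (u * x)) = (\<integral>x. 1 * (\<integral>t. kern_hat t * iexp ((t + u) * x) \<partial>?N) \<partial>M)"
  proof (rule Bochner_Integration.integral_cong[OF refl])
    fix x
    have "iexp ((t + u) * x) = iexp (t * x) * iexp (u * x)" for t
      unfolding exp_add[symmetric] by (rule arg_cong[where f = exp]) (simp add: algebra_simps)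
    then have "(\<integral>t. kern_hat t * iexp ((t + u) * x) \<partial>?N) = (\<integral>t. kern_hat t * iexp (t * x) * iexp (u * x) \<partial>?N)"
      by (simp only: mult.assoc)
    also have "\<dots> = (\<integral>t. kern_hat t * iexp (t * x) \<partial>?N) * iexp (u * x)"
      by (rule integral_mult_left_zero)
    also have "(\<integral>t. kern_hat t * iexp (t * x) \<partial>?N) = complex_of_real (kern x)"
      by (subst integral_density_interval, measurable) (rule kern_eq_integral)
    finally show "kern x * iexp (u * x) = 1 * (\<integral>t. kern_hat t * iexp ((t + u) * x) \<partial>?N)" by simp
  qed
  also have "\<dots> = (\<integral>t. (\<integral>x. 1 * (kern_hat t * iexp ((t + u) * x)) \<partial>M) \<partial>?N)"
    by (rule Fubini_integrable_bounded[symmetric, where B = 2])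
       (use cmod_kern_hat in \<open>auto simp: norm_mult finite_measure_interval intro: sigma_finite_measure_axioms\<close>)
  also have "\<dots> = (\<integral>t. kern_hat t * char M (t + u) \<partial>?N)" by (simp add: char_def)
  also have "\<dots> = (CLBINT t:{-1..1}. kern_hat t * char M (t + u))"
    by (rule integral_density_interval) measurable
  also have "\<dots> = (CLBINT t. kern_hat t * char M (t + u))"
    unfolding set_lebesgue_integral_def
  proof (rule Bochner_Integration.integral_cong[OF refl])
    fix t :: real
    show "indicator {-1..1} t *\<^sub>R (kern_hat t * char M (t + u)) = kern_hat t * char M (t + u)"
      using kern_hat_zero[of t] by (cases "\<bar>t\<bar> > 1") (auto simp: indicator_def abs_le_iff not_less)
  qed
  also have "\<dots> = (CLBINT t. kern_hat (t - u) * char M t)"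
    using lborel_integral_real_affine[where c = 1 and t = u and f = "\<lambda>t. kern_hat (t - u) * char M t"]
    by (simp add: add.commute)
  also have "\<dots> = (CLBINT t:{-(1 + \<bar>u\<bar>)..1 + \<bar>u\<bar>}. kern_hat (t - u) * char M t)"
    unfolding set_lebesgue_integral_def
  proof (rule Bochner_Integration.integral_cong[OF refl])
    fix t :: real
    have "\<bar>t - u\<bar> > 1" if "t \<notin> {-(1 + \<bar>u\<bar>)..1 + \<bar>u\<bar>}" using that by (auto simp: not_le)
    then show "kern_hat (t - u) * char M t = indicator {-(1 + \<bar>u\<bar>)..1 + \<bar>u\<bar>} t *\<^sub>R (kern_hat (t - u) * char M t)"
      using kern_hat_zero[of "t - u"] by (cases "t \<in> {-(1 + \<bar>u\<bar>)..1 + \<bar>u\<bar>}") auto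
  qed
  finally show ?thesis .
qed

lemma (in centered_distribution) local_limit_kern:
  assumes lt1: "\<And>t. t \<noteq> 0 \<Longrightarrow> cmod (char M t) < 1"
    and L: "\<And>n. real_distribution (L n)" and char_L: "\<And>n t. char (L n) t = char M t ^ n"
  shows "(\<lambda>n. sqrt (real n) *\<^sub>R (CLINT x|L n. kern x * iexp (u * x))) \<longlonglongrightarrow> kern_hat (- u) * sqrt (2 * pi / s)"
proof -
  have "(\<lambda>n. sqrt (real n) *\<^sub>R (LBINT t:{-(1 + \<bar>u\<bar>)..1 + \<bar>u\<bar>}. kern_hat (t - u) * char M t ^ n)
      - kern_hat (- u) * sqrt (2 * pi / s)) \<longlonglongrightarrow> 0"
  proof (rule local_limit_weighted[where B = 2])
    show "(\<lambda>n. kern_hat (t / sqrt (real n) - u) - kern_hat (- u)) \<longlonglongrightarrow> 0" for t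
    proof (rule LIM_zero)
      have "(\<lambda>n. t / sqrt (real n)) \<longlonglongrightarrow> 0" by real_asymp
      from tendsto_diff[OF this tendsto_const[of u]] have "(\<lambda>n. t / sqrt (real n) - u) \<longlonglongrightarrow> - u" by simp
      then show "(\<lambda>n. kern_hat (t / sqrt (real n) - u)) \<longlonglongrightarrow> kern_hat (- u)"
        by (rule isCont_tendsto_compose[OF isCont_kern_hat])
    qed
  qed (use lt1 cmod_kern_hat in auto)
  then have "(\<lambda>n. sqrt (real n) *\<^sub>R (CLINT x|L n. kern x * iexp (u * x)) - kern_hat (- u) * sqrt (2 * pi / s)) \<longlonglongrightarrow> 0"
    by (simp only: real_distribution.integral_kern_iexp[OF L] char_L)
  then show ?thesis by (rule LIM_zero_cancel)
qed

text \<open>The Fourier transform of the kernel is read off from the local limit for Gaussian sums.\<close>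

lemma fourier_kern: "(CLBINT x. kern x * iexp (u * x)) = 2 * pi * kern_hat (- u)"
proof -
  let ?G = "std_normal_distribution"
  interpret G: real_distribution ?G by (rule real_dist_normal_dist)
  interpret G: centered_distribution ?G 1
    using integrable_std_normal_distribution_moment[of 1] integrable_std_normal_distribution_moment[of 2]
      integral_std_normal_distribution_moment_odd[of 1] std_normal_distribution_even_moments(1)[of 1]
    by unfold_locales simp_all
  have [measurable_cong]: "sets ?G = sets borel" by simp
  \<comment> \<open>The law of a sum of n independent standard Gaussians, realised by rescaling a
    single one.\<close>
  define L where "L n = distr ?G borel (\<lambda>x. sqrt (real n) * x)" for n
  have L: "real_distribution (L n)" for n
    unfolding L_def by (intro G.real_distribution_distr) measurable
  have char_L: "char (L n) t = char ?G t ^ n" for n t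
  proof -
    have "char (L n) t = char ?G (sqrt (real n) * t)"
      unfolding L_def char_def by (subst integral_distr) (auto simp: mult_ac)
    also have "\<dots> = complex_of_real (exp (real n * (- (t\<^sup>2) / 2)))"
      by (simp add: char_std_normal_distribution power_mult_distrib)
    also have "\<dots> = char ?G t ^ n"
      by (simp only: exp_of_nat_mult char_std_normal_distribution of_real_power)
    finally show ?thesis .
  qed
  \<comment> \<open>sqrt n times the density of this Gaussian tends to the constant 1 / sqrt (2 pi),
    so the left side of the kernel limit also tends to a multiple of the Lebesgue integral.
    Comparing the two limits gives the transform.\<close>
  let ?F = "\<lambda>n x. (exp (- (x\<^sup>2 / real n / 2)) / sqrt (2 * pi)) *\<^sub>R (complex_of_real (kern x) * iexp (u * x))"
  let ?H = "\<lambda>x. (exp 0 / sqrt (2 * pi)) *\<^sub>R (complex_of_real (kern x) * iexp (u * x))"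
  have lim: "(\<lambda>n. sqrt (real n) *\<^sub>R (CLINT x|L n. complex_of_real (kern x) * iexp (u * x))) \<longlonglongrightarrow> kern_hat (- u) * sqrt (2 * pi / 1)"
    by (rule G.local_limit_kern[OF _ L char_L]) (simp add: char_std_normal_distribution)
  have eq: "sqrt (real n) *\<^sub>R (CLINT x|L n. complex_of_real (kern x) * iexp (u * x))
      = (CLBINT x. ?F n x)" if n: "n > 0" for n
  proof -
    let ?f = "?F n"
    have "(CLINT x|L n. complex_of_real (kern x) * iexp (u * x)) = (CLINT x|?G. kern (sqrt (real n) * x) * iexp (u * (sqrt (real n) * x)))"
      unfolding L_def by (subst integral_distr) auto
    also have "\<dots> = (CLBINT x. std_normal_density x *\<^sub>R (kern (sqrt (real n) * x) * iexp (u * (sqrt (real n) * x))))"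
      by (subst integral_density) auto
    also have "\<dots> = (CLBINT x. ?f (0 + sqrt (real n) * x))"
      using n by (intro Bochner_Integration.integral_cong refl) (simp add: std_normal_density_def power_mult_distrib)
    finally show ?thesis
      using lborel_integral_real_affine[of "sqrt (real n)" ?f 0] n by simp
  qed
  have lim2: "(\<lambda>n. CLBINT x. ?F n x)
      \<longlonglongrightarrow> (CLBINT x. ?H x)"
  proof (rule integral_dominated_convergence[where w = kern])
    show "AE x in lborel. (\<lambda>n. ?F n x)
      \<longlonglongrightarrow> ?H x"
    proof (rule AE_I2)
      fix x :: real
      have "(\<lambda>n. - (x\<^sup>2 / real n / 2)) \<longlonglongrightarrow> 0" by real_asymp
      then show "(\<lambda>n. ?F n x)
      \<longlonglongrightarrow> ?H x"
        by (intro tendsto_intros) auto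
    qed
    show "AE x in lborel. cmod (?F n x) \<le> kern x" for n
    proof (rule AE_I2)
      fix x :: real
      have "exp (- (x\<^sup>2 / real n / 2)) \<le> 1" by simp
      also have "1 \<le> sqrt (2 * pi)" using pi_ge_two by (simp add: real_le_rsqrt)
      finally have "exp (- (x\<^sup>2 / real n / 2)) / sqrt (2 * pi) \<le> 1" by simp
      then have "exp (- (x\<^sup>2 / real n / 2)) / sqrt (2 * pi) * kern x \<le> 1 * kern x"
        using kern_pos[of x] by (intro mult_right_mono) auto
      then show "cmod (?F n x) \<le> kern x"
        using kern_pos[of x] by (simp add: norm_mult)
    qed
  qed (use integrable_kern in auto)
  have ev: "\<forall>\<^sub>F n in sequentially. sqrt (real n) *\<^sub>R (CLINT x|L n. complex_of_real (kern x) * iexp (u * x))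
      = (CLBINT x. ?F n x)"
    using eventually_gt_at_top[of 0] by eventually_elim (rule eq)
  have "kern_hat (- u) * sqrt (2 * pi / 1) = (CLBINT x. ?H x)"
    by (rule LIMSEQ_unique[OF lim]) (subst tendsto_cong[OF ev], rule lim2)
  also have "\<dots> = (1 / sqrt (2 * pi)) *\<^sub>R (CLBINT x. complex_of_real (kern x) * iexp (u * x))"
    by (subst integral_scaleR_right) auto
  finally have "sqrt (2 * pi) *\<^sub>R (kern_hat (- u) * sqrt (2 * pi)) = (CLBINT x. complex_of_real (kern x) * iexp (u * x))"
    by simp
  then show ?thesis by (simp add: scaleR_conv_of_real mult_ac flip: of_real_mult)
qed

text \<open>Weighting the law of the sum by the kernel turns the local limit into weak convergence of
  probability measures, to which Levy's continuity theorem applies.\<close>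

theorem (in centered_distribution) local_limit_nonlattice:
  fixes L :: "nat \<Rightarrow> real measure" and \<phi> :: "real \<Rightarrow> real"
  assumes lt1: "\<And>t. t \<noteq> 0 \<Longrightarrow> cmod (char M t) < 1"
    and L: "\<And>n. real_distribution (L n)" and char_L: "\<And>n t. char (L n) t = char M t ^ n"
    and \<phi>_cont: "\<And>x. isCont \<phi> x" and \<phi>: "\<And>x. \<bar>\<phi> x\<bar> \<le> C / (1 + x\<^sup>2)"
  shows "(\<lambda>n. sqrt (real n) * (\<integral>x. \<phi> x \<partial>L n)) \<longlonglongrightarrow> (LBINT x. \<phi> x) / sqrt (2 * pi * s)"
proof -
  have sets_L[measurable_cong]: "sets (L n) = sets borel" for n
    using L[of n] by (simp add: real_distribution_def real_distribution_axioms_def)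
  have [measurable]: "\<phi> \<in> borel_measurable borel"
    using \<phi>_cont by (intro borel_measurable_continuous_onI continuous_at_imp_continuous_on) auto
  obtain B where B: "\<And>x. kern x \<le> B / (1 + x\<^sup>2)" "B > 0" using kern_le by blast
  have kernB: "\<bar>kern x\<bar> \<le> B" for x
  proof -
    have "kern x \<le> B / (1 + x\<^sup>2)" by (rule B)
    also have "\<dots> \<le> B" using B(2) by (simp add: field_simps add_pos_nonneg)
    finally show ?thesis using kern_pos[of x] by simp
  qed
  have kern_int: "integrable (L n) kern" for n
  proof -
    interpret Ln: real_distribution "L n" by (rule L)
    show ?thesis by (rule Ln.integrable_const_bound[where B = B]) (use kernB in auto)
  qed
  define c where "c n = (\<integral>x. kern x \<partial>L n)" for n
  have c_pos: "c n > 0" for n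
  proof -
    interpret Ln: real_distribution "L n" by (rule L)
    have "Ln.expectation (\<lambda>x. 0) < Ln.expectation kern"
      by (rule Ln.integral_less_AE_space) (use kern_int kern_pos Ln.emeasure_space_1 in auto)
    then show ?thesis by (simp add: c_def)
  qed
  let ?\<nu> = "\<lambda>N d. density N (\<lambda>x. ennreal (kern x / d))"
  \<comment> \<open>Proved once for both uses: N = \<open>L n\<close> with d = \<open>c n\<close>,
    and N = \<open>lborel\<close> with d = \<open>D\<close>.\<close>
  have weighted: "real_distribution (?\<nu> N d)"
      "char (?\<nu> N d) u = (CLINT x|N. kern x * iexp (u * x)) / d"
      "(\<integral>x. \<phi> x / kern x \<partial>?\<nu> N d) = (\<integral>x. \<phi> x \<partial>N) / d"
    if [measurable_cong]: "sets N = sets borel" and int: "integrable N kern" and d: "d = (\<integral>x. kern x \<partial>N)" "d > 0" for N d u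
  proof -
    have [simp]: "space N = UNIV" using sets_eq_imp_space_eq[OF that(1)] by simp
    have nn: "0 \<le> kern x / d" for x using kern_pos[of x] d by simp
    have "(\<integral>\<^sup>+x. ennreal (kern x / d) \<partial>N) = ennreal (\<integral>x. kern x / d \<partial>N)"
      using int nn by (intro nn_integral_eq_integral) auto
    also have "(\<integral>x. kern x / d \<partial>N) = 1" using d by simp
    finally have "prob_space (?\<nu> N d)"
      by (intro prob_spaceI) (simp add: emeasure_density)
    then show "real_distribution (?\<nu> N d)"
      by (simp add: real_distribution_def real_distribution_axioms_def that(1))
    show "char (?\<nu> N d) u = (CLINT x|N. kern x * iexp (u * x)) / d"
      unfolding char_def using nn by (subst integral_density) (auto simp: scaleR_conv_of_real)
    show "(\<integral>x. \<phi> x / kern x \<partial>?\<nu> N d) = (\<integral>x. \<phi> x \<partial>N) / d"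
      using nn kern_pos by (subst integral_density) (auto simp: less_imp_neq[THEN not_sym])
  qed
  have lim: "(\<lambda>n. sqrt (real n) *\<^sub>R (CLINT x|L n. kern x * iexp (u * x))) \<longlonglongrightarrow> kern_hat (- u) * sqrt (2 * pi / s)" for u
    by (rule local_limit_kern[OF lt1 L char_L])
  have k0: "kern_hat 0 = 2" by (simp add: kern_hat_def tent_def)
  \<comment> \<open>The kernel limit at frequency u = 0 gives the growth of the normalising
    constants.\<close>
  have c_lim: "(\<lambda>n. sqrt (real n) * c n) \<longlonglongrightarrow> 2 * sqrt (2 * pi / s)"
  proof -
    have "(\<lambda>n. complex_of_real (sqrt (real n) * c n)) \<longlonglongrightarrow> complex_of_real (2 * sqrt (2 * pi / s))"
      using lim[of 0] by (simp add: k0 c_def scaleR_conv_of_real)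
    then show ?thesis by (rule iffD1[OF tendsto_of_real_iff])
  qed
  define D where "D = (LBINT x. kern x)"
  have "complex_of_real D = 4 * complex_of_real pi"
    using fourier_kern[of 0] by (simp add: k0 D_def)
  then have D: "D = 4 * pi" by (metis of_real_eq_iff of_real_mult of_real_numeral)
  let ?W = "\<lambda>n. ?\<nu> (L n) (c n)"
  let ?W' = "?\<nu> lborel D"
  have wl: "sets lborel = sets borel" "integrable lborel kern" "D = (LBINT x. kern x)" "D > 0"
    using integrable_kern D by (auto simp: D_def)
  have Wn: "real_distribution (?W n)" for n
    by (rule weighted(1)) (use sets_L kern_int c_pos in \<open>auto simp: c_def\<close>)
  have W': "real_distribution ?W'" by (rule weighted(1)) (use wl in auto)
  have "weak_conv_m ?W ?W'"
  proof (rule levy_continuity[OF Wn W'])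
    fix u
    have "(\<lambda>n. (sqrt (real n) *\<^sub>R (CLINT x|L n. kern x * iexp (u * x))) / complex_of_real (sqrt (real n) * c n))
        \<longlonglongrightarrow> (kern_hat (- u) * sqrt (2 * pi / s)) / complex_of_real (2 * sqrt (2 * pi / s))"
      using s by (intro tendsto_divide lim tendsto_of_real c_lim) auto
    also have "(kern_hat (- u) * sqrt (2 * pi / s)) / complex_of_real (2 * sqrt (2 * pi / s)) = kern_hat (- u) / 2"
      using s by simp
    also have "\<dots> = char ?W' u"
      unfolding weighted(2)[OF wl] fourier_kern by (simp add: D)
    finally show "(\<lambda>n. char (?W n) u) \<longlonglongrightarrow> char ?W' u"
    proof (rule Lim_transform_eventually)
      show "\<forall>\<^sub>F n in sequentially. (sqrt (real n) *\<^sub>R (CLINT x|L n. kern x * iexp (u * x))) / complex_of_real (sqrt (real n) * c n) = char (?W n) u"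
        using eventually_gt_at_top[of 0]
      proof eventually_elim
        case (elim n)
        have "char (?W n) u = (CLINT x|L n. kern x * iexp (u * x)) / complex_of_real (c n)"
          by (rule weighted(2)) (use sets_L kern_int c_pos in \<open>auto simp: c_def\<close>)
        then show ?case using elim by (simp add: scaleR_conv_of_real)
      qed
    qed
  qed
  then have "(\<lambda>n. \<integral>x. \<phi> x / kern x \<partial>?W n) \<longlonglongrightarrow> (\<integral>x. \<phi> x / kern x \<partial>?W')"
  proof (rule weak_conv_imp_integral_bdd_continuous_conv[OF Wn W'])
    show "isCont (\<lambda>x. \<phi> x / kern x) x" for x
      using kern_pos[of x] by (intro continuous_intros \<phi>_cont isCont_kern) auto
    show "norm (\<phi> x / kern x) \<le> C * 33 / 4" for x
    proof -
      have C: "C \<ge> 0" using \<phi>[of 0] by simp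
      have "\<bar>\<phi> x\<bar> \<le> C * 33 / 4 * (4 / (33 * (1 + x\<^sup>2)))"
      proof -
        have eq: "C * 33 / 4 * (4 / (33 * y)) = C / y" for y :: real by simp
        show ?thesis unfolding eq by (rule \<phi>)
      qed
      also have "\<dots> \<le> C * 33 / 4 * kern x" using C by (intro mult_left_mono kern_ge) auto
      finally show ?thesis using kern_pos[of x] by (simp add: field_simps)
    qed
  qed
  \<comment> \<open>Multiplication by sqrt n * c n removes the normalisation and restores the
    unweighted expectation.\<close>
  from tendsto_mult[OF c_lim this]
  have "(\<lambda>n. sqrt (real n) * c n * (\<integral>x. \<phi> x / kern x \<partial>?W n)) \<longlonglongrightarrow> 2 * sqrt (2 * pi / s) * (\<integral>x. \<phi> x / kern x \<partial>?W')" .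
  also have "(\<lambda>n. sqrt (real n) * c n * (\<integral>x. \<phi> x / kern x \<partial>?W n)) = (\<lambda>n. sqrt (real n) * (\<integral>x. \<phi> x \<partial>L n))"
  proof
    fix n
    have "(\<integral>x. \<phi> x / kern x \<partial>?W n) = (\<integral>x. \<phi> x \<partial>L n) / c n"
      by (rule weighted(3)) (use sets_L kern_int c_pos in \<open>auto simp: c_def\<close>)
    then show "sqrt (real n) * c n * (\<integral>x. \<phi> x / kern x \<partial>?W n) = sqrt (real n) * (\<integral>x. \<phi> x \<partial>L n)"
      using c_pos[of n] by simp
  qed
  also have "(\<integral>x. \<phi> x / kern x \<partial>?W') = (LBINT x. \<phi> x) / D" by (rule weighted(3)[OF wl])
  also have "2 * sqrt (2 * pi / s) * ((LBINT x. \<phi> x) / D) = (LBINT x. \<phi> x) / sqrt (2 * pi * s)"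
  proof -
    have "sqrt (2 * pi / s) = 2 * pi / sqrt (2 * pi * s)"
      using s by (simp add: real_sqrt_divide real_sqrt_mult field_simps)
    then show ?thesis using s by (simp add: D)
  qed
  finally show ?thesis .
qed

section \<open>Maximum likelihood decoding\<close>

lemma PiM_density:
  fixes f :: "'i \<Rightarrow> 'a \<Rightarrow> ennreal"
  assumes I: "finite I" and M: "\<And>i. sigma_finite_measure (M i)"
    and f[measurable]: "\<And>i. i \<in> I \<Longrightarrow> f i \<in> borel_measurable (M i)"
    and D: "\<And>i. i \<in> I \<Longrightarrow> sigma_finite_measure (density (M i) (f i))"
  shows "PiM I (\<lambda>i. density (M i) (f i)) = density (PiM I M) (\<lambda>x. \<Prod>i\<in>I. f i (x i))"
proof -
  \<comment> \<open>\<open>product_sigma_finite\<close> speaks about every index, while outside I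
    the functions f are arbitrary; a one-point measure fills those places.\<close>
  define M' where "M' i = (if i \<in> I then density (M i) (f i) else count_space {undefined})" for i
  interpret M: product_sigma_finite M using M by (simp add: product_sigma_finite_def)
  interpret M': product_sigma_finite M'
    using D by (auto simp: product_sigma_finite_def M'_def intro!: sigma_finite_measure_count_space_finite)
  have eq: "PiM I (\<lambda>i. density (M i) (f i)) = PiM I M'" by (intro PiM_cong) (auto simp: M'_def)
  have "density (PiM I M) (\<lambda>x. \<Prod>i\<in>I. f i (x i)) = PiM I M'"
  proof (rule M'.PiM_eqI[OF I])
    show "sets (density (PiM I M) (\<lambda>x. \<Prod>i\<in>I. f i (x i))) = sets (PiM I M')"
      by (simp, intro sets_PiM_cong) (auto simp: M'_def)
    fix A assume "\<And>i. i \<in> I \<Longrightarrow> A i \<in> sets (M' i)"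
    then have A[measurable]: "\<And>i. i \<in> I \<Longrightarrow> A i \<in> sets (M i)" by (auto simp: M'_def)
    have "emeasure (density (PiM I M) (\<lambda>x. \<Prod>i\<in>I. f i (x i))) (Pi\<^sub>E I A)
        = (\<integral>\<^sup>+x. (\<Prod>i\<in>I. f i (x i)) * indicator (Pi\<^sub>E I A) x \<partial>PiM I M)"
      by (subst emeasure_density) (auto intro!: sets_PiM_I_finite I A)
    also have "\<dots> = (\<integral>\<^sup>+x. (\<Prod>i\<in>I. f i (x i) * indicator (A i) (x i)) \<partial>PiM I M)"
    proof (rule nn_integral_cong)
      fix x assume "x \<in> space (PiM I M)"
      then have "indicator (Pi\<^sub>E I A) x = (\<Prod>i\<in>I. indicator (A i) (x i) :: ennreal)"
        using I by (auto simp: space_PiM indicator_def PiE_iff)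
      then show "(\<Prod>i\<in>I. f i (x i)) * indicator (Pi\<^sub>E I A) x = (\<Prod>i\<in>I. f i (x i) * indicator (A i) (x i))"
        by (simp add: prod.distrib)
    qed
    also have "\<dots> = (\<Prod>i\<in>I. \<integral>\<^sup>+x. f i x * indicator (A i) x \<partial>M i)"
      by (rule M.product_nn_integral_prod[OF I]) measurable
    also have "\<dots> = (\<Prod>i\<in>I. emeasure (M' i) (A i))"
      by (intro prod.cong refl) (simp add: M'_def emeasure_density)
    finally show "emeasure (density (PiM I M) (\<lambda>x. \<Prod>i\<in>I. f i (x i))) (Pi\<^sub>E I A) = (\<Prod>i\<in>I. emeasure (M' i) (A i))" .
  qed
  with eq show ?thesis by simp
qed

lemma measurable_coordinate:
  "i \<in> I \<Longrightarrow> f \<in> measurable M N \<Longrightarrow> (\<lambda>y. f (y i)) \<in> measurable (Pi\<^sub>M I (\<lambda>_. M)) N"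
  by (rule measurable_compose[OF measurable_component_singleton[of i I "\<lambda>_. M"]])

text \<open>For factors that are only sigma-finite, such as Q: the exceptional set lies in a box
  with one null side, and a product with a factor 0 vanishes even if other sides have infinite
  measure.\<close>

lemma (in product_sigma_finite) AE_PiM_finite_component:
  assumes I: "finite I" and i: "i \<in> I" and P: "AE x in M i. P x"
  shows "AE x in PiM I M. P (x i)"
proof -
  from P obtain N where N: "N \<in> sets (M i)" "emeasure (M i) N = 0" "{x \<in> space (M i). \<not> P x} \<subseteq> N"
    by (auto elim: AE_E)
  let ?A = "\<lambda>j. if j = i then N else space (M j)"
  show ?thesis
  proof (rule AE_I)
    show "{x \<in> space (PiM I M). \<not> P (x i)} \<subseteq> Pi\<^sub>E I ?A"
    proof
      fix x assume "x \<in> {x \<in> space (PiM I M). \<not> P (x i)}"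
      then have "x \<in> Pi\<^sub>E I (\<lambda>i. space (M i))" "\<not> P (x i)" by (auto simp: space_PiM)
      with N(3) i show "x \<in> Pi\<^sub>E I ?A" by (auto simp: PiE_iff)
    qed
    show "Pi\<^sub>E I ?A \<in> sets (PiM I M)" using N by (intro sets_PiM_I_finite I) auto
    have "emeasure (PiM I M) (Pi\<^sub>E I ?A) = (\<Prod>j\<in>I. emeasure (M j) (?A j))"
      using N by (intro emeasure_PiM I) auto
    also have "\<dots> = 0" using N(2) i I by (intro prod_zero) auto
    finally show "emeasure (PiM I M) (Pi\<^sub>E I ?A) = 0" .
  qed
qed

section \<open>Likelihoods and uniform tie-breaking\<close>

lemma ext_ln_mult: "a \<ge> 0 \<Longrightarrow> b \<ge> 0 \<Longrightarrow> ext_ln (a * b) = ext_ln a + ext_ln b"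
  by (auto simp: ext_ln_def ln_mult zero_less_mult_iff)

lemma ext_ln_prod:
  "(\<And>i. i \<in> A \<Longrightarrow> f i \<ge> 0) \<Longrightarrow> ext_ln (\<Prod>i\<in>A. f i) = (\<Sum>i\<in>A. ext_ln (f i))"
proof (induction A rule: infinite_finite_induct)
  case (insert x F)
  then show ?case by (simp add: ext_ln_mult prod_nonneg)
qed (auto simp: ext_ln_def)

lemma ext_ln_le_iff: "a \<ge> 0 \<Longrightarrow> b \<ge> 0 \<Longrightarrow> ext_ln a \<le> ext_ln b \<longleftrightarrow> a \<le> b"
  by (auto simp: ext_ln_def)

definition likelihood :: "('x \<Rightarrow> 'y \<Rightarrow> real) \<Rightarrow> nat \<Rightarrow> (nat \<Rightarrow> 'x) \<Rightarrow> (nat \<Rightarrow> 'y) \<Rightarrow> real" where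
  "likelihood w n x y = (\<Prod>i<n. w (x i) (y i))"

text \<open>The probability that the decoder returns m. It is written with sums of 0/1 terms instead
  of a cardinality, so that joint measurability in the code and the output follows from that of the
  likelihoods.\<close>

definition ml_weight ::
  "('x \<Rightarrow> 'y \<Rightarrow> real) \<Rightarrow> nat \<Rightarrow> nat \<Rightarrow> (nat \<Rightarrow> nat \<Rightarrow> 'x) \<Rightarrow> (nat \<Rightarrow> 'y) \<Rightarrow> nat \<Rightarrow> real" where
  "ml_weight w n M c y m =
     (if \<forall>k\<in>{..<M}. likelihood w n (c k) y \<le> likelihood w n (c m) y then 1 else 0) /
     (\<Sum>j<M. if \<forall>k\<in>{..<M}. likelihood w n (c k) y \<le> likelihood w n (c j) y then 1 else 0)"

lemma ml_weight_bounds: "m < M \<Longrightarrow> 0 \<le> ml_weight w n M c y m" "m < M \<Longrightarrow> ml_weight w n M c y m \<le> 1"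
proof -
  let ?a = "\<lambda>j. if \<forall>k\<in>{..<M}. likelihood w n (c k) y \<le> likelihood w n (c j) y then 1 else 0 :: real"
  assume m: "m < M"
  then have "?a m \<le> (\<Sum>j<M. ?a j)" by (intro member_le_sum) auto
  moreover have "0 \<le> (\<Sum>j<M. ?a j)" by (intro sum_nonneg) auto
  ultimately show "0 \<le> ml_weight w n M c y m" "ml_weight w n M c y m \<le> 1"
    unfolding ml_weight_def by (auto intro!: divide_nonneg_nonneg simp: divide_le_eq_1 less_le)
qed

text \<open>\<open>ext_ln\<close> preserves the order on nonnegative reals, and reflects it up to
  equality of values, so sums of logarithms and products have the same maximizers; this includes
  ties at likelihood 0, where the logarithm is -oo.\<close>

lemma prob_ml_decoder:
  assumes m: "m < M" and w: "\<And>k i. k < M \<Longrightarrow> i < n \<Longrightarrow> 0 \<le> w (c k i) (y i)"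
  shows "measure_pmf.prob (ml_decoder w n M c y) (- {m}) = 1 - ml_weight w n M c y m"
proof -
  have nn: "likelihood w n (c k) y \<ge> 0" if "k < M" for k
    unfolding likelihood_def using w that by (intro prod_nonneg) auto
  have "log_likelihood w n (c k) y = ext_ln (likelihood w n (c k) y)" if "k < M" for k
    unfolding log_likelihood_def likelihood_def using w that by (subst ext_ln_prod) auto
  then have A: "{j \<in> {..<M}. \<forall>k<M. log_likelihood w n (c k) y \<le> log_likelihood w n (c j) y}
      = {j \<in> {..<M}. \<forall>k\<in>{..<M}. likelihood w n (c k) y \<le> likelihood w n (c j) y}" (is "_ = ?A")
    using nn by (auto simp: ext_ln_le_iff)
  \<comment> \<open>The maximum is attained, so the set handed to \<open>pmf_of_set\<close> is
    nonempty.\<close>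
  have "Max ((\<lambda>k. likelihood w n (c k) y) ` {..<M}) \<in> (\<lambda>k. likelihood w n (c k) y) ` {..<M}"
    using m by (intro Max_in) auto
  then obtain j where j: "j < M" "likelihood w n (c j) y = Max ((\<lambda>k. likelihood w n (c k) y) ` {..<M})" by auto
  have "likelihood w n (c k) y \<le> likelihood w n (c j) y" if "k < M" for k
    unfolding j(2) using that by (intro Max_ge) auto
  with j(1) have ne: "?A \<noteq> {}" by blast
  have card: "real (card ?A) = (\<Sum>j<M. if \<forall>k\<in>{..<M}. likelihood w n (c k) y \<le> likelihood w n (c j) y then 1 else 0)"
    by (subst sum.If_cases) (auto intro!: arg_cong[where f = card])
  have "measure_pmf.prob (ml_decoder w n M c y) (- {m}) = 1 - pmf (ml_decoder w n M c y) m"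
    using measure_pmf.prob_compl[of "{m}" "ml_decoder w n M c y"] by (simp add: measure_pmf_single Compl_eq_Diff_UNIV)
  also have "pmf (ml_decoder w n M c y) m = indicator ?A m / card ?A"
    unfolding ml_decoder_def A by (rule pmf_of_set) (use ne in auto)
  also have "\<dots> = ml_weight w n M c y m"
    unfolding ml_weight_def card using m by (simp add: indicator_def)
  finally show ?thesis .
qed

definition max_likelihood :: "('x \<Rightarrow> 'y \<Rightarrow> real) \<Rightarrow> nat \<Rightarrow> nat \<Rightarrow> (nat \<Rightarrow> nat \<Rightarrow> 'x) \<Rightarrow> (nat \<Rightarrow> 'y) \<Rightarrow> real" where
  "max_likelihood w n M c y = Max ((\<lambda>k. likelihood w n (c k) y) ` {..<M})"

text \<open>Averaged over a uniform message, maximum likelihood decoding with uniform tie-breaking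
  succeeds with weight equal to the largest likelihood, however the ties fall.\<close>

lemma sum_likelihood_ml_weight:
  assumes "M > 0"
  shows "(\<Sum>m<M. likelihood w n (c m) y * ml_weight w n M c y m) = max_likelihood w n M c y"
proof -
  let ?l = "\<lambda>k. likelihood w n (c k) y"
  let ?P = "\<lambda>m. \<forall>k\<in>{..<M}. ?l k \<le> ?l m"
  let ?a = "\<lambda>m. if ?P m then 1 else 0 :: real"
  let ?X = "Max (?l ` {..<M})"
  have X: "?l m = ?X" if "?P m" "m < M" for m
    using that by (intro Max_eqI[symmetric]) auto
  have "?X \<in> ?l ` {..<M}" using assms by (intro Max_in) auto
  then obtain j where j: "j < M" "?l j = ?X" by auto
  have Pj: "?P j" unfolding j(2) by (auto intro!: Max_ge)
  have "1 \<le> (\<Sum>m<M. ?a m)" using member_le_sum[of j "{..<M}" ?a] j(1) Pj by auto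
  then have pos: "(\<Sum>m<M. ?a m) \<noteq> 0" by linarith
  have "(\<Sum>m<M. ?l m * ml_weight w n M c y m) = (\<Sum>m<M. ?X * (?a m / (\<Sum>m<M. ?a m)))"
  proof (rule sum.cong[OF refl])
    fix m assume "m \<in> {..<M}"
    then show "?l m * ml_weight w n M c y m = ?X * (?a m / (\<Sum>m<M. ?a m))"
      unfolding ml_weight_def using X[of m] by auto
  qed
  also have "\<dots> = ?X * ((\<Sum>m<M. ?a m) / (\<Sum>m<M. ?a m))"
    by (simp only: sum_distrib_left sum_divide_distrib)
  also have "\<dots> = max_likelihood w n M c y" using pos by (simp add: max_likelihood_def)
  finally show ?thesis .
qed

definition match_prob :: "'x measure \<Rightarrow> ('x \<Rightarrow> 'y \<Rightarrow> real) \<Rightarrow> 'y \<Rightarrow> real" where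
  "match_prob PX w y = measure PX {x \<in> space PX. w x y > 0}"

definition output_density :: "'x measure \<Rightarrow> ('x \<Rightarrow> 'y \<Rightarrow> real) \<Rightarrow> 'y \<Rightarrow> real" where
  "output_density PX w y = enn2real (\<integral>\<^sup>+x. ennreal (w x y) \<partial>PX)"

definition output_law :: "'x measure \<Rightarrow> 'y measure \<Rightarrow> ('x \<Rightarrow> 'y \<Rightarrow> real) \<Rightarrow> 'y measure" where
  "output_law PX Q w = density Q (\<lambda>y. ennreal (output_density PX w y))"

text \<open>If K of the other M - 1 codewords match, with K binomial of parameter q, decoding
  succeeds with probability 1 / (K + 1); the mean of this is (1 - (1 - q)^M) / (M q). Division by
  zero gives the value 1 at q = 0; under the law of the outputs q is almost surely positive.\<close>

definition tie_error :: "nat \<Rightarrow> real \<Rightarrow> real" where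
  "tie_error M q = 1 - (1 - (1 - q) ^ M) / (real M * q)"

section \<open>The error probability of a memoryless channel through the largest likelihood\<close>

context memoryless_channel
begin

abbreviation codes :: "nat \<Rightarrow> nat \<Rightarrow> (nat \<Rightarrow> nat \<Rightarrow> 'x) measure" where
  "codes n M \<equiv> Pi\<^sub>M {..<M} (\<lambda>_. Pi\<^sub>M {..<n} (\<lambda>_. PX))"

abbreviation outputs :: "nat \<Rightarrow> (nat \<Rightarrow> 'y) measure" where
  "outputs n \<equiv> Pi\<^sub>M {..<n} (\<lambda>_. Q)"

lemma prob_space_codes: "prob_space (codes n M)"
  by (intro prob_space_PiM PX.prob_space_axioms)

lemma sigma_finite_outputs: "sigma_finite_measure (outputs n)"
proof -
  interpret product_sigma_finite "\<lambda>_::nat. Q" ..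
  show ?thesis by (rule sigma_finite) simp
qed

lemma codes_mem: "c \<in> space (codes n M) \<Longrightarrow> m < M \<Longrightarrow> i < n \<Longrightarrow> c m i \<in> space PX"
  by (auto simp: space_PiM PiE_iff)

lemma outputs_mem: "y \<in> space (outputs n) \<Longrightarrow> i < n \<Longrightarrow> y i \<in> space Q"
  by (auto simp: space_PiM PiE_iff)

lemma measurable_w1[measurable]: "y \<in> space Q \<Longrightarrow> (\<lambda>x. w x y) \<in> borel_measurable PX"
  using measurable_compose[OF _ measurable_density, of "\<lambda>x. (x, y)" PX] by simp

lemma measurable_w2[measurable]: "x \<in> space PX \<Longrightarrow> (\<lambda>y. w x y) \<in> borel_measurable Q"
  using measurable_compose[OF _ measurable_density, of "\<lambda>y. (x, y)" Q] by simp

lemma measurable_likelihood: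
  assumes "m < M"
  shows "(\<lambda>p. likelihood w n (fst p m) (snd p)) \<in> borel_measurable (codes n M \<Otimes>\<^sub>M outputs n)"
  unfolding likelihood_def
proof (rule borel_measurable_prod)
  fix i assume i: "i \<in> {..<n}"
  have "(\<lambda>c. c m i) \<in> measurable (codes n M) PX"
    using assms i by (intro measurable_compose[OF measurable_component_singleton[of m] measurable_component_singleton[of i]]) auto
  moreover have "(\<lambda>y. y i) \<in> measurable (outputs n) Q" using i by simp
  ultimately have "(\<lambda>p. (fst p m i, snd p i)) \<in> measurable (codes n M \<Otimes>\<^sub>M outputs n) (PX \<Otimes>\<^sub>M Q)"
    by (intro measurable_Pair measurable_compose[OF measurable_fst] measurable_compose[OF measurable_snd])
  from measurable_compose[OF this measurable_density]
  show "(\<lambda>p. w (fst p m i) (snd p i)) \<in> borel_measurable (codes n M \<Otimes>\<^sub>M outputs n)" by simp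
qed

lemma measurable_ml_weight:
  assumes "m < M"
  shows "(\<lambda>p. ml_weight w n M (fst p) (snd p) m) \<in> borel_measurable (codes n M \<Otimes>\<^sub>M outputs n)"
proof -
  let ?N = "codes n M \<Otimes>\<^sub>M outputs n"
  have "(\<lambda>p. if \<forall>k\<in>{..<M}. likelihood w n (fst p k) (snd p) \<le> likelihood w n (fst p j) (snd p) then 1 else 0 :: real)
      \<in> borel_measurable ?N" if "j < M" for j
    by (intro measurable_If measurable_const sets.sets_Collect_finite_All' borel_measurable_le measurable_likelihood)
       (use that in auto)
  with assms show ?thesis
    unfolding ml_weight_def by (intro borel_measurable_divide borel_measurable_sum) auto
qed

lemma prob_space_channel_law: "x \<in> space PX \<Longrightarrow> prob_space (channel_law Q w x)"
  using density_normalized[of x]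
  by (intro prob_spaceI) (simp add: channel_law_def emeasure_density)

lemma PiM_channel_law:
  assumes x: "\<And>i. i < n \<Longrightarrow> x i \<in> space PX"
  shows "Pi\<^sub>M {..<n} (\<lambda>i. channel_law Q w (x i)) = density (outputs n) (\<lambda>y. ennreal (likelihood w n x y))"
proof -
  have "Pi\<^sub>M {..<n} (\<lambda>i. channel_law Q w (x i)) = density (outputs n) (\<lambda>y. \<Prod>i\<in>{..<n}. ennreal (w (x i) (y i)))"
    unfolding channel_law_def
    by (rule PiM_density)
       (use x prob_space_channel_law Q.sigma_finite_measure_axioms in
         \<open>auto simp: channel_law_def[symmetric] intro!: prob_space_imp_sigma_finite\<close>)
  also have "\<dots> = density (outputs n) (\<lambda>y. ennreal (likelihood w n x y))"
  proof (rule density_cong)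
    have l: "(\<lambda>y. w (x i) (y i)) \<in> borel_measurable (outputs n)" if "i < n" for i
      using that
      by (intro measurable_coordinate[OF _ measurable_w2[OF x[OF that]]]) auto
    then show "(\<lambda>y. \<Prod>i\<in>{..<n}. ennreal (w (x i) (y i))) \<in> borel_measurable (outputs n)"
      by (intro borel_measurable_prod_ennreal measurable_compose[OF _ measurable_ennreal]) auto
    show "(\<lambda>y. ennreal (likelihood w n x y)) \<in> borel_measurable (outputs n)"
      unfolding likelihood_def using l by (intro measurable_compose[OF _ measurable_ennreal] borel_measurable_prod) auto
    show "AE y in outputs n. (\<Prod>i\<in>{..<n}. ennreal (w (x i) (y i))) = ennreal (likelihood w n x y)"
      unfolding likelihood_def
      by (intro AE_I2 prod_ennreal density_nonneg) (auto intro: x outputs_mem)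
  qed
  finally show ?thesis .
qed

text \<open>Only the sum over all messages of likelihood times success weight simplifies, so it has
  to be moved inside the integrals over codes and outputs. Nonnegative integrals permit these
  exchanges by Tonelli without integrability conditions.\<close>

proposition P_RC_eq_nn_integral:
  assumes "M > 0"
  shows "P_RC PX Q w n M = 1 - enn2real (\<integral>\<^sup>+y. (\<integral>\<^sup>+c. ennreal (max_likelihood w n M c y) \<partial>codes n M)
      \<partial>outputs n) / real M"
proof -
  let ?C = "codes n M" and ?Y = "outputs n"
  interpret C: prob_space ?C by (rule prob_space_codes)
  interpret Y: sigma_finite_measure ?Y by (rule sigma_finite_outputs)
  interpret CY: pair_sigma_finite ?C ?Y ..
  have lik_nn: "0 \<le> likelihood w n (c m) y" if "c \<in> space ?C" "y \<in> space ?Y" "m < M" for c y m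
    unfolding likelihood_def using that by (intro prod_nonneg ballI density_nonneg) (auto intro: codes_mem outputs_mem)
  let ?J = "\<lambda>m c y. likelihood w n (c m) y * ml_weight w n M c y m"
  have J_meas: "(\<lambda>p. ennreal (?J m (fst p) (snd p))) \<in> borel_measurable (?C \<Otimes>\<^sub>M ?Y)" if "m < M" for m
    using that by (intro measurable_compose[OF _ measurable_ennreal] borel_measurable_times measurable_likelihood measurable_ml_weight)
  \<comment> \<open>The probability of correct decoding of message m for the fixed code c. The bound
    by 1 proved next makes it finite, as the passages between \<open>ennreal\<close> and
    \<open>real\<close> require.\<close>
  define X where "X m c = (\<integral>\<^sup>+y. ennreal (?J m c y) \<partial>?Y)" for m c
  have X_meas: "X m \<in> borel_measurable ?C" if "m < M" for m
    unfolding X_def using J_meas[OF that] by (intro Y.borel_measurable_nn_integral) (simp add: case_prod_beta')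
  have inner: "(\<integral>y. measure_pmf.prob (ml_decoder w n M c y) (- {m}) \<partial>Pi\<^sub>M {..<n} (\<lambda>i. channel_law Q w (c m i))) = 1 - enn2real (X m c)
      \<and> X m c \<le> 1"
    if m: "m < M" and c: "c \<in> space ?C" for m c
  proof -
    let ?D = "Pi\<^sub>M {..<n} (\<lambda>i. channel_law Q w (c m i))"
    have D: "?D = density ?Y (\<lambda>y. ennreal (likelihood w n (c m) y))"
      by (rule PiM_channel_law) (use c m codes_mem in auto)
    interpret D: prob_space ?D
      by (rule prob_space_PiM) (use c m codes_mem prob_space_channel_law in auto)
    have [simp]: "space ?D = space ?Y" unfolding D by simp
    have [simp]: "D.prob (space ?Y) = 1" "emeasure ?D (space ?Y) = 1"
      using D.prob_space D.emeasure_space_1 by simp_all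
    have wt: "(\<lambda>y. ml_weight w n M c y m) \<in> borel_measurable ?Y"
      using measurable_compose[OF measurable_Pair1'[OF c] measurable_ml_weight[OF m]] by simp
    then have wtD: "(\<lambda>y. ml_weight w n M c y m) \<in> borel_measurable ?D" unfolding D by simp
    have lik: "(\<lambda>y. ennreal (likelihood w n (c m) y)) \<in> borel_measurable ?Y"
      using measurable_compose[OF measurable_Pair1'[OF c] measurable_likelihood[OF m]]
      by (intro measurable_compose[OF _ measurable_ennreal]) simp
    have mb: "0 \<le> ml_weight w n M c y m" "ml_weight w n M c y m \<le> 1" for y
      by (rule ml_weight_bounds[OF m])+
    have int: "integrable ?D (\<lambda>y. ml_weight w n M c y m)"
      by (rule D.integrable_const_bound[where B = 1]) (use wtD mb in \<open>auto intro!: AE_I2 simp: abs_of_nonneg\<close>)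
    have "(\<integral>y. measure_pmf.prob (ml_decoder w n M c y) (- {m}) \<partial>?D) = (\<integral>y. 1 - ml_weight w n M c y m \<partial>?D)"
    proof (rule Bochner_Integration.integral_cong[OF refl])
      fix y assume "y \<in> space ?D"
      then have y: "y \<in> space ?Y" by simp
      show "measure_pmf.prob (ml_decoder w n M c y) (- {m}) = 1 - ml_weight w n M c y m"
        by (rule prob_ml_decoder[OF m]) (intro density_nonneg codes_mem[OF c] outputs_mem[OF y])
    qed
    also have "\<dots> = 1 - (\<integral>y. ml_weight w n M c y m \<partial>?D)"
      using int by (subst Bochner_Integration.integral_diff) (auto simp: D.prob_space)
    also have "(\<integral>y. ml_weight w n M c y m \<partial>?D) = enn2real (\<integral>\<^sup>+y. ennreal (ml_weight w n M c y m) \<partial>?D)"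
      using mb wtD by (intro integral_eq_nn_integral) auto
    also have nn: "(\<integral>\<^sup>+y. ennreal (ml_weight w n M c y m) \<partial>?D) = X m c"
    proof -
      have "(\<integral>\<^sup>+y. ennreal (ml_weight w n M c y m) \<partial>?D)
          = (\<integral>\<^sup>+y. ennreal (likelihood w n (c m) y) * ennreal (ml_weight w n M c y m) \<partial>?Y)"
        unfolding D by (rule nn_integral_density[OF lik]) (use wt in simp)
      also have "\<dots> = X m c"
        unfolding X_def using lik_nn[OF c _ m] mb
        by (intro nn_integral_cong) (simp add: ennreal_mult)
      finally show ?thesis .
    qed
    moreover have "X m c \<le> 1"
    proof -
      have "(\<integral>\<^sup>+y. ennreal (ml_weight w n M c y m) \<partial>?D) \<le> (\<integral>\<^sup>+y. 1 \<partial>?D)"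
        using mb by (intro nn_integral_mono) (simp add: ennreal_le_1)
      also have "\<dots> = 1" by (simp add: D.emeasure_space_1)
      finally show ?thesis unfolding nn .
    qed
    ultimately show ?thesis by simp
  qed
  have Xe: "ennreal (enn2real (X m c)) = X m c" if "m < M" "c \<in> space ?C" for m c
    using inner[OF that] by (auto intro!: ennreal_enn2real simp: less_top top_unique intro: le_less_trans)
  have X1: "(\<integral>\<^sup>+c. X m c \<partial>?C) \<le> 1" if "m < M" for m
  proof -
    have "(\<integral>\<^sup>+c. X m c \<partial>?C) \<le> (\<integral>\<^sup>+c. 1 \<partial>?C)" using inner[OF that] by (intro nn_integral_mono) auto
    then show ?thesis by (simp add: C.emeasure_space_1)
  qed
  have outer: "(\<integral>c. (\<integral>y. measure_pmf.prob (ml_decoder w n M c y) (- {m}) \<partial>Pi\<^sub>M {..<n} (\<lambda>i. channel_law Q w (c m i))) \<partial>?C)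
      = 1 - enn2real (\<integral>\<^sup>+c. X m c \<partial>?C)" if m: "m < M" for m
  proof -
    have meas: "(\<lambda>c. enn2real (X m c)) \<in> borel_measurable ?C" using X_meas[OF m] by simp
    have "enn2real (X m c) \<le> 1" if "c \<in> space ?C" for c
      using inner[OF m that] by (intro enn2real_leI) auto
    then have int: "integrable ?C (\<lambda>c. enn2real (X m c))"
      by (intro C.integrable_const_bound[where B = 1]) (use meas in auto)
    have "(\<integral>c. (\<integral>y. measure_pmf.prob (ml_decoder w n M c y) (- {m}) \<partial>Pi\<^sub>M {..<n} (\<lambda>i. channel_law Q w (c m i))) \<partial>?C)
        = (\<integral>c. 1 - enn2real (X m c) \<partial>?C)"
      using inner[OF m] by (intro Bochner_Integration.integral_cong) auto
    also have "\<dots> = 1 - (\<integral>c. enn2real (X m c) \<partial>?C)"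
      using int by (subst Bochner_Integration.integral_diff) (auto simp: C.prob_space)
    also have "(\<integral>c. enn2real (X m c) \<partial>?C) = enn2real (\<integral>\<^sup>+c. ennreal (enn2real (X m c)) \<partial>?C)"
      by (rule integral_eq_nn_integral) (use meas in auto)
    also have "(\<integral>\<^sup>+c. ennreal (enn2real (X m c)) \<partial>?C) = (\<integral>\<^sup>+c. X m c \<partial>?C)"
      using Xe[OF m] by (intro nn_integral_cong) auto
    finally show ?thesis .
  qed
  have "P_RC PX Q w n M = (1 / real M) * (\<Sum>m<M. 1 - enn2real (\<integral>\<^sup>+c. X m c \<partial>?C))"
    unfolding P_RC_def by (intro arg_cong2[where f = "(*)"] refl sum.cong outer) auto
  also have "\<dots> = 1 - (\<Sum>m<M. enn2real (\<integral>\<^sup>+c. X m c \<partial>?C)) / real M"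
    using assms by (simp add: sum_subtractf field_simps)
  also have "(\<Sum>m<M. enn2real (\<integral>\<^sup>+c. X m c \<partial>?C)) = enn2real (\<Sum>m<M. \<integral>\<^sup>+c. X m c \<partial>?C)"
    by (subst enn2real_sum) (auto simp: comp_def intro: le_less_trans[OF X1 ennreal_one_less_top])
  also have "(\<Sum>m<M. \<integral>\<^sup>+c. X m c \<partial>?C) = (\<integral>\<^sup>+c. (\<Sum>m<M. X m c) \<partial>?C)"
    by (rule nn_integral_sum[symmetric]) (use X_meas in auto)
  also have "\<dots> = (\<integral>\<^sup>+c. (\<integral>\<^sup>+y. (\<Sum>m<M. ennreal (?J m c y)) \<partial>?Y) \<partial>?C)"
  proof (rule nn_integral_cong)
    fix c assume c: "c \<in> space ?C"
    show "(\<Sum>m<M. X m c) = (\<integral>\<^sup>+y. (\<Sum>m<M. ennreal (?J m c y)) \<partial>?Y)"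
      unfolding X_def
      by (rule nn_integral_sum[symmetric]) (use measurable_compose[OF measurable_Pair1'[OF c] J_meas] in auto)
  qed
  also have "\<dots> = (\<integral>\<^sup>+y. (\<integral>\<^sup>+c. (\<Sum>m<M. ennreal (?J m c y)) \<partial>?C) \<partial>?Y)"
  proof -
    have "(\<lambda>(c, y). \<Sum>m<M. ennreal (?J m c y)) \<in> borel_measurable (?C \<Otimes>\<^sub>M ?Y)"
      using J_meas by (simp add: case_prod_beta' borel_measurable_sum)
    from CY.Fubini'[OF this] show ?thesis by simp
  qed
  also have "\<dots> = (\<integral>\<^sup>+y. (\<integral>\<^sup>+c. ennreal (max_likelihood w n M c y) \<partial>?C) \<partial>?Y)"
  proof (intro nn_integral_cong)
    fix c y assume "c \<in> space ?C" "y \<in> space ?Y"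
    then have "(\<Sum>m<M. ennreal (?J m c y)) = ennreal (\<Sum>m<M. ?J m c y)"
      using lik_nn by (intro sum_ennreal mult_nonneg_nonneg ml_weight_bounds) auto
    then show "(\<Sum>m<M. ennreal (?J m c y)) = ennreal (max_likelihood w n M c y)"
      by (simp add: sum_likelihood_ml_weight[OF assms])
  qed
  finally show ?thesis .
qed

end

section \<open>Singular channels\<close>

lemma nu_mem_iff:
  assumes "w (fst \<omega>) (snd \<omega>) > 0"
  shows "nu w \<omega> x' \<in> {-\<infinity>, 0} \<longleftrightarrow> w x' (snd \<omega>) \<le> 0 \<or> w x' (snd \<omega>) = w (fst \<omega>) (snd \<omega>)"
  using assms by (auto simp: nu_def ext_ln_def zero_ereal_def field_simps zero_less_divide_iff not_less)

context memoryless_channel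
begin

lemma Q_PX: "pair_sigma_finite Q PX" and PX_Q: "pair_sigma_finite PX Q"
  by (simp_all add: pair_sigma_finite_def Q.sigma_finite_measure_axioms PX.sigma_finite_measure_axioms)

lemma measurable_density_swap: "(\<lambda>(y, x). w x y) \<in> borel_measurable (Q \<Otimes>\<^sub>M PX)"
  using measurable_compose[OF measurable_pair_swap' measurable_density] by (simp add: case_prod_beta')

lemma measurable_match_prob[measurable]: "match_prob PX w \<in> borel_measurable Q"
proof -
  have "(\<lambda>y. \<integral>x. (indicator {0<..} (w x y) :: real) \<partial>PX) \<in> borel_measurable Q"
    by (rule PX.borel_measurable_lebesgue_integral) (use measurable_compose[OF measurable_density_swap, of "indicator {0<..} :: real \<Rightarrow> real"] in \<open>simp add: case_prod_beta'\<close>)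
  moreover have "match_prob PX w y = (\<integral>x. (indicator {0<..} (w x y) :: real) \<partial>PX)" if "y \<in> space Q" for y
  proof -
    have "(\<integral>x. (indicator {0<..} (w x y) :: real) \<partial>PX) = (\<integral>x. indicator {x \<in> space PX. w x y > 0} x \<partial>PX)"
      by (intro Bochner_Integration.integral_cong) (auto simp: indicator_def)
    then show ?thesis using measurable_w1[OF that] by (simp add: match_prob_def)
  qed
  ultimately show ?thesis by (simp cong: measurable_cong)
qed

lemma match_prob_bounds: "0 \<le> match_prob PX w y" "match_prob PX w y \<le> 1"
  by (auto simp: match_prob_def)

lemma measurable_output_density[measurable]: "output_density PX w \<in> borel_measurable Q"
proof -
  have "(\<lambda>y. \<integral>\<^sup>+x. ennreal (w x y) \<partial>PX) \<in> borel_measurable Q"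
    by (rule PX.borel_measurable_nn_integral)
       (use measurable_compose[OF measurable_density_swap measurable_ennreal] in \<open>simp add: case_prod_beta'\<close>)
  then show ?thesis unfolding output_density_def by simp
qed

lemma AE_swap:
  assumes "AE p in PX \<Otimes>\<^sub>M Q. P p"
  shows "AE y in Q. AE x in PX. P (x, y)"
proof -
  interpret Q_PX: pair_sigma_finite Q PX by (rule Q_PX)
  interpret PX_Q: pair_sigma_finite PX Q by (rule PX_Q)
  have "AE p in Q \<Otimes>\<^sub>M PX. P (case p of (y, x) \<Rightarrow> (x, y))"
    by (rule AE_distrD[OF measurable_pair_swap']) (subst PX_Q.distr_pair_swap[symmetric], rule assms)
  from Q_PX.AE_pair[OF this] show ?thesis by simp
qed

text \<open>For almost every y with positive matching probability some letter x of positive density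
  satisfies the singularity condition; compared with it, almost every letter has density 0 or
  \<open>w x y\<close>. So the density at y has one nonzero value, which integration identifies as
  output density over matching probability.\<close>

lemma singular_AE:
  assumes "singular_channel PX Q w"
  shows "AE y in Q. (AE x in PX. w x y = 0 \<or> w x y = output_density PX w y / match_prob PX w y)
    \<and> (\<integral>\<^sup>+x. ennreal (w x y) \<partial>PX) = ennreal (output_density PX w y)
    \<and> (match_prob PX w y = 0 \<longrightarrow> output_density PX w y = 0)
    \<and> (match_prob PX w y > 0 \<longrightarrow> output_density PX w y > 0)"
proof -
  have "AE p in PX \<Otimes>\<^sub>M Q. 0 < (case p of (x, y) \<Rightarrow> ennreal (w x y)) \<longrightarrow> (AE x' in PX. nu w p x' \<in> {-\<infinity>, 0})"
    using assms measurable_compose[OF measurable_density measurable_ennreal]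
    unfolding singular_channel_def joint_law_def by (subst (asm) AE_density) (auto simp: case_prod_beta')
  from AE_swap[OF this]
  show ?thesis
  proof (rule AE_mp, intro AE_I2 impI)
    fix y assume y: "y \<in> space Q"
    assume A: "AE x in PX. 0 < (case (x, y) of (x, y) \<Rightarrow> ennreal (w x y)) \<longrightarrow> (AE x' in PX. nu w (x, y) x' \<in> {-\<infinity>, 0})"
    have [measurable]: "(\<lambda>x. w x y) \<in> borel_measurable PX" using y by (rule measurable_w1)
    let ?p = "match_prob PX w y"
    show "(AE x in PX. w x y = 0 \<or> w x y = output_density PX w y / ?p)
      \<and> (\<integral>\<^sup>+x. ennreal (w x y) \<partial>PX) = ennreal (output_density PX w y)
      \<and> (?p = 0 \<longrightarrow> output_density PX w y = 0) \<and> (?p > 0 \<longrightarrow> output_density PX w y > 0)"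
    proof (cases "?p = 0")
      \<comment> \<open>Here the quotient is a division by zero and equals 0, in agreement with the
        vanishing density.\<close>
      case True
      then have "AE x in PX. \<not> 0 < w x y"
        by (subst AE_iff_measurable[OF _ refl]) (auto simp: match_prob_def PX.emeasure_eq_measure)
      then have w0: "AE x in PX. w x y = 0"
        using AE_space[of PX] by eventually_elim (use density_nonneg[OF _ y] in force)
      then have "(\<integral>\<^sup>+x. ennreal (w x y) \<partial>PX) = (\<integral>\<^sup>+x. 0 \<partial>PX)"
        by (intro nn_integral_cong_AE) auto
      then show ?thesis using w0 True by (auto simp: output_density_def)
    next
      case False
      have "\<exists>x\<in>space PX. 0 < w x y \<and> (AE x' in PX. nu w (x, y) x' \<in> {-\<infinity>, 0})"
      proof (rule ccontr)
        assume neg: "\<not> ?thesis"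
        have "AE x in PX. \<not> 0 < w x y"
          using A AE_space[of PX] by eventually_elim (use neg in auto)
        then have "?p = 0"
          by (subst (asm) AE_iff_measurable[OF _ refl]) (auto simp: match_prob_def measure_def)
        with False show False by simp
      qed
      then obtain x where x: "x \<in> space PX" "0 < w x y" "AE x' in PX. nu w (x, y) x' \<in> {-\<infinity>, 0}" by blast
      have two: "AE x' in PX. w x' y = 0 \<or> w x' y = w x y"
        using x(3) AE_space[of PX]
      proof eventually_elim
        case (elim x')
        have "0 \<le> w x' y" using elim(2) y by (rule density_nonneg)
        with elim(1) nu_mem_iff[of w "(x, y)" x'] x(2) show ?case by auto
      qed
      have "(\<integral>\<^sup>+x'. ennreal (w x' y) \<partial>PX) = (\<integral>\<^sup>+x'. ennreal (w x y) * indicator {x' \<in> space PX. w x' y > 0} x' \<partial>PX)"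
        using two AE_space[of PX] by (intro nn_integral_cong_AE, eventually_elim) (use x(2) in \<open>auto simp: indicator_def\<close>)
      also have "\<dots> = ennreal (w x y * ?p)"
        by (subst nn_integral_cmult_indicator) (use x(2) in \<open>auto simp: match_prob_def PX.emeasure_eq_measure ennreal_mult\<close>)
      finally have int: "(\<integral>\<^sup>+x'. ennreal (w x' y) \<partial>PX) = ennreal (w x y * ?p)" .
      then have out: "output_density PX w y = w x y * ?p"
        using x(2) match_prob_bounds(1)[of y] by (simp add: output_density_def)
      show ?thesis using two int False x(2) match_prob_bounds(1)[of y] by (auto simp: out)
    qed
  qed
qed

lemma nn_integral_output_density:
  assumes "singular_channel PX Q w"
  shows "(\<integral>\<^sup>+y. ennreal (output_density PX w y) \<partial>Q) = 1"
proof -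
  interpret PX_Q: pair_sigma_finite PX Q by (rule PX_Q)
  have "(\<integral>\<^sup>+y. ennreal (output_density PX w y) \<partial>Q) = (\<integral>\<^sup>+y. (\<integral>\<^sup>+x. ennreal (w x y) \<partial>PX) \<partial>Q)"
    using singular_AE[OF assms] by (intro nn_integral_cong_AE) auto
  also have "\<dots> = (\<integral>\<^sup>+x. (\<integral>\<^sup>+y. ennreal (w x y) \<partial>Q) \<partial>PX)"
    using PX_Q.Fubini'[of "\<lambda>x y. ennreal (w x y)"] measurable_compose[OF measurable_density measurable_ennreal]
    by (simp add: case_prod_beta')
  also have "\<dots> = (\<integral>\<^sup>+x. 1 \<partial>PX)" by (intro nn_integral_cong density_normalized)
  finally show ?thesis by (simp add: PX.emeasure_space_1)
qed

lemma prob_space_output_law: "singular_channel PX Q w \<Longrightarrow> prob_space (output_law PX Q w)"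
  using nn_integral_output_density by (intro prob_spaceI) (simp add: output_law_def emeasure_density)

text \<open>For a fixed output almost every codeword has likelihood V or 0, so the maximum is V
  unless no codeword matches. The M codewords are independent, and each matches with probability
  equal to the product over the letters.\<close>

lemma nn_integral_Max_likelihood:
  assumes M: "M > 0" and y: "\<And>i. i < n \<Longrightarrow> y i \<in> space Q" and v: "\<And>i. i < n \<Longrightarrow> v i \<ge> 0"
    and two: "\<And>i. i < n \<Longrightarrow> AE x in PX. w x (y i) = 0 \<or> w x (y i) = v i"
    and pos: "\<And>i. i < n \<Longrightarrow> match_prob PX w (y i) > 0 \<Longrightarrow> v i > 0"
  shows "(\<integral>\<^sup>+c. ennreal (max_likelihood w n M c y) \<partial>codes n M)
      = ennreal ((\<Prod>i<n. v i) * (1 - (1 - (\<Prod>i<n. match_prob PX w (y i))) ^ M))"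
proof -
  let ?X = "Pi\<^sub>M {..<n} (\<lambda>_. PX)"
  interpret C: prob_space "codes n M" by (rule prob_space_codes)
  interpret X: prob_space ?X by (intro prob_space_PiM PX.prob_space_axioms)
  interpret PXs: product_sigma_finite "\<lambda>_::nat. PX" ..
  interpret Xs: product_sigma_finite "\<lambda>_::nat. ?X" ..
  define V where "V = (\<Prod>i<n. v i)"
  have V0: "V \<ge> 0" using v by (auto simp: V_def intro!: prod_nonneg)
  \<comment> \<open>Indicator that the word x matches y in every letter, written as a product so
    that its expectation factorises.\<close>
  define b where "b x = (\<Prod>i<n. indicator {0<..} (w (x i) (y i)) :: real)" for x
  have b01: "b x = 0 \<or> b x = 1" for x
    unfolding b_def by (cases "\<forall>i<n. w (x i) (y i) > 0") (auto simp: indicator_def)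
  have b_bd: "\<bar>b x\<bar> \<le> 1" "0 \<le> 1 - b x" "1 - b x \<le> 1" for x
    using b01[of x] by auto
  have b_meas[measurable]: "b \<in> borel_measurable ?X"
    unfolding b_def
  proof (rule borel_measurable_prod)
    fix i assume "i \<in> {..<n}"
    then show "(\<lambda>x. indicator {0<..} (w (x i) (y i)) :: real) \<in> borel_measurable ?X"
      using measurable_compose[OF measurable_compose[OF measurable_component_singleton[of i "{..<n}" "\<lambda>_. PX"] measurable_w1[OF y[of i]]],
          of "indicator {0<..} :: real \<Rightarrow> real"] by simp
  qed
  have int_b: "(\<integral>x. b x \<partial>?X) = (\<Prod>i<n. match_prob PX w (y i))"
  proof -
    have p: "(\<integral>x. (indicator {0<..} (w x (y i)) :: real) \<partial>PX) = match_prob PX w (y i)"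
      "integrable PX (\<lambda>x. indicator {0<..} (w x (y i)) :: real)" if "i < n" for i
    proof -
      have [measurable]: "(\<lambda>x. w x (y i)) \<in> borel_measurable PX" by (rule measurable_w1[OF y[OF that]])
      have "(\<integral>x. (indicator {0<..} (w x (y i)) :: real) \<partial>PX) = (\<integral>x. indicator {x \<in> space PX. w x (y i) > 0} x \<partial>PX)"
        by (intro Bochner_Integration.integral_cong) (auto simp: indicator_def)
      then show "(\<integral>x. (indicator {0<..} (w x (y i)) :: real) \<partial>PX) = match_prob PX w (y i)" by (simp add: match_prob_def)
      show "integrable PX (\<lambda>x. indicator {0<..} (w x (y i)) :: real)"
        by (rule PX.integrable_const_bound[where B = 1]) auto
    qed
    show ?thesis unfolding b_def by (subst PXs.product_integral_prod) (use p in auto)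
  qed
  have AE_c: "AE c in codes n M. \<forall>m\<in>{..<M}. \<forall>i\<in>{..<n}. w (c m i) (y i) = 0 \<or> w (c m i) (y i) = v i"
  proof (intro AE_finite_allI finite_lessThan)
    fix m i assume m: "m \<in> {..<M}" and i: "i \<in> {..<n}"
    have "AE x in ?X. w (x i) (y i) = 0 \<or> w (x i) (y i) = v i"
      by (rule AE_PiM_component[OF _ i two]) (use i PX.prob_space_axioms in auto)
    then show "AE c in codes n M. w (c m i) (y i) = 0 \<or> w (c m i) (y i) = v i"
      by (intro AE_PiM_component[OF _ m]) (use X.prob_space_axioms in auto)
  qed
  have "(\<integral>\<^sup>+c. ennreal (max_likelihood w n M c y) \<partial>codes n M)
      = (\<integral>\<^sup>+c. ennreal (V * (1 - (\<Prod>m<M. 1 - b (c m)))) \<partial>codes n M)"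
  proof (rule nn_integral_cong_AE, use AE_c in eventually_elim)
    fix c assume c: "\<forall>m\<in>{..<M}. \<forall>i\<in>{..<n}. w (c m i) (y i) = 0 \<or> w (c m i) (y i) = v i"
    have l: "likelihood w n (c m) y = V * b (c m)" if "m < M" for m
    proof (cases "\<forall>i<n. w (c m i) (y i) > 0")
      case True
      then have "likelihood w n (c m) y = V"
        unfolding likelihood_def V_def using c that by (intro prod.cong) force+
      then show ?thesis using True by (simp add: b_def)
    next
      case False
      then obtain i where i: "i < n" "\<not> w (c m i) (y i) > 0" by auto
      then have "w (c m i) (y i) = 0" using c that v[of i] by force
      then have "likelihood w n (c m) y = 0" unfolding likelihood_def using i by (intro prod_zero) auto
      moreover have "b (c m) = 0" unfolding b_def by (intro prod_zero bexI[of _ i]) (use i in auto)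
      ultimately show ?thesis by simp
    qed
    have "max_likelihood w n M c y = V * (1 - (\<Prod>m<M. 1 - b (c m)))"
    proof (cases "\<exists>m<M. b (c m) = 1")
      case True
      then obtain m where m: "m < M" "b (c m) = 1" by auto
      then have "(\<Prod>m<M. 1 - b (c m)) = 0" by (intro prod_zero) auto
      moreover have "max_likelihood w n M c y = V"
        unfolding max_likelihood_def
      proof (rule Max_eqI)
        show "z \<le> V" if "z \<in> (\<lambda>k. likelihood w n (c k) y) ` {..<M}" for z
        proof -
          from that obtain k where k: "k < M" "z = V * b (c k)" using l by auto
          show ?thesis using b01[of "c k"] V0 k by auto
        qed
        show "V \<in> (\<lambda>k. likelihood w n (c k) y) ` {..<M}"
          using m l[of m] by (auto intro!: image_eqI[of _ _ m])
      qed simp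
      ultimately show ?thesis by simp
    next
      case False
      then have b0: "b (c m) = 0" if "m < M" for m using b01 that by blast
      then have "(\<lambda>k. likelihood w n (c k) y) ` {..<M} = {0}" using l M by (auto simp: image_iff)
      moreover have "(\<Prod>m<M. 1 - b (c m)) = 1" using b0 by (intro prod.neutral) auto
      ultimately show ?thesis by (simp add: max_likelihood_def)
    qed
    then show "ennreal (max_likelihood w n M c y) = ennreal (V * (1 - (\<Prod>m<M. 1 - b (c m))))" by simp
  qed
  also have "\<dots> = ennreal (\<integral>c. V * (1 - (\<Prod>m<M. 1 - b (c m))) \<partial>codes n M)"
  proof (rule nn_integral_eq_integral)
    have bd: "0 \<le> (\<Prod>m<M. 1 - b (c m)) \<and> (\<Prod>m<M. 1 - b (c m)) \<le> 1" for c
      using b_bd by (auto intro!: prod_nonneg prod_le_1)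
    have "(\<lambda>c. \<Prod>m<M. 1 - b (c m)) \<in> borel_measurable (codes n M)"
      by (intro borel_measurable_prod borel_measurable_diff borel_measurable_const measurable_coordinate[OF _ b_meas])
    then show "integrable (codes n M) (\<lambda>c. V * (1 - (\<Prod>m<M. 1 - b (c m))))"
      by (intro integrable_mult_right C.integrable_const_bound[where B = 1]) (use bd in auto)
    show "AE c in codes n M. 0 \<le> V * (1 - (\<Prod>m<M. 1 - b (c m)))"
      using bd V0 by (auto intro!: AE_I2 mult_nonneg_nonneg)
  qed
  also have "(\<integral>c. V * (1 - (\<Prod>m<M. 1 - b (c m))) \<partial>codes n M) = V * (1 - (1 - (\<Prod>i<n. match_prob PX w (y i))) ^ M)"
  proof -
    have ib: "integrable ?X b"
      by (rule X.integrable_const_bound[where B = 1]) (use b_bd in auto)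
    then have i1: "integrable ?X (\<lambda>x. 1 - b x)" by simp
    have "integrable (codes n M) (\<lambda>c. \<Prod>m<M. 1 - b (c m))"
      by (rule Xs.product_integrable_prod) (use i1 in auto)
    moreover have "(\<integral>c. (\<Prod>m<M. 1 - b (c m)) \<partial>codes n M) = (\<Prod>m<M. \<integral>x. 1 - b x \<partial>?X)"
      by (rule Xs.product_integral_prod) (use i1 in auto)
    moreover have "(\<integral>x. 1 - b x \<partial>?X) = 1 - (\<Prod>i<n. match_prob PX w (y i))"
      using ib int_b by (simp add: X.prob_space)
    ultimately show ?thesis by (simp add: C.prob_space)
  qed
  finally show ?thesis by (simp add: V_def)
qed

end

section \<open>The exact error of a singular channel as an integral over the outputs\<close>

lemma tie_error_bounds:
  assumes "0 \<le> q" "q \<le> 1"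
  shows "0 \<le> (1 - (1 - q) ^ M) / (real M * q)" "(1 - (1 - q) ^ M) / (real M * q) \<le> 1"
proof -
  have "(1 - q) ^ M \<le> 1" using assms by (intro power_le_one) auto
  then show "0 \<le> (1 - (1 - q) ^ M) / (real M * q)" using assms by (intro divide_nonneg_nonneg) auto
  have "1 + real M * (- q) \<le> (1 + (- q)) ^ M" using assms by (intro Bernoulli_inequality) auto
  then have "1 - (1 - q) ^ M \<le> real M * q" by simp
  moreover have "0 \<le> real M * q" using assms by simp
  ultimately show "(1 - (1 - q) ^ M) / (real M * q) \<le> 1" by (intro divide_le_eq_1[THEN iffD2]) linarith
qed

context memoryless_channel
begin

text \<open>The factor in front of 1 - (1 - q)^M is the product of the output densities divided by
  q. The output densities turn Q into the output law, and what is left is M times the probability of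
  correct decoding.\<close>

theorem P_RC_singular:
  assumes sing: "singular_channel PX Q w" and M: "M > 0"
  shows "P_RC PX Q w n M = (\<integral>y. tie_error M (\<Prod>i<n. match_prob PX w (y i)) \<partial>Pi\<^sub>M {..<n} (\<lambda>_. output_law PX Q w))"
proof -
  let ?Y = "outputs n" and ?T = "Pi\<^sub>M {..<n} (\<lambda>_. output_law PX Q w)"
  let ?out = "output_density PX w" and ?p = "match_prob PX w"
  let ?v = "\<lambda>y. ?out y / ?p y"
  let ?q = "\<lambda>y. \<Prod>i<n. ?p (y i)"
  interpret O: prob_space "output_law PX Q w" by (rule prob_space_output_law[OF sing])
  interpret T: prob_space ?T by (intro prob_space_PiM O.prob_space_axioms)
  interpret Qs: product_sigma_finite "\<lambda>_::nat. Q" ..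
  have q01: "0 \<le> ?q y" "?q y \<le> 1" for y
    using match_prob_bounds by (auto intro!: prod_nonneg prod_le_1)
  have T_eq: "?T = density ?Y (\<lambda>y. \<Prod>i<n. ennreal (?out (y i)))"
    unfolding output_law_def
    by (rule PiM_density)
       (use Q.sigma_finite_measure_axioms O.sigma_finite_measure_axioms in \<open>auto simp: output_law_def\<close>)
  have comp: "(\<lambda>y. f (y i)) \<in> borel_measurable ?Y" if "i < n" "f \<in> borel_measurable Q" for f :: "'y \<Rightarrow> real" and i
    using that by (intro measurable_coordinate) auto
  have q_meas[measurable]: "?q \<in> borel_measurable ?Y"
    by (intro borel_measurable_prod comp) auto
  have out_meas[measurable]: "(\<lambda>y. \<Prod>i<n. ennreal (?out (y i))) \<in> borel_measurable ?Y"
    by (intro borel_measurable_prod_ennreal measurable_compose[OF _ measurable_ennreal] comp) auto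
  have sets_T[measurable_cong]: "sets ?T = sets ?Y" unfolding T_eq by simp
  let ?good = "\<lambda>y. (AE x in PX. w x y = 0 \<or> w x y = ?v y) \<and> (?p y = 0 \<longrightarrow> ?out y = 0) \<and> (?p y > 0 \<longrightarrow> ?out y > 0)"
  have good: "AE y in ?Y. \<forall>i\<in>{..<n}. ?good (y i)"
  proof (intro AE_finite_allI finite_lessThan)
    fix i assume i: "i \<in> {..<n}"
    have "AE y in Q. ?good y" using singular_AE[OF sing] by eventually_elim blast
    then show "AE y in ?Y. ?good (y i)" by (rule Qs.AE_PiM_finite_component[OF finite_lessThan i])
  qed
  define k where "k q = (1 - (1 - q) ^ M) / (real M * q)" for q :: real
  have k01: "0 \<le> k (?q y)" "k (?q y) \<le> 1" for y
    unfolding k_def by (rule tie_error_bounds[OF q01])+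
  have k_meas[measurable]: "(\<lambda>y. k (?q y)) \<in> borel_measurable ?Y" unfolding k_def by measurable
  have int_k: "integrable ?T (\<lambda>y. k (?q y))"
  proof (rule T.integrable_const_bound[where B = 1])
    show "AE y in ?T. norm (k (?q y)) \<le> 1"
      using k01 by (intro AE_I2) (simp only: real_norm_def abs_of_nonneg)
  qed measurable
  have "(\<integral>\<^sup>+y. (\<integral>\<^sup>+c. ennreal (max_likelihood w n M c y) \<partial>codes n M) \<partial>?Y)
      = (\<integral>\<^sup>+y. (\<Prod>i<n. ennreal (?out (y i))) * ennreal (real M * k (?q y)) \<partial>?Y)"
  proof (rule nn_integral_cong_AE)
    show "AE y in ?Y. (\<integral>\<^sup>+c. ennreal (max_likelihood w n M c y) \<partial>codes n M)
        = (\<Prod>i<n. ennreal (?out (y i))) * ennreal (real M * k (?q y))"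
      using good AE_space[of ?Y]
    proof eventually_elim
      case (elim y)
      have out0: "?out y \<ge> 0" for y by (simp add: output_density_def)
      have "(\<integral>\<^sup>+c. ennreal (max_likelihood w n M c y) \<partial>codes n M)
          = ennreal ((\<Prod>i<n. ?v (y i)) * (1 - (1 - ?q y) ^ M))"
        by (rule nn_integral_Max_likelihood[OF M])
           (use elim out0 match_prob_bounds in \<open>auto intro: outputs_mem divide_nonneg_nonneg\<close>)
      \<comment> \<open>Valid at q = 0 too, where both sides vanish by division by zero.\<close>
      also have "(\<Prod>i<n. ?v (y i)) * (1 - (1 - ?q y) ^ M) = (\<Prod>i<n. ?out (y i)) * (real M * k (?q y))"
        using M by (simp add: prod_dividef k_def)
      also have "ennreal ((\<Prod>i<n. ?out (y i)) * (real M * k (?q y))) = (\<Prod>i<n. ennreal (?out (y i))) * ennreal (real M * k (?q y))"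
      proof -
        have "0 \<le> (\<Prod>i<n. ?out (y i))" using out0 by (intro prod_nonneg) auto
        moreover have "0 \<le> real M * k (?q y)" by (intro mult_nonneg_nonneg k01) auto
        moreover have "(\<Prod>i<n. ennreal (?out (y i))) = ennreal (\<Prod>i<n. ?out (y i))"
          using out0 by (intro prod_ennreal) auto
        ultimately show ?thesis by (simp only: ennreal_mult)
      qed
      finally show ?case .
    qed
  qed
  also have "\<dots> = (\<integral>\<^sup>+y. ennreal (real M * k (?q y)) \<partial>?T)"
    unfolding T_eq by (rule nn_integral_density[symmetric]) measurable
  also have "\<dots> = ennreal (\<integral>y. real M * k (?q y) \<partial>?T)"
    by (rule nn_integral_eq_integral) (use int_k k01 in \<open>auto intro!: AE_I2 mult_nonneg_nonneg\<close>)
  finally have "P_RC PX Q w n M = 1 - enn2real (ennreal (\<integral>y. real M * k (?q y) \<partial>?T)) / real M"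
    unfolding P_RC_eq_nn_integral[OF M] by simp
  also have "enn2real (ennreal (\<integral>y. real M * k (?q y) \<partial>?T)) = (\<integral>y. real M * k (?q y) \<partial>?T)"
    using k01 by (intro enn2real_ennreal integral_nonneg_AE AE_I2 mult_nonneg_nonneg) auto
  also have "1 - (\<integral>y. real M * k (?q y) \<partial>?T) / real M = (\<integral>y. 1 - k (?q y) \<partial>?T)"
    using int_k M by (simp add: T.prob_space)
  finally show ?thesis by (simp add: tie_error_def k_def)
qed

section \<open>Transfer between the law of (X, Y) and the law of Y\<close>

abbreviation "joint \<equiv> joint_law PX Q w"

lemma AE_joint_law_iff: "(AE p in joint. P p) \<longleftrightarrow> (AE p in PX \<Otimes>\<^sub>M Q. w (fst p) (snd p) > 0 \<longrightarrow> P p)"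
  unfolding joint_law_def
  using measurable_compose[OF measurable_density measurable_ennreal]
  by (subst AE_density) (auto simp: case_prod_beta')

text \<open>The predicate P is arbitrary, possibly not measurable, so the argument is direct: if P
  fails at a typical y, almost every letter has density 0 there, and then the output density at y
  vanishes.\<close>

lemma AE_output_of_joint_law:
  assumes sing: "singular_channel PX Q w" and P: "AE p in joint. P (snd p)"
  shows "AE y in output_law PX Q w. P y"
proof -
  have "AE p in PX \<Otimes>\<^sub>M Q. w (fst p) (snd p) > 0 \<longrightarrow> P (snd p)" using P by (simp add: AE_joint_law_iff)
  from AE_swap[OF this] have "AE y in Q. 0 < output_density PX w y \<longrightarrow> P y"
    using singular_AE[OF sing] AE_space[of Q]
  proof eventually_elim
    case (elim y)
    show ?case
    proof
      assume out: "0 < output_density PX w y"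
      show "P y"
      proof (rule ccontr)
        assume "\<not> P y"
        with elim(1) have "AE x in PX. ennreal (w x y) = 0" by (auto simp: ennreal_eq_0_iff not_less)
        then have "(\<integral>\<^sup>+x. ennreal (w x y) \<partial>PX) = (\<integral>\<^sup>+x. 0 \<partial>PX)" by (intro nn_integral_cong_AE) auto
        with elim(2) out show False by simp
      qed
    qed
  qed
  then show ?thesis unfolding output_law_def by (subst AE_density) auto
qed

lemma distr_joint_law_snd:
  assumes sing: "singular_channel PX Q w"
  shows "distr joint Q snd = output_law PX Q w"
proof (rule measure_eqI)
  interpret PX_Q: pair_sigma_finite PX Q by (rule PX_Q)
  fix A assume "A \<in> sets (distr joint Q snd)"
  then have A[measurable]: "A \<in> sets Q" by simp
  have dens: "(\<lambda>p. ennreal (w (fst p) (snd p))) \<in> borel_measurable (PX \<Otimes>\<^sub>M Q)"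
    using measurable_compose[OF measurable_density measurable_ennreal] by (simp add: case_prod_beta')
  then have meas: "(\<lambda>p. ennreal (w (fst p) (snd p)) * indicator A (snd p)) \<in> borel_measurable (PX \<Otimes>\<^sub>M Q)" by simp
  have "emeasure (distr joint Q snd) A = (\<integral>\<^sup>+y. indicator A y \<partial>distr joint Q snd)"
    by simp
  also have "\<dots> = (\<integral>\<^sup>+p. indicator A (snd p) \<partial>joint)"
    by (rule nn_integral_distr) (auto simp: joint_law_def)
  also have "\<dots> = (\<integral>\<^sup>+p. ennreal (w (fst p) (snd p)) * indicator A (snd p) \<partial>(PX \<Otimes>\<^sub>M Q))"
    unfolding joint_law_def using dens by (subst nn_integral_density) (auto simp: case_prod_beta')
  also have "\<dots> = (\<integral>\<^sup>+y. (\<integral>\<^sup>+x. ennreal (w x y) * indicator A y \<partial>PX) \<partial>Q)"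
    by (subst PX_Q.nn_integral_snd[symmetric]) (use meas in \<open>auto simp: case_prod_beta'\<close>)
  also have "\<dots> = (\<integral>\<^sup>+y. ennreal (output_density PX w y) * indicator A y \<partial>Q)"
    using singular_AE[OF sing] AE_space[of Q]
    by (intro nn_integral_cong_AE, eventually_elim) (simp add: nn_integral_multc)
  also have "\<dots> = emeasure (output_law PX Q w) A" by (simp add: output_law_def emeasure_density)
  finally show "emeasure (distr joint Q snd) A = emeasure (output_law PX Q w) A" .
qed (simp add: output_law_def)

lemma AE_joint_law_of_output:
  assumes "singular_channel PX Q w" and "AE y in output_law PX Q w. P y"
  shows "AE p in joint. P (snd p)"
proof (rule AE_distrD[where M' = Q])
  show "AE y in distr joint Q snd. P y" unfolding distr_joint_law_snd[OF assms(1)] by fact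
qed (simp add: joint_law_def)

lemma measurable_Zfun: "Zfun PX w l \<in> borel_measurable joint"
proof -
  have r: "(\<lambda>p. w (fst p) (snd p)) \<in> borel_measurable (PX \<Otimes>\<^sub>M Q)"
    using measurable_density by (simp add: case_prod_beta')
  have 1: "(\<lambda>p. w (snd p) (snd (fst p))) \<in> borel_measurable ((PX \<Otimes>\<^sub>M Q) \<Otimes>\<^sub>M PX)"
    using measurable_compose[OF _ r, of "\<lambda>p. (snd p, snd (fst p))" "(PX \<Otimes>\<^sub>M Q) \<Otimes>\<^sub>M PX"] by simp
  have 2: "(\<lambda>p. w (fst (fst p)) (snd (fst p))) \<in> borel_measurable ((PX \<Otimes>\<^sub>M Q) \<Otimes>\<^sub>M PX)"
    by (rule measurable_compose[OF measurable_fst r])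
  have e: "ext_exp l (ext_ln z) = (if z > 0 then exp (l * ln z) else 0)" for z :: real
    by (simp add: ext_exp_def ext_ln_def)
  have "(\<lambda>p. \<integral>x'. ext_exp l (nu w p x') \<partial>PX) \<in> borel_measurable (PX \<Otimes>\<^sub>M Q)"
    unfolding nu_def e using 1 2
    by (intro PX.borel_measurable_lebesgue_integral) (simp add: case_prod_beta')
  then show ?thesis unfolding Zfun_def cond_mgf_def joint_law_def by simp
qed

text \<open>Since nu is -oo or 0, exp (l * nu) is the indicator that x' matches the output, whatever
  l is.\<close>

lemma Zfun_eq:
  assumes sing: "singular_channel PX Q w"
  shows "AE p in joint. Zfun PX w l p = ln (match_prob PX w (snd p))"
proof -
  have pos: "AE p in joint. w (fst p) (snd p) > 0"
    unfolding AE_joint_law_iff by simp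
  show ?thesis
    using sing[unfolded singular_channel_def] pos AE_space[of "joint"]
  proof eventually_elim
    case (elim p)
    have p: "fst p \<in> space PX" "snd p \<in> space Q" using elim(3) by (auto simp: joint_law_def space_pair_measure)
    have [measurable]: "(\<lambda>x. w x (snd p)) \<in> borel_measurable PX" by (rule measurable_w1[OF p(2)])
    have "cond_mgf PX w l p = (\<integral>x'. indicator {x' \<in> space PX. w x' (snd p) > 0} x' \<partial>PX)"
      unfolding cond_mgf_def
    proof (rule integral_cong_AE)
      show "AE x' in PX. ext_exp l (nu w p x') = indicator {x' \<in> space PX. w x' (snd p) > 0} x'"
        using elim(1) AE_space[of PX]
      proof eventually_elim
        case (elim x')
        with nu_mem_iff[of w p x'] \<open>w (fst p) (snd p) > 0\<close> show ?case
          by (auto simp: nu_def ext_ln_def ext_exp_def indicator_def zero_less_divide_iff)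
      qed
      have e: "ext_exp l (ext_ln z) = (if z > 0 then exp (l * ln z) else 0)" for z :: real
        by (simp add: ext_exp_def ext_ln_def)
      show "(\<lambda>x'. ext_exp l (nu w p x')) \<in> borel_measurable PX" unfolding nu_def e by measurable
    qed measurable
    also have "\<dots> = match_prob PX w (snd p)" by (simp add: match_prob_def)
    finally show ?case by (simp add: Zfun_def)
  qed
qed

lemma match_prob_pos:
  assumes sing: "singular_channel PX Q w"
  shows "AE y in output_law PX Q w. match_prob PX w y > 0"
proof -
  have "AE y in Q. 0 < ennreal (output_density PX w y) \<longrightarrow> match_prob PX w y > 0"
    using singular_AE[OF sing]
  proof eventually_elim
    case (elim y)
    then show ?case using match_prob_bounds(1)[of y] by (cases "match_prob PX w y = 0") auto
  qed
  then show ?thesis unfolding output_law_def by (subst AE_density) auto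
qed

lemma integral_joint_law:
  assumes sing: "singular_channel PX Q w" and f[measurable]: "f \<in> borel_measurable borel"
  shows "(\<integral>p. f (Zfun PX w l p) \<partial>joint) = (\<integral>y. f (ln (match_prob PX w y)) \<partial>output_law PX Q w :: real)"
    and "integrable joint (\<lambda>p. f (Zfun PX w l p)) \<longleftrightarrow> integrable (output_law PX Q w) (\<lambda>y. f (ln (match_prob PX w y)) :: real)"
proof -
  note [measurable] = measurable_Zfun
  have snd[measurable]: "snd \<in> measurable joint Q" by (simp add: joint_law_def)
  have AE: "AE p in joint. f (Zfun PX w l p) = f (ln (match_prob PX w (snd p)))"
    using Zfun_eq[OF sing, of l] by eventually_elim simp
  have "(\<integral>p. f (Zfun PX w l p) \<partial>joint) = (\<integral>p. f (ln (match_prob PX w (snd p))) \<partial>joint)"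
    by (rule integral_cong_AE) (use AE in measurable)
  also have "\<dots> = (\<integral>y. f (ln (match_prob PX w y)) \<partial>output_law PX Q w)"
    unfolding distr_joint_law_snd[OF sing, symmetric] by (rule integral_distr[symmetric]) measurable
  finally show "(\<integral>p. f (Zfun PX w l p) \<partial>joint) = (\<integral>y. f (ln (match_prob PX w y)) \<partial>output_law PX Q w)" .
  have "integrable joint (\<lambda>p. f (Zfun PX w l p)) \<longleftrightarrow> integrable joint (\<lambda>p. f (ln (match_prob PX w (snd p))))"
    by (rule integrable_cong_AE) (use AE in measurable)
  also have "\<dots> \<longleftrightarrow> integrable (output_law PX Q w) (\<lambda>y. f (ln (match_prob PX w y)))"
    unfolding distr_joint_law_snd[OF sing, symmetric] by (rule integrable_distr_eq[symmetric]) measurable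
  finally show "integrable joint (\<lambda>p. f (Zfun PX w l p)) \<longleftrightarrow> integrable (output_law PX Q w) (\<lambda>y. f (ln (match_prob PX w y)))" .
qed

end

section \<open>Exponential tilting\<close>

locale nonpos_variable = prob_space N for N :: "'y measure" +
  fixes Z :: "'y \<Rightarrow> real"
  assumes Z_meas[measurable]: "Z \<in> borel_measurable N" and Z_nonpos: "AE y in N. Z y \<le> 0"
begin

definition mgf :: "real \<Rightarrow> real" where
  "mgf a = expectation (\<lambda>y. exp (a * Z y))"

lemma AE_exp_le_1: "a \<ge> 0 \<Longrightarrow> AE y in N. exp (a * Z y) \<le> 1"
  using Z_nonpos by eventually_elim (simp add: mult_nonneg_nonpos)

lemma integrable_exp: "a \<ge> 0 \<Longrightarrow> integrable N (\<lambda>y. exp (a * Z y))"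
  by (rule integrable_const_bound[where B = 1]) (use AE_exp_le_1 in auto)

lemma mgf_pos: "a \<ge> 0 \<Longrightarrow> mgf a > 0"
proof -
  assume a: "a \<ge> 0"
  have "expectation (\<lambda>y. 0) < expectation (\<lambda>y. exp (a * Z y))"
    by (rule integral_less_AE_space) (use integrable_exp[OF a] emeasure_space_1 in auto)
  then show ?thesis by (simp add: mgf_def)
qed

lemma mgf_0: "mgf 0 = 1"
  by (simp add: mgf_def prob_space)

lemma continuous_on_mgf: "continuous_on {0..1} mgf"
  unfolding continuous_on_sequentially comp_def
proof safe
  fix X :: "nat \<Rightarrow> real" and a assume X: "\<forall>n. X n \<in> {0..1}" "X \<longlonglongrightarrow> a"
  show "(\<lambda>n. mgf (X n)) \<longlonglongrightarrow> mgf a"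
    unfolding mgf_def
  proof (rule integral_dominated_convergence[where w = "\<lambda>_. 1"])
    show "AE y in N. (\<lambda>n. exp (X n * Z y)) \<longlonglongrightarrow> exp (a * Z y)"
      by (intro AE_I2 tendsto_intros X)
    show "AE y in N. norm (exp (X n * Z y)) \<le> 1" for n
      using AE_exp_le_1[of "X n"] X by auto
  qed auto
qed

section \<open>Existence of the minimizer\<close>

definition objective :: "real \<Rightarrow> real \<Rightarrow> real" where
  "objective R a = a * R + ln (mgf a)"

text \<open>The right derivative of the objective at 0 is R minus the mean of - Z, which is
  negative. It is taken along 1 / (n + 1), where exp x >= 1 + x provides the integrable majorant
  |Z|, and ln x <= x - 1 removes the logarithm.\<close>

lemma objective_neg:
  assumes int: "integrable N Z" and R: "R < expectation (\<lambda>y. - Z y)"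
  obtains a where "0 < a" "a \<le> 1" "objective R a < 0"
proof -
  let ?a = "\<lambda>n. inverse (real (Suc n))"
  have lim: "(\<lambda>n. expectation (\<lambda>y. (1 - exp (?a n * Z y)) / ?a n)) \<longlonglongrightarrow> expectation (\<lambda>y. - Z y)"
  proof (rule integral_dominated_convergence[where w = "\<lambda>y. \<bar>Z y\<bar>"])
    show "AE y in N. (\<lambda>n. (1 - exp (?a n * Z y)) / ?a n) \<longlonglongrightarrow> - Z y"
    proof (rule AE_I2)
      fix y
      have "((\<lambda>t. exp (t * Z y)) has_real_derivative Z y) (at 0)"
        by (auto intro!: derivative_eq_intros)
      then have "((\<lambda>t. (exp (t * Z y) - 1) / t) \<longlongrightarrow> Z y) (at 0)" by (simp add: DERIV_def)
      moreover have "filterlim ?a (at 0) sequentially"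
        unfolding filterlim_at using LIMSEQ_inverse_real_of_nat by (auto intro!: always_eventually)
      ultimately have "(\<lambda>n. (exp (?a n * Z y) - 1) / ?a n) \<longlonglongrightarrow> Z y" by (rule filterlim_compose)
      have eq: "(1 - b) / c = - ((b - 1) / c)" for b c :: real by (simp add: minus_divide_left)
      show "(\<lambda>n. (1 - exp (?a n * Z y)) / ?a n) \<longlonglongrightarrow> - Z y"
        unfolding eq by (rule tendsto_minus) fact
    qed
    show "AE y in N. norm ((1 - exp (?a n * Z y)) / ?a n) \<le> \<bar>Z y\<bar>" for n
      using Z_nonpos
    proof eventually_elim
      case (elim y)
      have "?a n * Z y \<le> 0" using elim by (intro mult_nonneg_nonpos) auto
      then have "0 \<le> 1 - exp (?a n * Z y)" by simp
      moreover have "1 - exp (?a n * Z y) \<le> ?a n * \<bar>Z y\<bar>"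
      proof -
        have "?a n * \<bar>Z y\<bar> = - (?a n * Z y)" using elim by simp
        then show ?thesis using exp_ge_add_one_self[of "?a n * Z y"] by linarith
      qed
      ultimately have "\<bar>1 - exp (?a n * Z y)\<bar> \<le> \<bar>Z y\<bar> * ?a n" by (simp add: mult.commute)
      then have "\<bar>1 - exp (?a n * Z y)\<bar> / ?a n \<le> \<bar>Z y\<bar>"
        by (subst pos_divide_le_eq) auto
      then show ?case by (simp add: abs_divide)
    qed
  qed (use int in auto)
  then have "\<forall>\<^sub>F n in sequentially. R < expectation (\<lambda>y. (1 - exp (?a n * Z y)) / ?a n)"
    by (rule order_tendstoD[OF _ R])
  then obtain n where "R < expectation (\<lambda>y. (1 - exp (?a n * Z y)) / ?a n)"
    by (auto simp: eventually_sequentially)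
  also have "\<dots> = (1 - mgf (?a n)) / ?a n"
    using integrable_exp[of "?a n"] by (simp only: integral_divide_zero mgf_def) (simp add: prob_space)
  finally have lt0: "R < (1 - mgf (?a n)) / ?a n" .
  have a0: "0 < ?a n" by simp
  have lt: "?a n * R < 1 - mgf (?a n)" using lt0 by (simp only: pos_less_divide_eq[OF a0] mult.commute)
  have "ln (mgf (?a n)) \<le> mgf (?a n) - 1" using mgf_pos[of "?a n"] by (intro ln_le_minus_one) auto
  with lt have "objective R (?a n) < 0" by (simp add: objective_def)
  then show ?thesis by (intro that[of "?a n"]) (auto simp: inverse_le_1_iff)
qed

text \<open>The range of a is not closed at 0. A minimum over [0, 1] exists by continuity, and it is
  not attained at 0, where the objective is 0, because negative values occur.\<close>

lemma objective_min_exists: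
  assumes "integrable N Z" and "R < expectation (\<lambda>y. - Z y)"
  shows "\<exists>a. is_arg_min (objective R) (\<lambda>a. a \<in> {0<..1}) a"
proof -
  have "mgf a \<noteq> 0" if "a \<in> {0..1}" for a using mgf_pos[of a] that by simp
  then have "continuous_on {0..1} (objective R)"
    unfolding objective_def[abs_def] by (intro continuous_intros continuous_on_mgf) auto
  then obtain x where x: "x \<in> {0..1}" "\<And>a. a \<in> {0..1} \<Longrightarrow> objective R x \<le> objective R a"
    using continuous_attains_inf[of "{0..1::real}" "objective R"] by auto
  obtain a where a: "0 < a" "a \<le> 1" "objective R a < 0" using objective_neg[OF assms] by blast
  have "objective R x \<noteq> objective R 0" using x(2)[of a] a by (simp add: objective_def mgf_0)
  then have "x \<noteq> 0" by auto
  moreover have "objective R x \<le> objective R y" if "y \<in> {0<..1}" for y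
    using x(2)[of y] that by auto
  moreover have "x \<in> {0<..1}" using x(1) \<open>x \<noteq> 0\<close> by simp
  ultimately have "is_arg_min (objective R) (\<lambda>a. a \<in> {0<..1}) x"
    by (simp add: is_arg_min_linorder)
  then show ?thesis by blast
qed

section \<open>The tilted law and its moments\<close>

definition tilt :: "real \<Rightarrow> 'y measure" where
  "tilt r = density N (\<lambda>y. ennreal (exp (r * Z y - ln (mgf r))))"

lemma tilt_simps[simp]: "space (tilt r) = space N" "sets (tilt r) = sets N"
  by (simp_all add: tilt_def)

lemma AE_tilt: "(AE y in tilt r. P y) \<longleftrightarrow> (AE y in N. P y)"
  unfolding tilt_def by (subst AE_density) auto

lemma prob_space_tilt:
  assumes "r \<ge> 0"
  shows "prob_space (tilt r)"
proof (rule prob_spaceI)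
  have "(\<integral>\<^sup>+y. ennreal (exp (r * Z y - ln (mgf r))) \<partial>N) = (\<integral>\<^sup>+y. ennreal (exp (r * Z y)) * ennreal (1 / mgf r) \<partial>N)"
    using mgf_pos[OF assms] by (intro nn_integral_cong) (simp add: exp_diff ennreal_mult[symmetric])
  also have "\<dots> = ennreal (mgf r) * ennreal (1 / mgf r)"
    using integrable_exp[OF assms] by (subst nn_integral_multc) (auto simp: nn_integral_eq_integral mgf_def)
  also have "\<dots> = 1" using mgf_pos[OF assms] by (simp add: ennreal_mult[symmetric])
  finally show "emeasure (tilt r) (space (tilt r)) = 1" by (simp add: tilt_def emeasure_density)
qed

lemma integral_tilt:
  assumes [measurable]: "f \<in> borel_measurable N"
  shows "(\<integral>y. f y \<partial>tilt r) = expectation (\<lambda>y. exp (r * Z y - ln (mgf r)) * f y)"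
  unfolding tilt_def by (subst integral_density) auto

text \<open>As Z <= 0 almost everywhere, the tilting factor exp (r * Z) compensates exp (k * |Z|)
  for every k <= r.\<close>

lemma integrable_tilt_exp:
  assumes "0 \<le> k" "k \<le> r"
  shows "integrable (tilt r) (\<lambda>y. exp (k * \<bar>Z y + R\<bar>))"
proof -
  have "integrable N (\<lambda>y. exp (r * Z y - ln (mgf r)) * exp (k * \<bar>Z y + R\<bar>))"
  proof (rule integrable_const_bound[where B = "exp (- ln (mgf r)) * exp (k * \<bar>R\<bar>)"])
    show "AE y in N. norm (exp (r * Z y - ln (mgf r)) * exp (k * \<bar>Z y + R\<bar>)) \<le> exp (- ln (mgf r)) * exp (k * \<bar>R\<bar>)"
      using Z_nonpos
    proof eventually_elim
      case (elim y)
      have "\<bar>Z y + R\<bar> \<le> - Z y + \<bar>R\<bar>" using elim by linarith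
      then have "k * \<bar>Z y + R\<bar> \<le> k * (- Z y + \<bar>R\<bar>)" using assms by (intro mult_left_mono)
      moreover have "r * Z y \<le> k * Z y" using assms elim by (intro mult_right_mono_neg)
      ultimately have "(r * Z y - ln (mgf r)) + k * \<bar>Z y + R\<bar> \<le> - ln (mgf r) + k * \<bar>R\<bar>"
        by (simp add: algebra_simps)
      then show ?case by (simp add: exp_add[symmetric])
    qed
  qed measurable
  then show ?thesis unfolding tilt_def by (subst integrable_density) auto
qed

lemma integrable_tilt_moments:
  assumes "r > 0"
  shows "integrable (tilt r) (\<lambda>y. Z y + R)" "integrable (tilt r) (\<lambda>y. (Z y + R)\<^sup>2)"
proof -
  \<comment> \<open>This is x <= exp x at x = (r / 2) |Z + R|, squared.\<close>
  have bound: "(Z y + R)\<^sup>2 \<le> (2 / r)\<^sup>2 * exp (r * \<bar>Z y + R\<bar>)" for y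
  proof -
    have "r / 2 * \<bar>Z y + R\<bar> \<le> exp (r / 2 * \<bar>Z y + R\<bar>)"
      using exp_ge_add_one_self[of "r / 2 * \<bar>Z y + R\<bar>"] by linarith
    then have "(r / 2 * \<bar>Z y + R\<bar>)\<^sup>2 \<le> (exp (r / 2 * \<bar>Z y + R\<bar>))\<^sup>2"
      using assms by (intro power_mono) auto
    also have "\<dots> = exp (r * \<bar>Z y + R\<bar>)" by (simp flip: exp_double)
    finally have "(2 / r)\<^sup>2 * (r / 2 * \<bar>Z y + R\<bar>)\<^sup>2 \<le> (2 / r)\<^sup>2 * exp (r * \<bar>Z y + R\<bar>)"
      by (intro mult_left_mono) auto
    moreover have "(2 / r)\<^sup>2 * (r / 2 * \<bar>Z y + R\<bar>)\<^sup>2 = (Z y + R)\<^sup>2"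
      using assms by (simp flip: power_mult_distrib)
    ultimately show ?thesis by simp
  qed
  show sq: "integrable (tilt r) (\<lambda>y. (Z y + R)\<^sup>2)"
    by (rule Bochner_Integration.integrable_bound[OF integrable_mult_right[OF integrable_tilt_exp[of r r R], of "(2 / r)\<^sup>2"]])
       (use assms bound in \<open>auto intro!: AE_I2 simp: tilt_def intro: order_trans[OF _ abs_ge_self]\<close>)
  interpret T: prob_space "tilt r" using assms by (intro prob_space_tilt) auto
  show "integrable (tilt r) (\<lambda>y. Z y + R)"
    by (rule T.square_integrable_imp_integrable[OF _ sq]) (simp add: tilt_def)
qed

text \<open>Stationarity at an interior minimum, obtained from difference quotients of the
  moment generating function of the tilted variable.\<close>

lemma tilt_mean_zero:
  assumes min: "is_arg_min (objective R) (\<lambda>a. a \<in> {0<..1}) r" and r: "r \<noteq> 1"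
  shows "(\<integral>y. Z y + R \<partial>tilt r) = 0"
proof -
  have r01: "0 < r" "r < 1" using min r by (auto simp: is_arg_min_def)
  interpret T: prob_space "tilt r" using r01 by (intro prob_space_tilt) auto
  \<comment> \<open>Keeps r + u inside (0, 1] for |u| <= d, and leaves 2 d <= r, so that exp (2 d |Z
    + R|) is an integrable majorant.\<close>
  define d where "d = min r (1 - r) / 2"
  have d: "d > 0" "2 * d \<le> r" "r + d \<le> 1" "0 < r - d" using r01 by (auto simp: d_def min_def field_simps)
  \<comment> \<open>Under the tilted law the moment generating function of Z + R at u is exp
    (objective R (r + u) - objective R r), which minimality makes at least 1.\<close>
  have ge1: "T.expectation (\<lambda>y. exp (u * (Z y + R))) \<ge> 1" and
    iu: "integrable (tilt r) (\<lambda>y. exp (u * (Z y + R)))" if u: "\<bar>u\<bar> \<le> d" for u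
  proof -
    have ru: "r + u \<in> {0<..1}" using u d by auto
    have eq: "exp (r * Z y - ln (mgf r)) * exp (u * (Z y + R)) = exp (u * R) / mgf r * exp ((r + u) * Z y)" for y
    proof -
      have "exp (r * Z y - ln (mgf r)) * exp (u * (Z y + R)) = exp (u * R + (r + u) * Z y - ln (mgf r))"
        unfolding exp_add[symmetric] by (simp add: algebra_simps)
      then show ?thesis using mgf_pos[of r] r01 by (simp add: exp_add exp_diff)
    qed
    have "objective R r \<le> objective R (r + u)" using min ru by (auto simp: is_arg_min_def not_less)
    then have "ln (mgf r) \<le> u * R + ln (mgf (r + u))" by (simp add: objective_def algebra_simps)
    then have "exp (ln (mgf r)) \<le> exp (u * R + ln (mgf (r + u)))" by simp
    then have "mgf r \<le> exp (u * R) * mgf (r + u)"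
      using mgf_pos[of r] mgf_pos[of "r + u"] r01 ru by (simp add: exp_add)
    then have "1 \<le> exp (u * R) / mgf r * mgf (r + u)" using mgf_pos[of r] r01 by (simp add: field_simps)
    also have "\<dots> = T.expectation (\<lambda>y. exp (u * (Z y + R)))"
      by (subst integral_tilt, measurable) (simp only: eq integral_mult_right_zero mgf_def[of "r + u"])
    finally show "T.expectation (\<lambda>y. exp (u * (Z y + R))) \<ge> 1" .
    show "integrable (tilt r) (\<lambda>y. exp (u * (Z y + R)))"
      unfolding tilt_def using integrable_exp[of "r + u"] ru by (subst integrable_density) (auto simp: eq)
  qed
  \<comment> \<open>The sign of e selects the side from which 0 is approached. As the moment
    generating function is at least 1, the quotients are nonnegative on one side and nonpositive on
    the other, and the mean is squeezed to 0.\<close>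
  have lim: "(\<lambda>n. T.expectation (\<lambda>y. (exp (e * inverse (real (Suc n)) * (Z y + R)) - 1) / (e * inverse (real (Suc n)))))
      \<longlonglongrightarrow> T.expectation (\<lambda>y. Z y + R)" if e: "\<bar>e\<bar> = d" for e
  proof (rule integral_dominated_convergence[where w = "\<lambda>y. 1 / d * exp (2 * d * \<bar>Z y + R\<bar>)"])
    have e0: "e \<noteq> 0" using e d by auto
    let ?u = "\<lambda>n. e * inverse (real (Suc n))"
    show "AE y in tilt r. (\<lambda>n. (exp (?u n * (Z y + R)) - 1) / ?u n) \<longlonglongrightarrow> Z y + R"
    proof (rule AE_I2)
      fix y
      have "((\<lambda>t. exp (t * (Z y + R))) has_real_derivative Z y + R) (at 0)"
        by (auto intro!: derivative_eq_intros)
      then have "((\<lambda>t. (exp (t * (Z y + R)) - 1) / t) \<longlongrightarrow> Z y + R) (at 0)" by (simp add: DERIV_def)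
      moreover have "filterlim ?u (at 0) sequentially"
        unfolding filterlim_at using tendsto_mult_left[OF LIMSEQ_inverse_real_of_nat, of e] e0
        by (auto intro!: always_eventually)
      ultimately show "(\<lambda>n. (exp (?u n * (Z y + R)) - 1) / ?u n) \<longlonglongrightarrow> Z y + R" by (rule filterlim_compose)
    qed
    \<comment> \<open>Together with d |V| <= exp (d |V|) this produces the majorant exp (2 d |V|) /
      d for all quotients, where V = Z + R.\<close>
    have exp_le: "\<bar>exp x - 1\<bar> \<le> \<bar>x\<bar> * exp \<bar>x\<bar>" for x :: real
    proof (cases "x \<ge> 0")
      case True
      have "1 - x \<le> exp (- x)" using exp_ge_add_one_self[of "- x"] by simp
      then have "exp x * (1 - x) \<le> exp x * exp (- x)" by (intro mult_left_mono) auto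
      then have "exp x - 1 \<le> x * exp x" by (simp add: exp_minus field_simps)
      then show ?thesis using True by simp
    next
      case False
      have "exp x < 1" using False by simp
      then have "\<bar>exp x - 1\<bar> = 1 - exp x" by simp
      also have "\<dots> \<le> - x" using exp_ge_add_one_self[of x] by linarith
      also have "\<dots> = \<bar>x\<bar>" using False by simp
      finally have "\<bar>exp x - 1\<bar> \<le> \<bar>x\<bar>" .
      also have "\<dots> \<le> \<bar>x\<bar> * exp \<bar>x\<bar>" using mult_left_mono[of 1 "exp \<bar>x\<bar>" "\<bar>x\<bar>"] by simp
      finally show ?thesis .
    qed
    show "AE y in tilt r. norm ((exp (?u n * (Z y + R)) - 1) / ?u n) \<le> 1 / d * exp (2 * d * \<bar>Z y + R\<bar>)" for n
    proof (rule AE_I2)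
      fix y
      let ?V = "Z y + R"
      have u: "\<bar>?u n\<bar> \<le> d" "?u n \<noteq> 0"
        using e d(1) e0 by (auto simp: abs_mult field_simps)
      have "\<bar>exp (?u n * ?V) - 1\<bar> \<le> \<bar>?u n * ?V\<bar> * exp \<bar>?u n * ?V\<bar>" by (rule exp_le)
      also have "\<dots> \<le> \<bar>?u n * ?V\<bar> * exp (d * \<bar>?V\<bar>)"
        using u by (intro mult_left_mono) (auto simp: abs_mult intro: mult_right_mono)
      finally have "\<bar>exp (?u n * ?V) - 1\<bar> \<le> \<bar>?V\<bar> * exp (d * \<bar>?V\<bar>) * \<bar>?u n\<bar>" by (simp only: abs_mult mult_ac)
      then have "\<bar>exp (?u n * ?V) - 1\<bar> / \<bar>?u n\<bar> \<le> \<bar>?V\<bar> * exp (d * \<bar>?V\<bar>)"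
        using u(2) by (subst pos_divide_le_eq) auto
      also have "\<dots> = 1 / d * (d * \<bar>?V\<bar>) * exp (d * \<bar>?V\<bar>)" using d(1) by simp
      also have "\<dots> \<le> 1 / d * exp (d * \<bar>?V\<bar>) * exp (d * \<bar>?V\<bar>)"
      proof -
        have "d * \<bar>?V\<bar> \<le> exp (d * \<bar>?V\<bar>)" using exp_ge_add_one_self[of "d * \<bar>?V\<bar>"] by linarith
        then show ?thesis using d(1) by (intro mult_right_mono mult_left_mono) auto
      qed
      also have "\<dots> = 1 / d * exp (2 * d * \<bar>?V\<bar>)"
        unfolding mult.assoc exp_add[symmetric] by (simp add: mult.assoc)
      finally show "norm ((exp (?u n * ?V) - 1) / ?u n) \<le> 1 / d * exp (2 * d * \<bar>?V\<bar>)"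
        by (simp only: real_norm_def abs_divide)
    qed
    show "integrable (tilt r) (\<lambda>y. 1 / d * exp (2 * d * \<bar>Z y + R\<bar>))"
      using d by (intro integrable_mult_right integrable_tilt_exp) auto
  qed (auto simp: tilt_def)
  have quot: "T.expectation (\<lambda>y. (exp (u * (Z y + R)) - 1) / u) = (T.expectation (\<lambda>y. exp (u * (Z y + R))) - 1) / u"
    if "\<bar>u\<bar> \<le> d" for u
    using iu[OF that] T.prob_space by (simp only: integral_divide_zero) simp
  have small: "\<bar>e * inverse (real (Suc n))\<bar> \<le> d" if "\<bar>e\<bar> = d" for e n
    using that d(1) by (auto simp: abs_mult field_simps)
  show ?thesis
  proof (rule antisym)
    let ?E = "\<lambda>u. T.expectation (\<lambda>y. (exp (u * (Z y + R)) - 1) / u)"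
    show "T.expectation (\<lambda>y. Z y + R) \<le> 0"
    proof (rule LIMSEQ_le_const2[OF lim[of "- d"]])
      have "?E (- d * inverse (real (Suc n))) \<le> 0" for n
      proof -
        have u: "\<bar>- d * inverse (real (Suc n))\<bar> \<le> d" by (rule small) (use d in auto)
        moreover have "- d * inverse (real (Suc n)) < 0" using d(1) by simp
        ultimately show ?thesis using ge1[OF u] by (simp only: quot divide_nonneg_neg diff_ge_0_iff_ge)
      qed
      then show "\<exists>n0. \<forall>n\<ge>n0. ?E (- d * inverse (real (Suc n))) \<le> 0" by blast
    qed (use d in auto)
    show "T.expectation (\<lambda>y. Z y + R) \<ge> 0"
    proof (rule LIMSEQ_le_const[OF lim[of d]])
      have "0 \<le> ?E (d * inverse (real (Suc n)))" for n
      proof -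
        have u: "\<bar>d * inverse (real (Suc n))\<bar> \<le> d" by (rule small) (use d in auto)
        moreover have "0 < d * inverse (real (Suc n))" using d(1) by simp
        ultimately show ?thesis using ge1[OF u] by (simp only: quot divide_nonneg_pos diff_ge_0_iff_ge)
      qed
      then show "\<exists>n0. \<forall>n\<ge>n0. 0 \<le> ?E (d * inverse (real (Suc n)))" by blast
    qed (use d in auto)
  qed
qed

text \<open>If the second moment vanished, Z would be - R almost surely, also under N because
  tilting keeps the null sets, and the mean of - Z would equal R.\<close>

lemma tilt_variance_pos:
  assumes "r > 0" and int: "integrable N Z" and R: "R < expectation (\<lambda>y. - Z y)"
  shows "(\<integral>y. (Z y + R)\<^sup>2 \<partial>tilt r) > 0"
proof -
  have "0 \<le> (\<integral>y. (Z y + R)\<^sup>2 \<partial>tilt r)" by (intro integral_nonneg_AE) auto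
  moreover have "(\<integral>y. (Z y + R)\<^sup>2 \<partial>tilt r) \<noteq> 0"
  proof
    assume "(\<integral>y. (Z y + R)\<^sup>2 \<partial>tilt r) = 0"
    then have "AE y in tilt r. (Z y + R)\<^sup>2 = 0"
      using integral_nonneg_eq_0_iff_AE[OF integrable_tilt_moments(2)[OF assms(1)], of R] by auto
    then have "AE y in N. Z y + R = 0" by (simp add: AE_tilt)
    then have "AE y in N. - Z y = R" by eventually_elim auto
    then have "expectation (\<lambda>y. - Z y) = expectation (\<lambda>y. R)" by (intro integral_cong_AE) auto
    with R show False by (simp add: prob_space)
  qed
  ultimately show ?thesis by linarith
qed

end

section \<open>Sums of independent variables and lattices\<close>

definition sum_law :: "'y measure \<Rightarrow> ('y \<Rightarrow> real) \<Rightarrow> nat \<Rightarrow> real measure" where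
  "sum_law T V n = distr (Pi\<^sub>M {..<n} (\<lambda>_. T)) borel (\<lambda>y. \<Sum>i<n. V (y i))"

context prob_space
begin

lemma measurable_coordinate_sum:
  fixes V :: "'a \<Rightarrow> real"
  assumes "V \<in> borel_measurable M"
  shows "(\<lambda>y. \<Sum>i<n. V (y i)) \<in> borel_measurable (Pi\<^sub>M {..<n::nat} (\<lambda>_. M))"
  by (intro borel_measurable_sum measurable_coordinate[OF _ assms])

lemma real_distribution_sum_law:
  assumes "V \<in> borel_measurable M"
  shows "real_distribution (sum_law M V n)"
proof -
  interpret P: prob_space "Pi\<^sub>M {..<n} (\<lambda>_. M)" by (intro prob_space_PiM prob_space_axioms)
  show ?thesis unfolding sum_law_def
    by (rule P.real_distribution_distr) (rule measurable_coordinate_sum[OF assms])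
qed

lemma char_sum_law:
  assumes [measurable]: "V \<in> borel_measurable M"
  shows "char (sum_law M V n) t = char (distr M borel V) t ^ n"
proof -
  interpret Ms: product_sigma_finite "\<lambda>_::nat. M" ..
  have int: "integrable M (\<lambda>y. iexp (t * V y))"
    by (rule integrable_const_bound[where B = 1]) auto
  have "char (sum_law M V n) t = (\<integral>y. iexp (t * (\<Sum>i<n. V (y i))) \<partial>Pi\<^sub>M {..<n} (\<lambda>_. M))"
    unfolding char_def sum_law_def by (rule integral_distr) (use measurable_coordinate_sum in auto)
  also have "\<dots> = (\<integral>y. (\<Prod>i<n. iexp (t * V (y i))) \<partial>Pi\<^sub>M {..<n} (\<lambda>_. M))"
    by (simp add: sum_distrib_left exp_sum)
  also have "\<dots> = (\<Prod>i<n. \<integral>y. iexp (t * V y) \<partial>M)"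
    by (rule Ms.product_integral_prod) (use int in auto)
  also have "\<dots> = char (distr M borel V) t ^ n"
    unfolding char_def by (subst integral_distr) auto
  finally show ?thesis .
qed

lemma AE_sum_law_lattice:
  assumes V[measurable]: "V \<in> borel_measurable M" and lat: "AE y in M. \<exists>i::int. V y = a + real_of_int i * h"
  shows "AE x in sum_law M V n. \<exists>i::int. x = real n * a + real_of_int i * h"
  unfolding sum_law_def
proof (subst AE_distr_iff)
  have "AE y in Pi\<^sub>M {..<n} (\<lambda>_. M). \<forall>i\<in>{..<n}. \<exists>k::int. V (y i) = a + real_of_int k * h"
    by (intro AE_finite_allI finite_lessThan AE_PiM_component[where P = "\<lambda>y. \<exists>k::int. V y = a + real_of_int k * h"] lat prob_space_axioms)
  then show "AE y in Pi\<^sub>M {..<n} (\<lambda>_. M). \<exists>i::int. (\<Sum>i<n. V (y i)) = real n * a + real_of_int i * h"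
  proof eventually_elim
    case (elim y)
    then obtain k :: "nat \<Rightarrow> int" where "\<And>i. i < n \<Longrightarrow> V (y i) = a + real_of_int (k i) * h"
      by (metis lessThan_iff)
    then have "(\<Sum>i<n. V (y i)) = real n * a + real_of_int (\<Sum>i<n. k i) * h"
      by (simp add: sum.distrib sum_distrib_right)
    then show ?case by blast
  qed
qed (use measurable_coordinate_sum[OF V] in auto)

lemma integral_PiM_change_of_measure:
  fixes h :: "(nat \<Rightarrow> 'a) \<Rightarrow> real"
  assumes f[measurable]: "f \<in> borel_measurable M" and pos: "\<And>y. f y > 0"
    and D: "prob_space (density M (\<lambda>y. ennreal (f y)))"
    and h: "h \<in> borel_measurable (Pi\<^sub>M {..<n} (\<lambda>_. M))"
  shows "(\<integral>y. h y \<partial>Pi\<^sub>M {..<n} (\<lambda>_. M)) = (\<integral>y. h y / (\<Prod>i<n. f (y i)) \<partial>Pi\<^sub>M {..<n} (\<lambda>_. density M (\<lambda>y. ennreal (f y))))"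
proof -
  have pos': "(\<Prod>i<n. f (y i)) > 0" for y :: "nat \<Rightarrow> 'a" using pos by (intro prod_pos) auto
  have meas: "(\<lambda>y. \<Prod>i<n. f (y i)) \<in> borel_measurable (Pi\<^sub>M {..<n} (\<lambda>_. M))"
    by (intro borel_measurable_prod measurable_coordinate[OF _ f])
  have "Pi\<^sub>M {..<n} (\<lambda>_. density M (\<lambda>y. ennreal (f y))) = density (Pi\<^sub>M {..<n} (\<lambda>_. M)) (\<lambda>y. \<Prod>i\<in>{..<n}. ennreal (f (y i)))"
    by (rule PiM_density) (use sigma_finite_measure_axioms D prob_space_imp_sigma_finite in auto)
  also have "(\<lambda>y. \<Prod>i\<in>{..<n}. ennreal (f (y i))) = (\<lambda>y. ennreal (\<Prod>i<n. f (y i)))"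
    using pos by (intro ext prod_ennreal) (auto intro: less_imp_le)
  finally have eq: "Pi\<^sub>M {..<n} (\<lambda>_. density M (\<lambda>y. ennreal (f y))) = density (Pi\<^sub>M {..<n} (\<lambda>_. M)) (\<lambda>y. ennreal (\<Prod>i<n. f (y i)))" .
  have "(\<integral>y. h y / (\<Prod>i<n. f (y i)) \<partial>density (Pi\<^sub>M {..<n} (\<lambda>_. M)) (\<lambda>y. ennreal (\<Prod>i<n. f (y i))))
      = (\<integral>y. (\<Prod>i<n. f (y i)) *\<^sub>R (h y / (\<Prod>i<n. f (y i))) \<partial>Pi\<^sub>M {..<n} (\<lambda>_. M))"
    by (rule integral_density) (use h meas pos' in \<open>auto intro!: AE_I2 less_imp_le\<close>)
  also have "\<dots> = (\<integral>y. h y \<partial>Pi\<^sub>M {..<n} (\<lambda>_. M))"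
    using pos' by (intro Bochner_Integration.integral_cong refl) (simp add: less_imp_neq[THEN not_sym])
  finally show ?thesis unfolding eq ..
qed

end

section \<open>Recognising lattice distributions\<close>

text \<open>The equality case of the triangle inequality: after rotation by the argument y of the
  characteristic function, cos (t x - y) has mean 1 and hence equals 1 almost surely.\<close>

lemma (in real_distribution) lattice_if_cmod_char_eq_1:
  assumes t: "t \<noteq> 0" and c: "cmod (char M t) = 1"
  shows "\<exists>a. AE x in M. \<exists>i::int. x = a + real_of_int i * (2 * pi / \<bar>t\<bar>)"
proof -
  obtain y where y: "char M t = iexp y" using c complex_norm_eq_1_exp[of "char M t"] by metis
  have int: "integrable M (\<lambda>x. iexp (t * x - y))"
    by (rule integrable_const_bound[where B = 1]) auto
  have "expectation (\<lambda>x. iexp (t * x - y)) = expectation (\<lambda>x. iexp (t * x) * iexp (- y))"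
    by (intro Bochner_Integration.integral_cong refl) (simp add: exp_add[symmetric] algebra_simps)
  also have "\<dots> = char M t * iexp (- y)" unfolding char_def by (rule integral_mult_left_zero)
  also have "\<dots> = 1" unfolding y exp_add[symmetric] by simp
  finally have "Re (expectation (\<lambda>x. iexp (t * x - y))) = 1" by simp
  then have E: "expectation (\<lambda>x. cos (t * x - y)) = 1"
    using integral_Re[OF int] by (simp add: Re_exp)
  have ic: "integrable M (\<lambda>x. cos (t * x - y))"
    by (rule integrable_const_bound[where B = 1]) auto
  then have "integrable M (\<lambda>x. 1 - cos (t * x - y))" by simp
  moreover have "expectation (\<lambda>x. 1 - cos (t * x - y)) = 0"
    using ic E prob_space by simp
  ultimately have "AE x in M. 1 - cos (t * x - y) = 0"
    by (subst (asm) integral_nonneg_eq_0_iff_AE) auto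
  then have "AE x in M. \<exists>i::int. x = y / t + real_of_int i * (2 * pi / \<bar>t\<bar>)"
  proof eventually_elim
    case (elim x)
    then have "cos (t * x - y) = 1" by simp
    then obtain n :: int where n: "t * x - y = of_int n * 2 * pi" by (auto simp: cos_one_2pi_int)
    show ?case
    proof (cases "t > 0")
      case True
      then show ?thesis using n by (intro exI[of _ n]) (simp add: field_simps)
    next
      \<comment> \<open>For negative t the division by |t| flips the sign of the integer.\<close>
      case False
      then show ?thesis using n t by (intro exI[of _ "- n"]) (simp add: field_simps)
    qed
  qed
  then show ?thesis by blast
qed

text \<open>Two atoms of a non-degenerate lattice variable bound every admissible span by their distance,
  and every admissible span divides that distance; so the largest one is attained.\<close>

lemma (in prob_space) lattice_dist_exists:
  fixes Z :: "'a \<Rightarrow> real"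
  assumes Z[measurable]: "Z \<in> borel_measurable M"
    and supp: "supported_on_lattice M (\<lambda>\<omega>. ereal (Z \<omega>)) h0 a0" and h0: "h0 > 0"
    and nonconst: "\<not> (\<exists>v. AE \<omega> in M. Z \<omega> = v)"
  shows "\<exists>h a. lattice_dist M (\<lambda>\<omega>. ereal (Z \<omega>)) h a"
proof -
  let ?S = "supported_on_lattice M (\<lambda>\<omega>. ereal (Z \<omega>))"
  have supp_iff: "?S h a \<longleftrightarrow> (AE \<omega> in M. \<exists>i::int. Z \<omega> = a + real_of_int i * h)" for h a
    by (simp add: supported_on_lattice_def)
  have lat0: "AE \<omega> in M. \<exists>i::int. Z \<omega> = a0 + real_of_int i * h0" using supp by (simp add: supp_iff)
  \<comment> \<open>One of countably many lattice points must have positive probability; since Z is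
    not constant, there is a second such point.\<close>
  have "\<exists>i::int. \<not> (AE \<omega> in M. Z \<omega> \<noteq> a0 + real_of_int i * h0)"
  proof (rule ccontr)
    assume "\<not> ?thesis"
    then have "AE \<omega> in M. \<forall>i::int. Z \<omega> \<noteq> a0 + real_of_int i * h0" by (subst AE_all_countable) blast
    with lat0 have "AE \<omega> in M. False" by eventually_elim blast
    then show False by simp
  qed
  then obtain i :: int where i: "\<not> (AE \<omega> in M. Z \<omega> \<noteq> a0 + real_of_int i * h0)" by blast
  have "\<exists>j::int. j \<noteq> i \<and> \<not> (AE \<omega> in M. Z \<omega> \<noteq> a0 + real_of_int j * h0)"
  proof (rule ccontr)
    assume "\<not> ?thesis"
    then have "AE \<omega> in M. \<forall>j::int. j \<noteq> i \<longrightarrow> Z \<omega> \<noteq> a0 + real_of_int j * h0"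
      by (subst AE_all_countable) auto
    with lat0 have "AE \<omega> in M. Z \<omega> = a0 + real_of_int i * h0" by eventually_elim metis
    with nonconst show False by blast
  qed
  then obtain j :: int where j: "j \<noteq> i" "\<not> (AE \<omega> in M. Z \<omega> \<noteq> a0 + real_of_int j * h0)" by blast
  define d where "d = \<bar>real_of_int i - real_of_int j\<bar> * h0"
  have d: "d > 0" using j h0 by (simp add: d_def)
  have div: "\<exists>k::nat. k > 0 \<and> d = real k * h" if h: "h > 0" and s: "?S h a" for h a
  proof -
    have ex: "\<exists>k::int. a0 + real_of_int m * h0 = a + real_of_int k * h"
      if m: "\<not> (AE \<omega> in M. Z \<omega> \<noteq> a0 + real_of_int m * h0)" for m
    proof (rule ccontr)
      assume neg: "\<not> ?thesis"
      have "AE \<omega> in M. Z \<omega> \<noteq> a0 + real_of_int m * h0"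
        using s[unfolded supp_iff] by eventually_elim (use neg in metis)
      with m show False by blast
    qed
    obtain k1 k2 :: int where k: "a0 + real_of_int i * h0 = a + real_of_int k1 * h" "a0 + real_of_int j * h0 = a + real_of_int k2 * h"
      using ex[OF i] ex[OF j(2)] by blast
    then have "(real_of_int i - real_of_int j) * h0 = (real_of_int k1 - real_of_int k2) * h" by (simp add: algebra_simps)
    then have "\<bar>(real_of_int i - real_of_int j) * h0\<bar> = \<bar>(real_of_int k1 - real_of_int k2) * h\<bar>" by simp
    then have "d = \<bar>real_of_int k1 - real_of_int k2\<bar> * h" using h h0 by (simp add: d_def abs_mult)
    also have "\<bar>real_of_int k1 - real_of_int k2\<bar> = real (nat \<bar>k1 - k2\<bar>)" by simp
    finally have "d = real (nat \<bar>k1 - k2\<bar>) * h" .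
    moreover from this d have "nat \<bar>k1 - k2\<bar> > 0" by (intro gr0I) simp
    ultimately show ?thesis by blast
  qed
  \<comment> \<open>By \<open>div\<close> every admissible span is d / k for some positive integer
    k, so the largest span belongs to the least k.\<close>
  define P where "P k \<longleftrightarrow> k > 0 \<and> (\<exists>a. ?S (d / real k) a)" for k :: nat
  have P: "P k" if "k > 0" "d = real k * h" "?S h a" for k h a
  proof -
    have "d / real k = h" using that by simp
    then show ?thesis unfolding P_def using that by blast
  qed
  have "\<exists>k. P k" using div[OF h0 supp] P[OF _ _ supp] by blast
  then have L: "P (LEAST k. P k)" by (rule LeastI_ex)
  define k0 where "k0 = (LEAST k. P k)"
  obtain a where a: "k0 > 0" "?S (d / real k0) a"
    using L unfolding P_def k0_def by blast
  have "lattice_dist M (\<lambda>\<omega>. ereal (Z \<omega>)) (d / real k0) a"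
    unfolding lattice_dist_def
  proof (intro conjI allI impI)
    show "\<not> (\<exists>v. AE \<omega> in M. ereal (Z \<omega>) \<in> {- \<infinity>, ereal v})" using nonconst by simp
    show "d / real k0 > 0" using d a by simp
    show "?S (d / real k0) a" by (rule a)
    fix h' a' assume h': "h' > 0" "?S h' a'"
    obtain k where k: "k > 0" "d = real k * h'" using div[OF h'] by blast
    have "P k" by (rule P[OF k h'(2)])
    then have "k0 \<le> k" unfolding k0_def by (rule Least_le)
    then have "real k0 * h' \<le> d" using k h' by (simp add: mult_right_mono)
    then show "h' \<le> d / real k0" using a by (simp add: pos_le_divide_eq mult.commute)
  qed
  then show ?thesis by blast
qed

section \<open>Bounds for the limiting error function\<close>

text \<open>As an average of 1 - exp (- (u * s)) over s in [0, 1], \<open>g_s\<close> inherits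
  monotonicity, scaling and its bounds from pointwise estimates.\<close>

lemma g_s_has_integral:
  assumes "u > 0"
  shows "((\<lambda>s. 1 - exp (- (u * s))) has_integral g_s u) {0..1}"
proof -
  have "((\<lambda>s. 1 - exp (- (u * s))) has_integral (1 + exp (- (u * 1)) / u) - (0 + exp (- (u * 0)) / u)) {0..1}"
    by (rule fundamental_theorem_of_calculus)
       (use assms in \<open>auto intro!: derivative_eq_intros simp: has_real_derivative_iff_has_vector_derivative[symmetric]\<close>)
  also have "(1 + exp (- (u * 1)) / u) - (0 + exp (- (u * 0)) / u) = g_s u"
    using assms by (simp add: g_s_def diff_divide_distrib)
  finally show ?thesis .
qed

text \<open>Convexity of exp on the segment from 0 to - k t, at the fraction 1 / k of the
  way.\<close>

lemma one_minus_exp_scale: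
  fixes t k :: real
  assumes "k \<ge> 1" "t \<ge> 0"
  shows "1 - exp (- (k * t)) \<le> k * (1 - exp (- t))"
proof -
  have "exp ((1 - 1 / k) *\<^sub>R 0 + (1 / k) *\<^sub>R (- (k * t))) \<le> (1 - 1 / k) * exp 0 + (1 / k) * exp (- (k * t))"
    using assms by (intro convex_onD[OF exp_convex]) auto
  then have "exp (- t) \<le> (1 - 1 / k) + exp (- (k * t)) / k" using assms by simp
  then have "k * exp (- t) \<le> k * ((1 - 1 / k) + exp (- (k * t)) / k)" using assms by (intro mult_left_mono) auto
  also have "\<dots> = k - 1 + exp (- (k * t))" using assms by (simp add: distrib_left right_diff_distrib)
  finally show ?thesis by (simp add: algebra_simps)
qed

lemma g_s_mono: "0 < u \<Longrightarrow> u \<le> v \<Longrightarrow> g_s u \<le> g_s v"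
  by (rule has_integral_le[OF g_s_has_integral g_s_has_integral]) (auto intro: mult_right_mono)

lemma g_s_scale_le:
  assumes "u > 0" "k \<ge> 1"
  shows "g_s (k * u) \<le> k * g_s u"
proof (rule has_integral_le[OF g_s_has_integral has_integral_mult_right[OF g_s_has_integral]])
  show "1 - exp (- (k * u * s)) \<le> k * (1 - exp (- (u * s)))" if "s \<in> {0..1}" for s
    using one_minus_exp_scale[of k "u * s"] assms that by (simp add: mult.assoc)
qed (use assms in auto)

text \<open>Rounding M to an integer multiplies the argument of \<open>g_s\<close> by a factor k
  near 1; these bounds absorb it with a relative error independent of u.\<close>

lemma g_s_scale_bounds:
  assumes "u > 0" "k > 0"
  shows "min 1 k * g_s u \<le> g_s (k * u)" "g_s (k * u) \<le> max 1 k * g_s u"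
proof -
  show "g_s (k * u) \<le> max 1 k * g_s u"
    using assms g_s_scale_le[of u k] g_s_mono[of "k * u" u] by (cases "k \<ge> 1") auto
  show "min 1 k * g_s u \<le> g_s (k * u)"
  proof (cases "k \<ge> 1")
    case True
    then show ?thesis using g_s_mono[of u "k * u"] assms by simp
  next
    case False
    then have "g_s (1 / k * (k * u)) \<le> 1 / k * g_s (k * u)" using assms by (intro g_s_scale_le) auto
    then show ?thesis using False assms by (simp add: field_simps)
  qed
qed

text \<open>The integrand satisfies 1 - exp (- x) >= x exp (- x) at x = u s, and exp (- u s) >= exp
  (- u); the 1/2 is the integral of s. The form is the one that turns the error term of
  \<open>tie_error_approx\<close> into a relative error.\<close>

lemma g_s_ge:
  assumes "u > 0"
  shows "u * exp (- u) / 2 \<le> g_s u"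
proof (rule has_integral_le[OF _ g_s_has_integral[OF assms]])
  have "((\<lambda>s. s * (u * exp (- u))) has_integral (1\<^sup>2 / 2 * (u * exp (- u)) - 0\<^sup>2 / 2 * (u * exp (- u)))) {0..1}"
    by (rule fundamental_theorem_of_calculus)
       (auto intro!: derivative_eq_intros simp: has_real_derivative_iff_has_vector_derivative[symmetric])
  then show "((\<lambda>s. s * (u * exp (- u))) has_integral (u * exp (- u) / 2)) {0..1}" by simp
  show "s * (u * exp (- u)) \<le> 1 - exp (- (u * s))" if s: "s \<in> {0..1}" for s
  proof -
    have "s * (u * exp (- u)) \<le> u * s * exp (- (u * s))"
    proof -
      have "exp (- u) \<le> exp (- (u * s))" using s assms mult_left_le[of s u] by simp
      then have "u * s * exp (- u) \<le> u * s * exp (- (u * s))" using s assms by (intro mult_left_mono) auto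
      then show ?thesis by (simp add: mult_ac)
    qed
    also have "\<dots> = exp (- (u * s)) * (1 + u * s) - exp (- (u * s))" by (simp add: algebra_simps)
    also have "exp (- (u * s)) * (1 + u * s) \<le> exp (- (u * s)) * exp (u * s)"
      by (intro mult_left_mono exp_ge_add_one_self) auto
    also have "exp (- (u * s)) * exp (u * s) = 1" by (simp flip: exp_add)
    finally show ?thesis by simp
  qed
qed

lemma g_s_pos: "u > 0 \<Longrightarrow> g_s u > 0"
  by (rule less_le_trans[OF _ g_s_ge]) auto

lemma g_s_le: "u > 0 \<Longrightarrow> g_s u \<le> 1" "u > 0 \<Longrightarrow> g_s u \<le> u"
proof -
  assume u: "u > 0"
  have c: "((\<lambda>s::real. c) has_integral c) {0..1}" for c :: real using has_integral_const_real[of c 0 1] by simp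
  show "g_s u \<le> 1" by (rule has_integral_le[OF g_s_has_integral[OF u] c]) auto
  show "g_s u \<le> u"
  proof (rule has_integral_le[OF g_s_has_integral[OF u] c])
    show "1 - exp (- (u * s)) \<le> u" if "s \<in> {0..1}" for s
    proof -
      have "1 - exp (- (u * s)) \<le> u * s" using exp_ge_add_one_self[of "- (u * s)"] by linarith
      also have "\<dots> \<le> u" using that u by (simp add: mult_left_le)
      finally show ?thesis .
    qed
  qed
qed

text \<open>The difference between \<open>g_s (M q)\<close> and the tie error is (exp (- M q) - (1 -
  q)^M) / (M q). It is nonnegative by 1 - q <= exp (- q). By 1 - q >= exp (- q) (1 - q^2) and
  Bernoulli's inequality it is at most q exp (- M q), which is 2 / M times the lower bound in
  \<open>g_s_ge\<close>.\<close>

lemma tie_error_approx: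
  assumes q: "0 < q" "q \<le> 1" and M: "M > 0"
  shows "tie_error M q \<le> g_s (real M * q)" "(1 - 2 / real M) * g_s (real M * q) \<le> tie_error M q"
proof -
  let ?u = "real M * q"
  have u: "?u > 0" using q M by simp
  have diff: "g_s ?u - tie_error M q = (exp (- ?u) - (1 - q) ^ M) / ?u"
    by (simp add: g_s_def tie_error_def diff_divide_distrib)
  have eM: "exp (- q) ^ M = exp (- ?u)" by (simp add: exp_of_nat_mult[symmetric])
  have "(1 - q) ^ M \<le> exp (- q) ^ M"
    using q exp_ge_add_one_self[of "- q"] by (intro power_mono) auto
  then have "0 \<le> (exp (- ?u) - (1 - q) ^ M) / ?u" using u by (intro divide_nonneg_pos) (auto simp: eM)
  with diff show "tie_error M q \<le> g_s ?u" by linarith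
  have "1 - q\<^sup>2 = (1 - q) * (1 + q)" by (simp add: power2_eq_square algebra_simps)
  also have "\<dots> \<le> (1 - q) * exp q" using q by (intro mult_left_mono exp_ge_add_one_self) auto
  finally have "exp (- q) * (1 - q\<^sup>2) \<le> exp (- q) * ((1 - q) * exp q)" by (intro mult_left_mono) auto
  also have "\<dots> = 1 - q" by (simp add: exp_minus)
  finally have "(exp (- q) * (1 - q\<^sup>2)) ^ M \<le> (1 - q) ^ M"
    using q by (intro power_mono) (auto simp: power_le_one)
  moreover have "1 + real M * (- q\<^sup>2) \<le> (1 + (- q\<^sup>2)) ^ M"
    using q by (intro Bernoulli_inequality) (auto simp: power_le_one)
  then have "exp (- ?u) * (1 - real M * q\<^sup>2) \<le> exp (- ?u) * (1 - q\<^sup>2) ^ M" by (intro mult_left_mono) auto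
  ultimately have "exp (- ?u) * (1 - real M * q\<^sup>2) \<le> (1 - q) ^ M"
    by (simp only: power_mult_distrib eM)
  then have "exp (- ?u) - (1 - q) ^ M \<le> exp (- ?u) * (q * ?u)" by (simp add: algebra_simps power2_eq_square)
  then have "(exp (- ?u) - (1 - q) ^ M) / ?u \<le> exp (- ?u) * q"
    using u by (simp add: pos_divide_le_eq mult_ac)
  also have "\<dots> = 2 / real M * (?u * exp (- ?u) / 2)" using M by simp
  also have "\<dots> \<le> 2 / real M * g_s ?u" using g_s_ge[OF u] by (intro mult_left_mono) auto
  finally have "g_s ?u - tie_error M q \<le> 2 / real M * g_s ?u" unfolding diff .
  then show "(1 - 2 / real M) * g_s ?u \<le> tie_error M q" unfolding left_diff_distrib by linarith
qed

lemma g_s_rho_exp: "g_s_rho r (exp x) = exp (- (r * x)) * g_s (exp x)"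
  by (simp add: g_s_rho_def powr_def)

lemma g_s_rho_exp_pos: "g_s_rho r (exp x) > 0"
  by (simp add: g_s_rho_exp g_s_pos)

lemma isCont_g_s_rho_exp: "isCont (\<lambda>x. g_s_rho r (exp x)) x"
  unfolding g_s_rho_exp g_s_def by (intro continuous_intros) auto

text \<open>By g_s u <= 1 the function is at most exp (- r x), which decays to the right; by g_s u
  <= u it is at most exp ((1 - r) x), which decays to the left. Both ends of 0 < r < 1
  enter.\<close>

lemma g_s_rho_exp_bounds:
  assumes r: "0 < r" "r < 1"
  obtains C where "\<And>x. \<bar>g_s_rho r (exp x)\<bar> \<le> C / (1 + x\<^sup>2)" "\<And>x. \<bar>x * g_s_rho r (exp x)\<bar> \<le> C / (1 + x\<^sup>2)"
proof -
  define k where "k = min r (1 - r)"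
  have k: "k > 0" "k \<le> r" "k \<le> 1 - r" using r by (auto simp: k_def)
  have le: "g_s_rho r (exp x) \<le> exp (- (k * \<bar>x\<bar>))" for x
  proof (cases "x \<ge> 0")
    case True
    have "g_s_rho r (exp x) \<le> exp (- (r * x)) * 1" unfolding g_s_rho_exp by (intro mult_left_mono g_s_le) auto
    also have "\<dots> \<le> exp (- (k * \<bar>x\<bar>))" using True k by (simp add: mult_right_mono)
    finally show ?thesis .
  next
    case False
    have "g_s_rho r (exp x) \<le> exp (- (r * x)) * exp x" unfolding g_s_rho_exp by (intro mult_left_mono g_s_le) auto
    also have "\<dots> = exp ((1 - r) * x)" by (simp add: exp_add[symmetric] algebra_simps)
    also have "\<dots> \<le> exp (- (k * \<bar>x\<bar>))" using False k by (simp add: mult_right_mono_neg)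
    finally show ?thesis .
  qed
  \<comment> \<open>From y <= exp y at y = (k / 3) (1 + |x|), cubed. Two of the three powers of 1 +
    |x| pay for 1 + x^2 and one for the factor x.\<close>
  define C where "C = (3 / k) ^ 3 * exp k"
  have cube: "(1 + \<bar>x\<bar>) ^ 3 * exp (- (k * \<bar>x\<bar>)) \<le> C" for x
  proof -
    have "k / 3 * (1 + \<bar>x\<bar>) \<le> exp (k / 3 * (1 + \<bar>x\<bar>))"
      using exp_ge_add_one_self[of "k / 3 * (1 + \<bar>x\<bar>)"] by linarith
    then have "(k / 3 * (1 + \<bar>x\<bar>)) ^ 3 \<le> exp (k / 3 * (1 + \<bar>x\<bar>)) ^ 3" using k by (intro power_mono) auto
    also have "\<dots> = exp (k + k * \<bar>x\<bar>)" by (simp add: exp_of_nat_mult[symmetric] distrib_left)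
    finally have "(3 / k) ^ 3 * (k / 3 * (1 + \<bar>x\<bar>)) ^ 3 \<le> (3 / k) ^ 3 * exp (k + k * \<bar>x\<bar>)"
      using k by (intro mult_left_mono) auto
    moreover have "(3 / k) ^ 3 * (k / 3 * (1 + \<bar>x\<bar>)) ^ 3 = (1 + \<bar>x\<bar>) ^ 3"
    proof -
      have "3 / k * (k / 3 * (1 + \<bar>x\<bar>)) = 1 + \<bar>x\<bar>" using k by simp
      then show ?thesis by (simp only: power_mult_distrib[symmetric])
    qed
    ultimately have "(1 + \<bar>x\<bar>) ^ 3 * exp (- (k * \<bar>x\<bar>)) \<le> (3 / k) ^ 3 * exp (k + k * \<bar>x\<bar>) * exp (- (k * \<bar>x\<bar>))"
      by (intro mult_right_mono) auto
    also have "\<dots> = C" unfolding C_def mult.assoc exp_add[symmetric] by simp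
    finally show ?thesis .
  qed
  have main: "(1 + \<bar>x\<bar>) * g_s_rho r (exp x) \<le> C / (1 + x\<^sup>2)" for x
  proof -
    have "1 + x\<^sup>2 \<le> (1 + \<bar>x\<bar>)\<^sup>2" by (simp add: power2_eq_square algebra_simps)
    then have "(1 + \<bar>x\<bar>) * g_s_rho r (exp x) * (1 + x\<^sup>2) \<le> (1 + \<bar>x\<bar>) * exp (- (k * \<bar>x\<bar>)) * (1 + \<bar>x\<bar>)\<^sup>2"
      using le[of x] g_s_rho_exp_pos[of r x] by (intro mult_mono mult_left_mono) auto
    also have "\<dots> = (1 + \<bar>x\<bar>) ^ 3 * exp (- (k * \<bar>x\<bar>))" by (simp add: power2_eq_square power3_eq_cube)
    also have "\<dots> \<le> C" by (rule cube)
    finally show ?thesis by (subst pos_le_divide_eq) (auto simp: add_pos_nonneg)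
  qed
  show ?thesis
  proof (rule that)
    fix x
    have p: "g_s_rho r (exp x) > 0" by (rule g_s_rho_exp_pos)
    then have "\<bar>g_s_rho r (exp x)\<bar> \<le> (1 + \<bar>x\<bar>) * g_s_rho r (exp x)" "\<bar>x * g_s_rho r (exp x)\<bar> \<le> (1 + \<bar>x\<bar>) * g_s_rho r (exp x)"
      by (auto simp: abs_mult distrib_right)
    with main[of x] show "\<bar>g_s_rho r (exp x)\<bar> \<le> C / (1 + x\<^sup>2)" "\<bar>x * g_s_rho r (exp x)\<bar> \<le> C / (1 + x\<^sup>2)" by linarith+
  qed
qed

text \<open>Every translate of h Z meets [0, h], where the summand has a positive minimum, and all
  other terms are positive. Uniformity in x allows division by a main term whose phase moves with
  n.\<close>

lemma psi_lattice_lower_bound: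
  assumes r: "0 < r" "r < 1" and h: "h > 0"
  obtains c where "c > 0" "\<And>x. c \<le> psi_lattice r h x"
proof -
  let ?f = "\<lambda>x. g_s_rho r (exp x)"
  obtain C where C: "\<And>x. \<bar>?f x\<bar> \<le> C / (1 + x\<^sup>2)"
    by (rule g_s_rho_exp_bounds[OF r]) blast
  have C0: "C \<ge> 0" using order_trans[OF abs_ge_zero C[of 0]] by simp
  obtain D where D: "\<And>x. integrable (count_space UNIV) (\<lambda>i::int. 1 / (1 + (x + real_of_int i * h)\<^sup>2))"
    using lattice_sum_bound[OF h] unfolding abs_summable_on_def infsetsum_def by blast
  have sm: "(\<lambda>i::int. ?f (x + real_of_int i * h)) summable_on UNIV" for x
  proof -
    have "integrable (count_space UNIV) (\<lambda>i::int. ?f (x + real_of_int i * h))"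
      by (rule Bochner_Integration.integrable_bound[OF integrable_mult_right[OF D[of x], of C]])
         (use C C0 in \<open>auto intro!: AE_I2\<close>)
    then have "Infinite_Set_Sum.abs_summable_on (\<lambda>i::int. ?f (x + real_of_int i * h)) UNIV"
      by (simp add: abs_summable_on_def)
    then show ?thesis by (rule abs_summable_summable[OF abs_summable_equivalent[THEN iffD2]])
  qed
  have "continuous_on {0..h} ?f"
    using isCont_g_s_rho_exp by (intro continuous_at_imp_continuous_on) auto
  then have "\<exists>x0\<in>{0..h}. \<forall>y\<in>{0..h}. ?f x0 \<le> ?f y"
    using h by (intro continuous_attains_inf) auto
  then obtain x0 where x0: "\<And>y. y \<in> {0..h} \<Longrightarrow> ?f x0 \<le> ?f y" by blast
  show ?thesis
  proof (rule that)
    show "h * ?f x0 > 0" using h g_s_rho_exp_pos by simp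
    fix x
    define j where "j = - \<lfloor>x / h\<rfloor>"
    have "of_int \<lfloor>x / h\<rfloor> \<le> x / h" "x / h < of_int \<lfloor>x / h\<rfloor> + 1" by linarith+
    then have "of_int \<lfloor>x / h\<rfloor> * h \<le> x" "x < of_int \<lfloor>x / h\<rfloor> * h + h"
      by (simp_all only: pos_le_divide_eq[OF h] pos_divide_less_eq[OF h] distrib_right mult_1)
    then have "x + real_of_int j * h \<in> {0..h}" by (simp add: j_def)
    then have "?f x0 \<le> ?f (x + real_of_int j * h)" by (rule x0)
    also have "\<dots> = (\<Sum>i\<in>{j}. ?f (x + real_of_int i * h))" by simp
    also have "\<dots> \<le> (\<Sum>\<^sub>\<infinity>i\<in>UNIV. ?f (x + real_of_int i * h))"
      using g_s_rho_exp_pos by (intro finite_sum_le_infsum sm) (auto simp: less_imp_le)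
    finally have "h * ?f x0 \<le> h * (\<Sum>\<^sub>\<infinity>i\<in>UNIV. ?f (x + real_of_int i * h))" using h by (intro mult_left_mono) auto
    then show "h * ?f x0 \<le> psi_lattice r h x" by (simp only: psi_lattice_def infsum_cmult_right')
  qed
qed

lemma psi_nonlattice_pos:
  assumes r: "0 < r" "r < 1"
  shows "psi_nonlattice r > 0"
proof -
  obtain C where C: "\<And>x. \<bar>g_s_rho r (exp x)\<bar> \<le> C / (1 + x\<^sup>2)"
    by (rule g_s_rho_exp_bounds[OF r]) blast
  have C0: "C \<ge> 0" using order_trans[OF abs_ge_zero C[of 0]] by simp
  have meas: "(\<lambda>x. g_s_rho r (exp x)) \<in> borel_measurable borel"
    using isCont_g_s_rho_exp by (intro borel_measurable_continuous_onI continuous_at_imp_continuous_on) auto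
  have int: "integrable lborel (\<lambda>x. g_s_rho r (exp x))"
    by (rule Bochner_Integration.integrable_bound[OF integrable_cauchy_density[of C]])
       (use meas C C0 in \<open>auto intro!: AE_I2\<close>)
  have "0 \<le> psi_nonlattice r" unfolding psi_nonlattice_def
    by (intro integral_nonneg_AE AE_I2 less_imp_le g_s_rho_exp_pos)
  moreover have "psi_nonlattice r \<noteq> 0"
  proof
    assume "psi_nonlattice r = 0"
    then have "AE x in lborel. g_s_rho r (exp x) = 0"
      unfolding psi_nonlattice_def
      using integral_nonneg_eq_0_iff_AE[OF int] g_s_rho_exp_pos by (auto intro: less_imp_le)
    then have "AE x in (lborel :: real measure). False"
      by eventually_elim (use g_s_rho_exp_pos in \<open>force simp: less_le\<close>)
    then show False by (simp add: eventually_False ae_filter_eq_bot_iff)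
  qed
  ultimately show ?thesis by linarith
qed

section \<open>Asymptotic equivalence and assembly\<close>

text \<open>\<open>C\<close> may oscillate, so \<open>B\<close> need not converge; the lower bound c
  turns the vanishing difference into a ratio tending to 1. \<open>E\<close> carries the common
  exponential factor, positive only from n = 1 on because of a division by sqrt n.\<close>

lemma asymp_equiv_sandwich:
  fixes A B C D E :: "nat \<Rightarrow> real"
  assumes lower: "\<forall>\<^sub>F n in sequentially. l n * B n \<le> A n" and upper: "\<forall>\<^sub>F n in sequentially. A n \<le> u n * B n"
    and l: "l \<longlonglongrightarrow> 1" and u: "u \<longlonglongrightarrow> 1"
    and B: "(\<lambda>n. B n - C n) \<longlonglongrightarrow> 0" and C: "\<And>n. c \<le> C n" "c > 0"
    and E: "\<And>n. n > 0 \<Longrightarrow> E n > 0"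
  shows "(\<lambda>n. A n * E n) \<sim>[sequentially] (\<lambda>n. C n * E n)"
proof -
  have Cpos: "C n > 0" for n by (rule less_le_trans[OF C(2) C(1)])
  have "(\<lambda>n. (B n - C n) / C n) \<longlonglongrightarrow> 0"
  proof (rule Lim_null_comparison)
    show "\<forall>\<^sub>F n in sequentially. norm ((B n - C n) / C n) \<le> norm (B n - C n) / c"
    proof (rule always_eventually, rule allI)
      fix n
      have "norm ((B n - C n) / C n) = norm (B n - C n) / C n" using Cpos[of n] by simp
      also have "\<dots> \<le> norm (B n - C n) / c" using C by (intro divide_left_mono) (auto simp: Cpos)
      finally show "norm ((B n - C n) / C n) \<le> norm (B n - C n) / c" .
    qed
    show "(\<lambda>n. norm (B n - C n) / c) \<longlonglongrightarrow> 0"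
      using tendsto_divide[OF tendsto_norm[OF B] tendsto_const[of c]] C(2) by simp
  qed
  from tendsto_add[OF this tendsto_const[of 1]]
  have "(\<lambda>n. (B n - C n) / C n + 1) \<longlonglongrightarrow> 1" by simp
  moreover have "(B n - C n) / C n + 1 = B n / C n" for n using Cpos[of n] by (simp add: diff_divide_distrib)
  ultimately have BC: "(\<lambda>n. B n / C n) \<longlonglongrightarrow> 1" by simp
  have AC: "(\<lambda>n. A n / C n) \<longlonglongrightarrow> 1"
  proof (rule tendsto_sandwich)
    show "\<forall>\<^sub>F n in sequentially. l n * (B n / C n) \<le> A n / C n"
      using lower by eventually_elim (use Cpos in \<open>simp add: divide_right_mono less_imp_le\<close>)
    show "\<forall>\<^sub>F n in sequentially. A n / C n \<le> u n * (B n / C n)"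
      using upper by eventually_elim (use Cpos in \<open>simp add: divide_right_mono less_imp_le\<close>)
    show "(\<lambda>n. l n * (B n / C n)) \<longlonglongrightarrow> 1" using tendsto_mult[OF l BC] by simp
    show "(\<lambda>n. u n * (B n / C n)) \<longlonglongrightarrow> 1" using tendsto_mult[OF u BC] by simp
  qed
  show ?thesis
  proof (rule asymp_equivI', rule Lim_transform_eventually[OF AC])
    show "\<forall>\<^sub>F n in sequentially. A n / C n = A n * E n / (C n * E n)"
      using eventually_gt_at_top[of 0]
    proof eventually_elim
      case (elim n)
      then have "E n \<noteq> 0" using E[of n] by simp
      then show ?case by simp
    qed
  qed
qed

lemma nonpos_variable_output:
  assumes "memoryless_channel PX Q w" "singular_channel PX Q w"
  shows "nonpos_variable (output_law PX Q w) (\<lambda>y. ln (match_prob PX w y))"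
proof -
  interpret memoryless_channel PX Q w by fact
  interpret N: prob_space "output_law PX Q w" by (rule prob_space_output_law[OF assms(2)])
  have "ln (match_prob PX w y) \<le> 0" for y
    using match_prob_bounds[of y] by (cases "match_prob PX w y = 0") auto
  then show ?thesis
    by unfold_locales (auto simp: output_law_def)
qed

theorem theorem4:
  fixes PX :: "'x measure" and Q :: "'y measure" and w :: "'x \<Rightarrow> 'y \<Rightarrow> real"
    and R :: real and M :: "nat \<Rightarrow> nat"
  assumes "memoryless_channel PX Q w"
    and "finite_mutual_info PX Q w"
    and "singular_channel PX Q w"
    and "0 < R" and "R_crit PX Q w < R" and "R < mutual_info PX Q w"
    and "regular_channel PX Q w R"
    and "\<And>n. \<bar>real (M n) - exp (real n * R)\<bar> < 1"
  defines "r \<equiv> opt_rho PX Q w R"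
  shows
    "(\<forall>h' a'. WR_lattice PX Q w R h' a' \<longrightarrow>
        (\<lambda>n. P_RC PX Q w n (M n)) \<sim>[sequentially]
        (\<lambda>n. psi_lattice r h' (real n * (R + a')) / sqrt (2 * pi * real n * sigma00 PX Q w r)
              * exp (- real n * E_r PX Q w R))) \<and>
     (WR_nonlattice PX Q w R \<longrightarrow>
        (\<lambda>n. P_RC PX Q w n (M n)) \<sim>[sequentially]
        (\<lambda>n. psi_nonlattice r / sqrt (2 * pi * real n * sigma00 PX Q w r)
              * exp (- real n * E_r PX Q w R)))"
proof -
  note sing = assms(3)
  interpret memoryless_channel PX Q w by (rule assms(1))
  define N where "N = output_law PX Q w"
  define p where "p = match_prob PX w"
  define Z where "Z y = ln (p y)" for y
  interpret nonpos_variable N Z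
    unfolding N_def Z_def[abs_def] p_def by (rule nonpos_variable_output[OF assms(1) sing])
  have p_pos: "AE y in N. p y > 0" unfolding N_def p_def by (rule match_prob_pos[OF sing])
  have p_meas[measurable]: "p \<in> borel_measurable N"
    unfolding p_def N_def output_law_def using measurable_match_prob by simp
  note joint = integral_joint_law[OF sing, folded p_def N_def, folded Z_def]

  have int_Z: "integrable N Z" and R_lt: "R < expectation (\<lambda>y. - Z y)"
    using assms(2,6) joint[of "\<lambda>z. - z" 1] by (auto simp: finite_mutual_info_def mutual_info_def)
  have obj: "rate_objective PX Q w R = objective R"
  proof
    fix a show "rate_objective PX Q w R a = objective R a"
      using joint(1)[of "\<lambda>z. exp (a * z)" "1 / (1 + a)"]
      by (simp add: rate_objective_def Lam_def objective_def mgf_def)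
  qed
  have Lam: "Lam PX Q w a = ln (mgf a)" for a
    using obj[THEN fun_cong, of a] by (simp add: rate_objective_def objective_def)
  have min: "is_arg_min (objective R) (\<lambda>a. a \<in> {0<..1}) r"
    unfolding r_def opt_rho_def obj arg_min_on_def arg_min_def
    by (rule someI_ex[OF objective_min_exists[OF int_Z R_lt]])
  \<comment> \<open>With r = 1 the rate R would belong to the set whose supremum is
    \<open>R_crit\<close>, a set bounded above by the mutual information.\<close>
  have r1: "r \<noteq> 1"
  proof
    assume "r = 1"
    then have "R \<le> R_crit PX Q w"
      unfolding R_crit_def using min assms(4,6)
      by (intro cSup_upper bdd_aboveI[of _ "mutual_info PX Q w"]) (auto simp: obj)
    with assms(5) show False by simp
  qed
  then have r: "0 < r" "r < 1" using min by (auto simp: is_arg_min_def)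
  define V where "V y = Z y + R" for y
  define T where "T = tilt r"
  interpret T: prob_space T unfolding T_def using r by (intro prob_space_tilt) auto
  have sets_T[measurable_cong, simp]: "sets T = sets N" and space_T[simp]: "space T = space N" by (simp_all add: T_def)
  have V_meas[measurable]: "V \<in> borel_measurable N" unfolding V_def[abs_def] by simp
  have pT: "AE y in T. p y > 0" unfolding T_def AE_tilt by (rule p_pos)
  have ZT: "AE y in T. Z y \<le> 0" unfolding T_def AE_tilt by (rule Z_nonpos)
  define s where "s = (\<integral>y. (V y)\<^sup>2 \<partial>T)"
  have V_mean: "(\<integral>y. V y \<partial>T) = 0" unfolding V_def T_def by (rule tilt_mean_zero[OF min r1])
  have V_int: "integrable T V" "integrable T (\<lambda>y. (V y)\<^sup>2)"
    unfolding V_def[abs_def] T_def using r by (auto intro!: integrable_tilt_moments)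
  have s: "s > 0" unfolding s_def V_def T_def using r by (intro tilt_variance_pos int_Z R_lt) auto

  have E_tilted: "(\<integral>\<omega>. f (Zfun PX w (1 / (1 + r)) \<omega>) \<partial>tilted_law PX Q w r) = (\<integral>y. f (Z y) \<partial>T)"
    if [measurable]: "f \<in> borel_measurable borel" for f :: "real \<Rightarrow> real"
  proof -
    note [measurable] = measurable_Zfun
    have "(\<integral>\<omega>. f (Zfun PX w (1 / (1 + r)) \<omega>) \<partial>tilted_law PX Q w r)
        = (\<integral>\<omega>. exp (r * Zfun PX w (1 / (1 + r)) \<omega> - ln (mgf r)) * f (Zfun PX w (1 / (1 + r)) \<omega>) \<partial>joint_law PX Q w)"
      unfolding tilted_law_def Lam by (subst integral_density) auto
    also have "\<dots> = expectation (\<lambda>y. exp (r * Z y - ln (mgf r)) * f (Z y))"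
      by (rule joint(1)) measurable
    also have "\<dots> = (\<integral>y. f (Z y) \<partial>T)" unfolding T_def by (rule integral_tilt[symmetric]) measurable
    finally show ?thesis .
  qed
  \<comment> \<open>Because V = Z + R is centred, \<open>mu0\<close> is - R, and the second moment s
    of V is \<open>sigma00\<close>.\<close>
  have mu: "mu0 PX Q w r = - R"
  proof -
    have "mu0 PX Q w r = (\<integral>y. Z y \<partial>T)" unfolding mu0_def using E_tilted[of "\<lambda>z. z"] by simp
    moreover have "(\<integral>y. Z y \<partial>T) = (\<integral>y. V y - R \<partial>T)" by (simp add: V_def)
    moreover have "\<dots> = - R" using V_int(1) V_mean by (simp add: T.prob_space[simplified])
    ultimately show ?thesis by simp
  qed
  have sigma: "sigma00 PX Q w r = s"
    unfolding sigma00_def mu s_def V_def using E_tilted[of "\<lambda>z. (z - - R)\<^sup>2"] by simp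
  have Er: "E_r PX Q w R = - (r * R + ln (mgf r))"
    by (simp add: E_r_def rate_objective_def Lam r_def)

  let ?L = "sum_law T V"
  let ?D = "distr T borel V"
  interpret D: real_distribution ?D by (rule T.real_distribution_distr) measurable
  have L: "real_distribution (?L n)" for n by (rule T.real_distribution_sum_law) measurable
  have char_L: "char (?L n) t = char ?D t ^ n" for n t by (rule T.char_sum_law) measurable
  interpret D: centered_distribution ?D s
    by unfold_locales (use V_int V_mean s in \<open>simp_all add: integrable_distr_eq integral_distr s_def\<close>)

  define \<phi> where "\<phi> x = g_s_rho r (exp x)" for x
  have \<phi>_pos: "\<phi> x > 0" for x unfolding \<phi>_def by (rule g_s_rho_exp_pos)
  have \<phi>_cont: "isCont \<phi> x" for x unfolding \<phi>_def[abs_def] by (rule isCont_g_s_rho_exp)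
  have \<phi>_meas[measurable]: "\<phi> \<in> borel_measurable borel"
    using \<phi>_cont by (intro borel_measurable_continuous_onI continuous_at_imp_continuous_on) auto
  obtain C where C: "\<And>x. \<bar>\<phi> x\<bar> \<le> C / (1 + x\<^sup>2)" "\<And>x. \<bar>x * \<phi> x\<bar> \<le> C / (1 + x\<^sup>2)"
    unfolding \<phi>_def by (rule g_s_rho_exp_bounds[OF r]) blast
  have \<phi>_le: "\<phi> x \<le> C" for x
  proof -
    have "0 \<le> C" using order_trans[OF abs_ge_zero C(1)[of 0]] by simp
    then have "C / (1 + x\<^sup>2) \<le> C / 1" by (intro divide_left_mono) (auto simp: add_pos_nonneg)
    then show ?thesis using C(1)[of x] by linarith
  qed

  have M_pos: "M n > 0" for n
  proof -
    have "exp (real n * R) \<ge> 1" using assms(4) by simp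
    then show ?thesis using assms(8)[of n] by (intro gr0I) auto
  qed
  define k where "k n = real (M n) / exp (real n * R)" for n
  have k_pos: "k n > 0" for n using M_pos by (simp add: k_def)
  \<comment> \<open>The untilted integrand as a function of the sum x of the V: the matching
    probability is exp (x - n R), and exp (- (r * x)) comes from the reciprocal of the tilting
    density, up to the factor exp (- n E_r).\<close>
  define H where "H n x = exp (- (r * x)) * tie_error (M n) (exp (x - real n * R))" for n x
  have H_meas[measurable]: "H n \<in> borel_measurable borel" for n unfolding H_def[abs_def] tie_error_def by measurable
  have P_eq: "P_RC PX Q w n (M n) = exp (- real n * E_r PX Q w R) * (\<integral>x. H n x \<partial>?L n)" for n
  proof -
    let ?f = "\<lambda>y. exp (r * Z y - ln (mgf r))"
    have T_eq: "T = density N (\<lambda>y. ennreal (?f y))" by (simp add: T_def tilt_def)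
    have t_meas: "(\<lambda>y. tie_error (M n) (\<Prod>i<n. p (y i))) \<in> borel_measurable (Pi\<^sub>M {..<n} (\<lambda>_. N))"
      unfolding tie_error_def
      by (intro borel_measurable_diff borel_measurable_divide borel_measurable_power borel_measurable_times
            borel_measurable_const borel_measurable_prod measurable_coordinate[OF _ p_meas])
    have S_meas: "(\<lambda>y. \<Sum>i<n. V (y i)) \<in> borel_measurable (Pi\<^sub>M {..<n} (\<lambda>_. T))"
      by (rule T.measurable_coordinate_sum) measurable
    have "P_RC PX Q w n (M n) = (\<integral>y. tie_error (M n) (\<Prod>i<n. p (y i)) \<partial>Pi\<^sub>M {..<n} (\<lambda>_. N))"
      unfolding N_def p_def by (rule P_RC_singular[OF sing M_pos])
    also have "\<dots> = (\<integral>y. tie_error (M n) (\<Prod>i<n. p (y i)) / (\<Prod>i<n. ?f (y i)) \<partial>Pi\<^sub>M {..<n} (\<lambda>_. T))"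
      unfolding T_eq
      by (rule integral_PiM_change_of_measure) (use t_meas T.prob_space_axioms in \<open>auto simp: T_eq\<close>)
    also have "\<dots> = (\<integral>y. exp (- real n * E_r PX Q w R) * H n (\<Sum>i<n. V (y i)) \<partial>Pi\<^sub>M {..<n} (\<lambda>_. T))"
    proof (rule integral_cong_AE)
      have "AE y in Pi\<^sub>M {..<n} (\<lambda>_. T). \<forall>i\<in>{..<n}. p (y i) > 0"
        by (intro AE_finite_allI finite_lessThan AE_PiM_component[where P = "\<lambda>y. p y > 0"] T.prob_space_axioms pT) assumption
      then show "AE y in Pi\<^sub>M {..<n} (\<lambda>_. T). tie_error (M n) (\<Prod>i<n. p (y i)) / (\<Prod>i<n. ?f (y i))
          = exp (- real n * E_r PX Q w R) * H n (\<Sum>i<n. V (y i))"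
      proof eventually_elim
        case (elim y)
        let ?S = "\<Sum>i<n. V (y i)"
        have SZ: "(\<Sum>i<n. Z (y i)) = ?S - real n * R" by (simp add: V_def sum.distrib)
        have "(\<Prod>i<n. p (y i)) = exp (\<Sum>i<n. Z (y i))"
          unfolding exp_sum[OF finite_lessThan] using elim by (intro prod.cong) (auto simp: Z_def)
        then have 1: "(\<Prod>i<n. p (y i)) = exp (?S - real n * R)" by (simp only: SZ)
        have "(\<Prod>i<n. ?f (y i)) = exp (\<Sum>i<n. r * Z (y i) - ln (mgf r))"
          by (rule exp_sum[OF finite_lessThan, symmetric])
        also have "(\<Sum>i<n. r * Z (y i) - ln (mgf r)) = r * (?S - real n * R) - real n * ln (mgf r)"
          by (simp add: sum_subtractf sum_distrib_left[symmetric] SZ)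
        finally have 2: "1 / (\<Prod>i<n. ?f (y i)) = exp (- real n * E_r PX Q w R) * exp (- (r * ?S))"
          by (simp add: Er exp_minus[symmetric] exp_add[symmetric] divide_inverse algebra_simps)
        have "tie_error (M n) (\<Prod>i<n. p (y i)) / (\<Prod>i<n. ?f (y i))
            = 1 / (\<Prod>i<n. ?f (y i)) * tie_error (M n) (\<Prod>i<n. p (y i))" by simp
        then show ?case unfolding 1 2 H_def by (simp only: mult.assoc)
      qed
      have "(\<lambda>y. \<Prod>i<n. ?f (y i)) \<in> borel_measurable (Pi\<^sub>M {..<n} (\<lambda>_. N))"
        by (intro borel_measurable_prod measurable_coordinate) auto
      then show "(\<lambda>y. tie_error (M n) (\<Prod>i<n. p (y i)) / (\<Prod>i<n. ?f (y i))) \<in> borel_measurable (Pi\<^sub>M {..<n} (\<lambda>_. T))"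
        using t_meas by (subst measurable_cong_sets[OF sets_PiM_cong refl]) (auto intro!: borel_measurable_divide)
      show "(\<lambda>y. exp (- real n * E_r PX Q w R) * H n (\<Sum>i<n. V (y i))) \<in> borel_measurable (Pi\<^sub>M {..<n} (\<lambda>_. T))"
        using measurable_compose[OF S_meas H_meas] by (intro borel_measurable_times) auto
    qed
    also have "\<dots> = exp (- real n * E_r PX Q w R) * (\<integral>x. H n x \<partial>?L n)"
      unfolding sum_law_def by (subst integral_distr[OF S_meas]) (simp_all only: integral_mult_right_zero H_meas)
    finally show ?thesis .
  qed

  \<comment> \<open>\<open>tie_error_approx\<close> asks for q <= 1, that is x <= n R, which holds
    almost everywhere because Z <= 0. The condition M >= 2 makes 1 - 2 / M nonnegative.\<close>
  have H_bounds: "AE x in ?L n. (1 - 2 / real (M n)) * min 1 (k n) * \<phi> x \<le> H n x \<and> H n x \<le> max 1 (k n) * \<phi> x"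
    if M2: "real (M n) \<ge> 2" for n
  proof -
    have S_meas: "(\<lambda>y. \<Sum>i<n. V (y i)) \<in> borel_measurable (Pi\<^sub>M {..<n} (\<lambda>_. T))"
      by (rule T.measurable_coordinate_sum) measurable
    have "AE y in Pi\<^sub>M {..<n} (\<lambda>_. T). \<forall>i\<in>{..<n}. Z (y i) \<le> 0"
      by (intro AE_finite_allI finite_lessThan AE_PiM_component[where P = "\<lambda>y. Z y \<le> 0"] T.prob_space_axioms ZT) assumption
    then have "AE y in Pi\<^sub>M {..<n} (\<lambda>_. T). (\<Sum>i<n. V (y i)) \<le> real n * R"
    proof eventually_elim
      case (elim y)
      have "(\<Sum>i<n. V (y i)) \<le> (\<Sum>i<n. R)" using elim by (intro sum_mono) (auto simp: V_def)
      then show ?case by simp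
    qed
    then have "AE x in ?L n. x \<le> real n * R"
      unfolding sum_law_def by (subst AE_distr_iff[OF S_meas]) auto
    then show ?thesis
    proof eventually_elim
      case (elim x)
      have q: "0 < exp (x - real n * R)" "exp (x - real n * R) \<le> 1" using elim by auto
      have eq: "real (M n) * exp (x - real n * R) = k n * exp x" by (simp add: k_def exp_diff)
      note tie = tie_error_approx[OF q M_pos[of n], unfolded eq]
      note gs = g_s_scale_bounds[of "exp x", OF _ k_pos[of n], simplified]
      have "(1 - 2 / real (M n)) * (min 1 (k n) * g_s (exp x)) \<le> (1 - 2 / real (M n)) * g_s (k n * exp x)"
        using M2 gs(1) by (intro mult_left_mono) auto
      also note tie(2)
      finally have "exp (- (r * x)) * ((1 - 2 / real (M n)) * (min 1 (k n) * g_s (exp x))) \<le> H n x"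
        unfolding H_def by (intro mult_left_mono) auto
      moreover have "H n x \<le> exp (- (r * x)) * (max 1 (k n) * g_s (exp x))"
        unfolding H_def using tie(1) gs(2) by (intro mult_left_mono) auto
      ultimately show ?case unfolding \<phi>_def g_s_rho_exp by (simp only: mult_ac)
    qed
  qed

  have M_lim: "filterlim (\<lambda>n. real (M n)) at_top sequentially"
  proof (rule filterlim_at_top_mono)
    show "filterlim (\<lambda>n. exp (real n * R) - 1) at_top sequentially" using assms(4) by real_asymp
    show "\<forall>\<^sub>F n in sequentially. exp (real n * R) - 1 \<le> real (M n)"
      using assms(8) by (intro always_eventually allI) (smt (verit))
  qed
  have k_lim: "k \<longlonglongrightarrow> 1"
  proof -
    have "(\<lambda>n. k n - 1) \<longlonglongrightarrow> 0"
    proof (rule Lim_null_comparison)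
      show "\<forall>\<^sub>F n in sequentially. norm (k n - 1) \<le> exp (- (real n * R))"
      proof (rule always_eventually, rule allI)
        fix n
        have "k n - 1 = (real (M n) - exp (real n * R)) * exp (- (real n * R))"
          by (simp add: k_def exp_minus field_simps)
        then have "norm (k n - 1) = \<bar>real (M n) - exp (real n * R)\<bar> * exp (- (real n * R))" by (simp add: abs_mult)
        also have "\<dots> \<le> 1 * exp (- (real n * R))" using assms(8)[of n] by (intro mult_right_mono) auto
        finally show "norm (k n - 1) \<le> exp (- (real n * R))" by simp
      qed
      show "(\<lambda>n. exp (- (real n * R))) \<longlonglongrightarrow> 0" using assms(4) by real_asymp
    qed
    then show ?thesis by (rule LIM_zero_cancel)
  qed
  define l where "l n = (1 - 2 / real (M n)) * min 1 (k n)" for n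
  define u where "u n = max 1 (k n)" for n
  have l_lim: "l \<longlonglongrightarrow> 1"
  proof -
    have "(\<lambda>n. 2 / real (M n)) \<longlonglongrightarrow> 0"
      by (rule tendsto_divide_0[OF tendsto_const filterlim_at_top_imp_at_infinity[OF M_lim]])
    from tendsto_mult[OF tendsto_diff[OF tendsto_const[of 1] this] tendsto_min[OF tendsto_const[of 1] k_lim]]
    show ?thesis unfolding l_def[abs_def] by simp
  qed
  have u_lim: "u \<longlonglongrightarrow> 1"
    unfolding u_def[abs_def] using tendsto_max[OF tendsto_const[of 1] k_lim] by simp
  define B where "B n = sqrt (real n) * (\<integral>x. \<phi> x \<partial>?L n)" for n
  define A where "A n = sqrt (real n) * (\<integral>x. H n x \<partial>?L n)" for n
  have sandwich: "\<forall>\<^sub>F n in sequentially. l n * B n \<le> A n \<and> A n \<le> u n * B n"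
  proof -
    have "\<forall>\<^sub>F n in sequentially. real (M n) \<ge> 2" using M_lim unfolding filterlim_at_top by blast
    then show ?thesis
    proof eventually_elim
      case (elim n)
      interpret Ln: real_distribution "?L n" by (rule L)
      have [measurable_cong]: "sets (?L n) = sets borel" by simp
      note bd = H_bounds[OF elim, folded l_def u_def]
      have i\<phi>: "integrable (?L n) \<phi>"
        by (rule Ln.integrable_const_bound[where B = C])
           (use \<phi>_le \<phi>_pos in \<open>auto intro!: AE_I2 simp: abs_of_pos\<close>)
      have l0: "l n \<ge> 0" using elim k_pos[of n] by (simp add: l_def)
      have u0: "u n > 0" by (simp add: u_def less_max_iff_disj)
      have iH: "integrable (?L n) (H n)"
      proof (rule Bochner_Integration.integrable_bound[OF integrable_mult_right[OF i\<phi>, of "u n"]])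
        show "AE x in ?L n. norm (H n x) \<le> norm (u n * \<phi> x)"
          using bd
        proof eventually_elim
          case (elim x)
          have "0 \<le> l n * \<phi> x" using l0 \<phi>_pos[of x] by simp
          with elim show ?case by simp
        qed
      qed measurable
      have "l n * (\<integral>x. \<phi> x \<partial>?L n) = (\<integral>x. l n * \<phi> x \<partial>?L n)" by simp
      also have "\<dots> \<le> (\<integral>x. H n x \<partial>?L n)"
        using bd by (intro integral_mono_AE iH integrable_mult_right i\<phi>) auto
      finally have "sqrt (real n) * (l n * (\<integral>x. \<phi> x \<partial>?L n)) \<le> sqrt (real n) * (\<integral>x. H n x \<partial>?L n)"
        by (intro mult_left_mono) auto
      moreover have "(\<integral>x. H n x \<partial>?L n) \<le> (\<integral>x. u n * \<phi> x \<partial>?L n)"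
        using bd by (intro integral_mono_AE iH integrable_mult_right i\<phi>) auto
      then have "sqrt (real n) * (\<integral>x. H n x \<partial>?L n) \<le> sqrt (real n) * (u n * (\<integral>x. \<phi> x \<partial>?L n))"
        by (intro mult_left_mono) auto
      ultimately show ?case unfolding A_def B_def by (simp add: mult_ac)
    qed
  qed
  let ?P = "\<lambda>n. P_RC PX Q w n (M n)"
  let ?G = "\<lambda>psi n. psi n / sqrt (2 * pi * real n * sigma00 PX Q w r) * exp (- real n * E_r PX Q w R)"
  \<comment> \<open>\<open>psi\<close> depends on n to accommodate the lattice phase; in the
    nonlattice case it is constant.\<close>
  have transfer: "?P \<sim>[sequentially] ?G psi"
    if lim: "(\<lambda>n. B n - psi n / sqrt (2 * pi * s)) \<longlonglongrightarrow> 0" and c: "c > 0" "\<And>n. c \<le> psi n" for psi c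
  proof -
    let ?E = "\<lambda>n. exp (- real n * E_r PX Q w R) / sqrt (real n)"
    have sq: "sqrt (2 * pi * s) > 0" using s by simp
    have "(\<lambda>n. A n * ?E n) \<sim>[sequentially] (\<lambda>n. psi n / sqrt (2 * pi * s) * ?E n)"
    proof (rule asymp_equiv_sandwich[OF _ _ l_lim u_lim lim])
      show "c / sqrt (2 * pi * s) \<le> psi n / sqrt (2 * pi * s)" for n using c(2)[of n] sq by (intro divide_right_mono) auto
      show "c / sqrt (2 * pi * s) > 0" using c(1) sq by simp
    qed (use sandwich in \<open>auto elim: eventually_mono\<close>)
    also have "(\<lambda>n. psi n / sqrt (2 * pi * s) * ?E n)
        = ?G psi"
      by (intro ext) (simp add: sigma real_sqrt_mult)
    finally have "(\<lambda>n. A n * ?E n) \<sim>[sequentially]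
        ?G psi" .
    moreover have "?P \<sim>[sequentially] (\<lambda>n. A n * ?E n)"
    proof (rule asymp_equiv_refl_ev)
      show "\<forall>\<^sub>F n in sequentially. P_RC PX Q w n (M n) = A n * ?E n"
        using eventually_gt_at_top[of 0] by eventually_elim (simp add: P_eq A_def)
    qed
    ultimately show ?thesis by (rule asymp_equiv_trans[rotated])
  qed

  have [measurable_cong]: "sets (output_law PX Q w) = sets N" by (simp add: N_def)
  \<comment> \<open>Deduced from the image under \<open>snd\<close>, the output law, which is a
    probability measure.\<close>
  interpret J: prob_space "joint_law PX Q w"
  proof (rule prob_space_distrD)
    show "snd \<in> measurable (joint_law PX Q w) Q" by (simp add: joint_law_def)
    show "prob_space (distr (joint_law PX Q w) Q snd)"
      unfolding distr_joint_law_snd[OF sing] by (rule prob_space_output_law[OF sing])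
  qed
  let ?J = "joint_law PX Q w"
  let ?Zf = "\<lambda>\<omega>. Zfun PX w (1 / (1 + r)) \<omega>"
  let ?S = "supported_on_lattice ?J (\<lambda>\<omega>. ereal (?Zf \<omega>))"
  have Zf: "AE \<omega> in ?J. ?Zf \<omega> = Z (snd \<omega>)"
    using Zfun_eq[OF sing, of "1 / (1 + r)"] by (simp add: Z_def p_def)
  have joint_iff: "(AE \<omega> in ?J. P (?Zf \<omega>)) \<longleftrightarrow> (AE y in N. P (Z y))" for P
  proof
    assume "AE \<omega> in ?J. P (?Zf \<omega>)"
    with Zf have "AE \<omega> in ?J. P (Z (snd \<omega>))" by eventually_elim simp
    then show "AE y in N. P (Z y)" unfolding N_def by (rule AE_output_of_joint_law[OF sing])
  next
    assume "AE y in N. P (Z y)"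
    then have "AE \<omega> in ?J. P (Z (snd \<omega>))"
      unfolding N_def by (rule AE_joint_law_of_output[OF sing])
    with Zf show "AE \<omega> in ?J. P (?Zf \<omega>)" by eventually_elim simp
  qed
  have supp_iff: "?S h a
      \<longleftrightarrow> (AE y in N. \<exists>i::int. Z y = a + real_of_int i * h)" for h a
    using joint_iff[of "\<lambda>z. \<exists>i::int. z = a + real_of_int i * h"] by (simp add: supported_on_lattice_def)
  \<comment> \<open>If Z were constant, V would be too, and equal to its mean 0, against s >
    0.\<close>
  have nonconst: "\<not> (\<exists>v. AE \<omega> in ?J. ?Zf \<omega> = v)"
  proof
    assume "\<exists>v. AE \<omega> in ?J. ?Zf \<omega> = v"
    then obtain v where "AE y in N. Z y = v" using joint_iff[of "\<lambda>z. z = _"] by blast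
    then have v: "AE y in T. V y = v + R" unfolding T_def AE_tilt by eventually_elim (simp add: V_def)
    then have "(\<integral>y. V y \<partial>T) = (\<integral>y. v + R \<partial>T)" by (intro integral_cong_AE) auto
    then have "v + R = 0" using V_mean T.prob_space by simp
    then have "s = (\<integral>y. 0 \<partial>T)" unfolding s_def using v by (intro integral_cong_AE) auto
    with s show False by simp
  qed
  \<comment> \<open>Modulus 1 at t puts V on a lattice of span 2 pi / |t|, hence Z as well, with the
    offset shifted by R.\<close>
  have cmod_1: "\<exists>a. ?S (2 * pi / \<bar>t\<bar>) a"
    if t: "t \<noteq> 0" and not_less: "\<not> cmod (char ?D t) < 1" for t
  proof -
    have "cmod (char ?D t) = 1" using D.cmod_char_le_1[of t] not_less by linarith
    then obtain a where "AE x in ?D. \<exists>i::int. x = a + real_of_int i * (2 * pi / \<bar>t\<bar>)"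
      using D.lattice_if_cmod_char_eq_1[OF t] by blast
    then have "AE y in T. \<exists>i::int. V y = a + real_of_int i * (2 * pi / \<bar>t\<bar>)"
      by (rule AE_distrD[rotated]) simp
    then have "AE y in N. \<exists>i::int. V y = a + real_of_int i * (2 * pi / \<bar>t\<bar>)" unfolding T_def AE_tilt .
    then have "AE y in N. \<exists>i::int. Z y = (a - R) + real_of_int i * (2 * pi / \<bar>t\<bar>)"
      by eventually_elim (auto simp: V_def algebra_simps)
    then show ?thesis unfolding supp_iff by blast
  qed
  have lattice: "?P \<sim>[sequentially] ?G (\<lambda>n. psi_lattice r h (real n * (R + a)))"
    if lat: "WR_lattice PX Q w R h a" for h a
  proof -
    have ld: "lattice_dist ?J (\<lambda>\<omega>. ereal (?Zf \<omega>)) h a"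
      using lat by (simp add: WR_lattice_def r_def)
    then have h: "h > 0" and supp: "?S h a"
      and max: "\<And>h' a'. h' > 0 \<Longrightarrow> ?S h' a' \<Longrightarrow> h' \<le> h"
      unfolding lattice_dist_def by blast+
    \<comment> \<open>Modulus 1 at such a t would give a lattice of span 2 pi / |t| >= 2 h, against
      the maximality of h.\<close>
    have lt1: "cmod (char ?D t) < 1" if t: "t \<noteq> 0" "\<bar>t\<bar> \<le> pi / h" for t
    proof (rule ccontr)
      assume "\<not> cmod (char ?D t) < 1"
      then obtain a' where "?S (2 * pi / \<bar>t\<bar>) a'"
        using cmod_1[OF t(1)] by blast
      then have "2 * pi / \<bar>t\<bar> \<le> h" by (intro max) (use t in auto)
      then have "2 * pi \<le> h * \<bar>t\<bar>" using t(1) by (simp add: pos_divide_le_eq)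
      also have "\<dots> \<le> h * (pi / h)" using t(2) h by (intro mult_left_mono) auto
      also have "\<dots> = pi" using h by simp
      finally show False using pi_gt_zero by linarith
    qed
    have "AE y in T. \<exists>i::int. V y = (R + a) + real_of_int i * h"
      unfolding T_def AE_tilt using supp[unfolded supp_iff] by eventually_elim (auto simp: V_def)
    then have lat_L: "AE x in ?L n. \<exists>i::int. x = real n * (R + a) + real_of_int i * h" for n
      by (intro T.AE_sum_law_lattice) measurable
    have "(\<lambda>n. B n - h * (\<Sum>\<^sub>\<infinity>i\<in>(UNIV::int set). \<phi> (real n * (R + a) + real_of_int i * h)) / sqrt (2 * pi * s)) \<longlonglongrightarrow> 0"
      unfolding B_def by (rule D.local_limit_lattice[OF h lt1 L char_L lat_L \<phi>_meas C])
    then have "(\<lambda>n. B n - psi_lattice r h (real n * (R + a)) / sqrt (2 * pi * s)) \<longlonglongrightarrow> 0"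
      by (simp only: psi_lattice_def infsum_cmult_right' \<phi>_def)
    moreover obtain c where "c > 0" "\<And>x. c \<le> psi_lattice r h x"
      by (rule psi_lattice_lower_bound[OF r h]) blast
    ultimately show ?thesis by (intro transfer[of "\<lambda>n. psi_lattice r h (real n * (R + a))" c]) auto
  qed
  have nonlattice: "?P \<sim>[sequentially] ?G (\<lambda>n. psi_nonlattice r)"
    if nl: "WR_nonlattice PX Q w R"
  proof -
    \<comment> \<open>Modulus 1 puts Z on some lattice, but \<open>WR_lattice\<close> also asks for
      a largest span; \<open>lattice_dist_exists\<close> supplies it.\<close>
    have lt1: "cmod (char ?D t) < 1" if t: "t \<noteq> 0" for t
    proof (rule ccontr)
      assume "\<not> cmod (char ?D t) < 1"
      then obtain a where a: "?S (2 * pi / \<bar>t\<bar>) a"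
        using cmod_1[OF t] by blast
      have "\<exists>h a. lattice_dist ?J (\<lambda>\<omega>. ereal (?Zf \<omega>)) h a"
        by (rule J.lattice_dist_exists[OF measurable_Zfun a _ nonconst]) (use t in simp)
      with nl show False by (simp add: WR_nonlattice_def WR_lattice_def r_def)
    qed
    have "B \<longlonglongrightarrow> (LBINT x. \<phi> x) / sqrt (2 * pi * s)"
      unfolding B_def[abs_def] by (rule D.local_limit_nonlattice[OF lt1 L char_L \<phi>_cont C(1)])
    then have "(\<lambda>n. B n - psi_nonlattice r / sqrt (2 * pi * s)) \<longlonglongrightarrow> 0"
      unfolding psi_nonlattice_def \<phi>_def by (rule LIM_zero)
    then show ?thesis by (rule transfer[OF _ psi_nonlattice_pos[OF r]]) simp
  qed
  show ?thesis using lattice nonlattice by blast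
qed

end
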